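(* Let $R$ be a commutative Noetherian ring and let $M$ be a finitely generated $R$-module such that $\operatorname{qpd}_RM<\infty$. Then $\operatorname{Ext}^i_R(M,M)=0$ for all $i>0$ if and only if $M$ is projective.
   Context: For a complex $X$ of $R$-modules put $\sup X=\sup\{i: X_i\neq 0\}$, $\inf X=\inf\{i: X_i\neq0\}$ and $\operatorname{hsup}X=\sup\{i: H_i(X)\neq0\}$. A quasi-projective resolution of an $R$-module $M$ is a bounded below complex $P$ of projective $R$-modules such that for all $i\ge\inf P$ there are integers $a_i\ge0$, not all zero, with $H_i(P)\cong M^{\oplus a_i}$; it is finite if $P$ is bounded. The quasi-projective dimension of $M\ne0$ is $\operatorname{qpd}_RM=\inf\{\sup P-\operatorname{hsup}P : P \text{ a finite quasi-projective resolution of } M\}$ (so $=\infty$ if there is no finite quasi-projective resolution), and $\operatorname{qpd}_R 0=-\infty$. The notation $\operatorname{qpd}_RM<\infty$ includes the case $-\infty$. *)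

theory Defs
  imports "HOL-Library.Extended_Real" "HOL-Algebra.Algebra"
begin

section \<open>Modules\<close>

definition zero_module :: "('a, 'b, 'm) module_scheme \<Rightarrow> bool" where
  "zero_module M \<longleftrightarrow> carrier M = {\<zero>\<^bsub>M\<^esub>}"

definition finitely_generated_module ::
  "('a, 'r) ring_scheme \<Rightarrow> ('a, 'b, 'm) module_scheme \<Rightarrow> bool" where
  "finitely_generated_module R M \<longleftrightarrow>
     (\<exists>A \<subseteq> carrier M. finite A \<and> carrier M = \<Inter>{H. submodule H R M \<and> A \<subseteq> H})"

definition mod_hom ::
  "('a, 'r) ring_scheme \<Rightarrow> ('a, 'b, 'm) module_scheme \<Rightarrow> ('a, 'c, 'n) module_scheme \<Rightarrow> ('b \<Rightarrow> 'c) set" where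
  "mod_hom R M N = {f \<in> carrier M \<rightarrow> carrier N.
     (\<forall>x\<in>carrier M. \<forall>y\<in>carrier M. f (x \<oplus>\<^bsub>M\<^esub> y) = f x \<oplus>\<^bsub>N\<^esub> f y) \<and>
     (\<forall>r\<in>carrier R. \<forall>x\<in>carrier M. f (r \<odot>\<^bsub>M\<^esub> x) = r \<odot>\<^bsub>N\<^esub> f x)}"

definition mod_iso ::
  "('a, 'r) ring_scheme \<Rightarrow> ('a, 'b, 'm) module_scheme \<Rightarrow> ('a, 'c, 'n) module_scheme \<Rightarrow> bool" where
  "mod_iso R M N \<longleftrightarrow> (\<exists>f \<in> mod_hom R M N. bij_betw f (carrier M) (carrier N))"

text \<open>The ring part of the record type of modules has the fields \<open>mult\<close> and \<open>one\<close>, which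
  play no role for modules; they are left unspecified in the constructions below.\<close>

definition mod_power :: "nat \<Rightarrow> ('a, 'b, 'm) module_scheme \<Rightarrow> ('a, nat \<Rightarrow> 'b) module" where
  "mod_power n M =
     \<lparr>carrier = {..<n} \<rightarrow>\<^sub>E carrier M, monoid.mult = undefined, monoid.one = undefined,
      ring.zero = (\<lambda>k\<in>{..<n}. \<zero>\<^bsub>M\<^esub>),
      ring.add = (\<lambda>x y. \<lambda>k\<in>{..<n}. x k \<oplus>\<^bsub>M\<^esub> y k),
      module.smult = (\<lambda>r x. \<lambda>k\<in>{..<n}. r \<odot>\<^bsub>M\<^esub> x k)\<rparr>"

definition mod_quotient :: "('a, 'b, 'm) module_scheme \<Rightarrow> 'b set \<Rightarrow> ('a, 'b set) module" where
  "mod_quotient M H =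
     \<lparr>carrier = a_rcosets\<^bsub>M\<^esub> H, monoid.mult = undefined, monoid.one = undefined,
      ring.zero = H,
      ring.add = set_add M,
      module.smult = (\<lambda>r C. \<Union>x\<in>C. H +>\<^bsub>M\<^esub> (r \<odot>\<^bsub>M\<^esub> x))\<rparr>"

definition mod_Hom ::
  "('a, 'r) ring_scheme \<Rightarrow> ('a, 'b, 'm) module_scheme \<Rightarrow> ('a, 'c, 'n) module_scheme \<Rightarrow>
     ('a, 'b \<Rightarrow> 'c) module" where
  "mod_Hom R M N =
     \<lparr>carrier = mod_hom R M N \<inter> extensional (carrier M), monoid.mult = undefined, monoid.one = undefined,
      ring.zero = (\<lambda>x\<in>carrier M. \<zero>\<^bsub>N\<^esub>),
      ring.add = (\<lambda>f g. \<lambda>x\<in>carrier M. f x \<oplus>\<^bsub>N\<^esub> g x),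
      module.smult = (\<lambda>r f. \<lambda>x\<in>carrier M. r \<odot>\<^bsub>N\<^esub> f x)\<rparr>"

text \<open>HOL cannot quantify over all types inside a definition, so the modules \<open>A\<close>, \<open>B\<close> in the
  lifting property, and the modules in the projective resolutions used to define Ext, are taken on
  a fixed type.  For modules on \<open>'b\<close> over a ring on \<open>'a\<close> the type \<open>('a + 'b) list\<close> is large
  enough: it is infinite and at least as large as \<open>'a\<close> and \<open>'b\<close>, so it accommodates \<open>P\<close>, the free
  modules on at most that many generators, and their submodules and quotients.\<close>

type_synonym ('a, 'b) universe = "('a + 'b) list"

definition projective_module :: "('a, 'r) ring_scheme \<Rightarrow> ('a, 'b, 'm) module_scheme \<Rightarrow> bool" where
  "projective_module R P \<longleftrightarrow> module R P \<and>
     (\<forall>(A :: ('a, ('a, 'b) universe) module) (B :: ('a, ('a, 'b) universe) module) g f.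
        module R A \<longrightarrow> module R B \<longrightarrow>
        g \<in> mod_hom R A B \<longrightarrow> g ` carrier A = carrier B \<longrightarrow> f \<in> mod_hom R P B \<longrightarrow>
        (\<exists>h \<in> mod_hom R P A. \<forall>x\<in>carrier P. g (h x) = f x))"


section \<open>Complexes\<close>

record ('a, 'b) mod_complex =
  obj :: "int \<Rightarrow> ('a, 'b) module"
  bd :: "int \<Rightarrow> 'b \<Rightarrow> 'b"

definition is_complex :: "('a, 'r) ring_scheme \<Rightarrow> ('a, 'b) mod_complex \<Rightarrow> bool" where
  "is_complex R C \<longleftrightarrow>
     (\<forall>i. module R (obj C i)) \<and>
     (\<forall>i. bd C i \<in> mod_hom R (obj C i) (obj C (i - 1))) \<and>
     (\<forall>i. \<forall>x\<in>carrier (obj C i). bd C (i - 1) (bd C i x) = \<zero>\<^bsub>obj C (i - 2)\<^esub>)"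

definition homology :: "('a, 'b) mod_complex \<Rightarrow> int \<Rightarrow> ('a, 'b set) module" where
  "homology C i =
     mod_quotient ((obj C i)\<lparr>carrier := a_kernel (obj C i) (obj C (i - 1)) (bd C i)\<rparr>)
       (bd C (i + 1) ` carrier (obj C (i + 1)))"

definition csup :: "('a, 'b) mod_complex \<Rightarrow> ereal" where
  "csup C = (SUP i\<in>{i. \<not> zero_module (obj C i)}. ereal (of_int i))"

definition cinf :: "('a, 'b) mod_complex \<Rightarrow> ereal" where
  "cinf C = (INF i\<in>{i. \<not> zero_module (obj C i)}. ereal (of_int i))"

definition hsup :: "('a, 'b) mod_complex \<Rightarrow> ereal" where
  "hsup C = (SUP i\<in>{i. \<not> zero_module (homology C i)}. ereal (of_int i))"


section \<open>Ext\<close>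

definition projective_resolution ::
  "('a, 'r) ring_scheme \<Rightarrow> ('a, 'b, 'm) module_scheme \<Rightarrow> ('a, 'c) mod_complex \<Rightarrow> bool" where
  "projective_resolution R M F \<longleftrightarrow>
     is_complex R F \<and>
     (\<forall>i. projective_module R (obj F i)) \<and>
     (\<forall>i<0. zero_module (obj F i)) \<and>
     (\<forall>i>0. zero_module (homology F i)) \<and>
     (\<exists>e \<in> mod_hom R (obj F 0) M. e ` carrier (obj F 0) = carrier M \<and>
        a_kernel (obj F 0) M e = bd F 1 ` carrier (obj F 1))"

definition Hom_complex ::
  "('a, 'r) ring_scheme \<Rightarrow> ('a, 'b) mod_complex \<Rightarrow> ('a, 'c, 'n) module_scheme \<Rightarrow>
     ('a, 'b \<Rightarrow> 'c) mod_complex" where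
  "Hom_complex R F N =
     \<lparr>obj = (\<lambda>j. mod_Hom R (obj F (- j)) N),
      bd = (\<lambda>j f. \<lambda>x\<in>carrier (obj F (1 - j)). f (bd F (1 - j) x))\<rparr>"

text \<open>Cohomological degree \<open>i\<close> is homological degree \<open>- i\<close>; the usual signs in the differential of
  the Hom complex do not affect kernels and images and are omitted.  Every module on \<open>'b\<close> has a
  projective resolution on \<open>('a, 'b) universe\<close>, so the choice below is a proper one, and it
  determines Ext up to isomorphism.\<close>

definition Ext ::
  "('a, 'r) ring_scheme \<Rightarrow> nat \<Rightarrow> ('a, 'b, 'm) module_scheme \<Rightarrow> ('a, 'c, 'n) module_scheme \<Rightarrow>
     ('a, (('a, 'b) universe \<Rightarrow> 'c) set) module" where
  "Ext R i M N =
     homology (Hom_complex R (SOME F. projective_resolution R M F) N) (- int i)"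


section \<open>Quasi-projective dimension\<close>

definition quasi_projective_resolution ::
  "('a, 'r) ring_scheme \<Rightarrow> ('a, 'b, 'm) module_scheme \<Rightarrow> ('a, 'p) mod_complex \<Rightarrow> bool" where
  "quasi_projective_resolution R M P \<longleftrightarrow>
     is_complex R P \<and>
     (\<forall>i. projective_module R (obj P i)) \<and>
     cinf P > - \<infinity> \<and>
     (\<exists>a :: int \<Rightarrow> nat.
        (\<exists>i. cinf P \<le> ereal (of_int i) \<and> a i \<noteq> 0) \<and>
        (\<forall>i. cinf P \<le> ereal (of_int i) \<longrightarrow> mod_iso R (homology P i) (mod_power (a i) M)))"

definition finite_quasi_projective_resolution ::
  "('a, 'r) ring_scheme \<Rightarrow> ('a, 'b, 'm) module_scheme \<Rightarrow> ('a, 'p) mod_complex \<Rightarrow> bool" where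
  "finite_quasi_projective_resolution R M P \<longleftrightarrow>
     quasi_projective_resolution R M P \<and> csup P < \<infinity>"

text \<open>The type argument is the type on which the modules of the resolutions live.  It is a
  parameter, so that statements about \<open>qpd\<close> can be made for resolutions on an arbitrary type.\<close>

definition qpd :: "'p itself \<Rightarrow> ('a, 'r) ring_scheme \<Rightarrow> ('a, 'b, 'm) module_scheme \<Rightarrow> ereal" where
  "qpd (_ :: 'p itself) R M =
     (if zero_module M then - \<infinity>
      else (INF P\<in>{P :: ('a, 'p) mod_complex. finite_quasi_projective_resolution R M P}.
              csup P - hsup P))"


section \<open>Independence of the universe\<close>

text \<open>The lifting property in \<open>projective_module\<close> extends to modules \<open>A\<close>, \<open>B\<close> on arbitrary types
  (\<open>projective_module_lift\<close>): given lifts of the elements of \<open>P\<close> to \<open>A\<close>, only the submodule of \<open>A\<close>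
  they generate matters, and it is an image of lists over \<open>R \<times> P\<close>.\<close>

definition mod_transport ::
  "('b \<Rightarrow> 'c) \<Rightarrow> ('a, 'b, 'm) module_scheme \<Rightarrow> ('a, 'c) module" where
  "mod_transport e M =
     \<lparr>carrier = e ` carrier M, monoid.mult = undefined, monoid.one = undefined,
      ring.zero = e \<zero>\<^bsub>M\<^esub>,
      ring.add = (\<lambda>x y. e (inv_into (carrier M) e x \<oplus>\<^bsub>M\<^esub> inv_into (carrier M) e y)),
      module.smult = (\<lambda>r x. e (r \<odot>\<^bsub>M\<^esub> inv_into (carrier M) e x))\<rparr>"

lemma mod_transport:
  assumes M: "Module.module R M" and e: "inj_on e (carrier M)"
  shows "Module.module R (mod_transport e M)"
    and "e \<in> mod_hom R M (mod_transport e M)"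
    and "inv_into (carrier M) e \<in> mod_hom R (mod_transport e M) M"
proof -
  interpret M: Module.module R M by (rule M)
  show "Module.module R (mod_transport e M)"
  proof (rule moduleI)
    show "cring R" by (rule M.R.is_cring)
    show "abelian_group (mod_transport e M)"
    proof (rule abelian_groupI, goal_cases)
      case (6 x)
      then obtain m where m: "m \<in> carrier M" "x = e m" by (auto simp: mod_transport_def)
      then show ?case
        by (intro bexI[of _ "e (\<ominus>\<^bsub>M\<^esub> m)"]) (auto simp: mod_transport_def e M.M.l_neg)
    qed (auto simp: mod_transport_def e M.M.a_assoc intro!: arg_cong[where f = e] M.M.a_comm)
  qed (auto simp: mod_transport_def e M.smult_l_distr M.smult_r_distr M.smult_assoc1)
  show "e \<in> mod_hom R M (mod_transport e M)"
    "inv_into (carrier M) e \<in> mod_hom R (mod_transport e M) M"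
    by (auto simp: mod_transport_def mod_hom_def e)
qed

lemma mod_hom_compose:
  "f \<in> mod_hom R L M \<Longrightarrow> g \<in> mod_hom R M N \<Longrightarrow> (\<lambda>x. g (f x)) \<in> mod_hom R L N"
  by (simp add: mod_hom_def Pi_iff)

lemma submodule_image:
  assumes "Module.module R M" "Module.module R N" and g: "g \<in> mod_hom R M N" and H: "submodule H R M"
  shows "submodule (g ` H) R N"
proof -
  interpret M: Module.module R M by fact
  interpret N: Module.module R N by fact
  have sub: "H \<subseteq> carrier M" using M.submoduleE(1)[OF H] .
  have g0: "g x \<in> carrier N" and ga: "x \<in> carrier M \<Longrightarrow> y \<in> carrier M \<Longrightarrow> g x \<oplus>\<^bsub>N\<^esub> g y = g (x \<oplus>\<^bsub>M\<^esub> y)"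
    and gs: "r \<in> carrier R \<Longrightarrow> r \<odot>\<^bsub>N\<^esub> g x = g (r \<odot>\<^bsub>M\<^esub> x)" if "x \<in> carrier M" for x y r
    using g that by (auto simp: mod_hom_def)
  have sm: "r \<odot>\<^bsub>M\<^esub> x \<in> H" if "r \<in> carrier R" "x \<in> H" for r x
    using M.submoduleE(4)[OF H] that .
  have sa: "x \<oplus>\<^bsub>M\<^esub> y \<in> H" if "x \<in> H" "y \<in> H" for x y
    using M.submoduleE(5)[OF H] that .
  have gH: "r \<odot>\<^bsub>N\<^esub> y \<in> g ` H" if ry: "r \<in> carrier R" "y \<in> g ` H" for r y
  proof -
    obtain x where x: "x \<in> H" "y = g x" using ry(2) by auto
    show ?thesis
      unfolding x(2) gs[OF subsetD[OF sub x(1)] ry(1)] by (intro imageI sm ry(1) x(1))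
  qed
  show ?thesis
  proof (rule N.submoduleI)
    show sN: "g ` H \<subseteq> carrier N" using g0 sub by auto
    obtain h where h: "h \<in> H" using M.submoduleE(2)[OF H] by auto
    have "\<zero>\<^bsub>N\<^esub> = \<zero>\<^bsub>R\<^esub> \<odot>\<^bsub>N\<^esub> g h" using h sub g0 by auto
    then show "\<zero>\<^bsub>N\<^esub> \<in> g ` H" using gH h by simp
    fix a assume a: "a \<in> g ` H"
    then have "\<ominus>\<^bsub>N\<^esub> a = (\<ominus>\<^bsub>R\<^esub> \<one>\<^bsub>R\<^esub>) \<odot>\<^bsub>N\<^esub> a"
      using sN by (auto simp: N.smult_l_minus)
    then show "\<ominus>\<^bsub>N\<^esub> a \<in> g ` H" using gH a by simp
  next
    fix a b assume "a \<in> g ` H" "b \<in> g ` H"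
    then obtain x y where "x \<in> H" "y \<in> H" "a = g x" "b = g y" by auto
    then show "a \<oplus>\<^bsub>N\<^esub> b \<in> g ` H" using ga sub sa by (auto simp: subset_iff)
  qed (erule (1) gH)
qed

primrec lincomb :: "('a, 'c, 'm) module_scheme \<Rightarrow> ('b \<Rightarrow> 'c) \<Rightarrow> ('a \<times> 'b) list \<Rightarrow> 'c" where
  "lincomb A s [] = \<zero>\<^bsub>A\<^esub>"
| "lincomb A s (p # w) = (fst p \<odot>\<^bsub>A\<^esub> s (snd p)) \<oplus>\<^bsub>A\<^esub> lincomb A s w"

lemma submodule_lincomb:
  assumes "Module.module R A" and s: "s \<in> C \<rightarrow> carrier A"
  shows "submodule (lincomb A s ` lists (carrier R \<times> C)) R A" (is "submodule ?H R A")
proof -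
  interpret A: Module.module R A by fact
  have cl: "lincomb A s w \<in> carrier A" if "w \<in> lists (carrier R \<times> C)" for w
    using that s by (induction w) (auto simp: Pi_iff)
  have add: "lincomb A s (v @ w) = lincomb A s v \<oplus>\<^bsub>A\<^esub> lincomb A s w"
    if "v \<in> lists (carrier R \<times> C)" "w \<in> lists (carrier R \<times> C)" for v w
    using that(1)
  proof (induction v)
    case Nil then show ?case using cl[OF that(2)] by simp
  next
    case (Cons p v)
    then have "v \<in> lists (carrier R \<times> C)" "fst p \<in> carrier R" "snd p \<in> C" by auto
    then show ?case
      using Cons.IH cl[of v] cl[OF that(2)] s by (simp add: A.M.a_assoc Pi_iff del: in_lists_conv_set)
  qed
  have smult: "lincomb A s (map (\<lambda>p. (r \<otimes>\<^bsub>R\<^esub> fst p, snd p)) w) = r \<odot>\<^bsub>A\<^esub> lincomb A s w"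
    if "w \<in> lists (carrier R \<times> C)" "r \<in> carrier R" for r w
    using that(1)
  proof (induction w)
    case Nil then show ?case using that(2) by simp
  next
    case (Cons p w)
    then have "w \<in> lists (carrier R \<times> C)" "fst p \<in> carrier R" "snd p \<in> C" by auto
    then show ?case
      using Cons.IH cl[of w] that(2) s
      by (simp add: A.smult_r_distr A.smult_assoc1 Pi_iff del: in_lists_conv_set)
  qed
  have sH: "r \<odot>\<^bsub>A\<^esub> x \<in> ?H" if "r \<in> carrier R" "x \<in> ?H" for r x
  proof -
    obtain w where w: "w \<in> lists (carrier R \<times> C)" "x = lincomb A s w" using \<open>x \<in> ?H\<close> by auto
    have "map (\<lambda>p. (r \<otimes>\<^bsub>R\<^esub> fst p, snd p)) w \<in> lists (carrier R \<times> C)"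
      using w(1) that(1) by (induction w) auto
    then show ?thesis unfolding w(2) smult[OF w(1) that(1), symmetric] by (rule imageI)
  qed
  have HA: "?H \<subseteq> carrier A" using cl by blast
  show ?thesis
  proof (rule A.submoduleI)
    show "\<zero>\<^bsub>A\<^esub> \<in> ?H" by (rule image_eqI[of _ _ "[]"]) auto
    fix a assume a: "a \<in> ?H"
    then have "a \<in> carrier A" using HA by blast
    then have "\<ominus>\<^bsub>A\<^esub> a = (\<ominus>\<^bsub>R\<^esub> \<one>\<^bsub>R\<^esub>) \<odot>\<^bsub>A\<^esub> a"
      by (simp add: A.smult_l_minus)
    then show "\<ominus>\<^bsub>A\<^esub> a \<in> ?H" using sH[OF _ a, of "\<ominus>\<^bsub>R\<^esub> \<one>\<^bsub>R\<^esub>"] by simp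
  next
    fix a b assume "a \<in> ?H" "b \<in> ?H"
    then obtain v w where vw: "v \<in> lists (carrier R \<times> C)" "w \<in> lists (carrier R \<times> C)"
      "a = lincomb A s v" "b = lincomb A s w" by blast
    then show "a \<oplus>\<^bsub>A\<^esub> b \<in> ?H"
      unfolding vw(3,4) add[OF vw(1,2), symmetric] by (intro imageI) simp
  qed (fact HA, erule (1) sH)
qed

lemma projective_module_lift:
  fixes P :: "('a, 'b, 'm) module_scheme"
    and A :: "('a, 'c, 'n) module_scheme" and B :: "('a, 'd, 'k) module_scheme"
  assumes P: "projective_module R P" and A: "Module.module R A" and B: "Module.module R B"
    and g: "g \<in> mod_hom R A B" "g ` carrier A = carrier B" and f: "f \<in> mod_hom R P B"
  shows "\<exists>h \<in> mod_hom R P A. \<forall>x\<in>carrier P. g (h x) = f x"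
proof -
  interpret A: Module.module R A by (rule A)
  interpret B: Module.module R B by (rule B)
  have "\<forall>p\<in>carrier P. \<exists>a\<in>carrier A. g a = f p"
  proof
    fix p assume "p \<in> carrier P"
    then have "f p \<in> g ` carrier A" using f g(2) by (auto simp: mod_hom_def)
    then show "\<exists>a\<in>carrier A. g a = f p" by auto
  qed
  then obtain s where s: "\<And>p. p \<in> carrier P \<Longrightarrow> s p \<in> carrier A"
      "\<And>p. p \<in> carrier P \<Longrightarrow> g (s p) = f p" by metis
  define W where "W = lists (carrier R \<times> carrier P)"
  define H where "H = lincomb A s ` W"
  have H: "submodule H R A"
    unfolding H_def W_def by (rule submodule_lincomb[OF A]) (use s in auto)
  have HA: "H \<subseteq> carrier A" using A.submoduleE(1)[OF H] .
  have gH: "submodule (g ` H) R B" by (rule submodule_image[OF A B g(1) H])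
  have sH: "s p \<in> H" if "p \<in> carrier P" for p
  proof -
    have "s p = lincomb A s [(\<one>\<^bsub>R\<^esub>, p)]" using s(1)[OF that] by simp
    moreover have "[(\<one>\<^bsub>R\<^esub>, p)] \<in> W" using that by (simp add: W_def)
    ultimately show ?thesis unfolding H_def by (rule image_eqI)
  qed
  define A' where "A' = A\<lparr>carrier := H\<rparr>"
  define B' where "B' = B\<lparr>carrier := g ` H\<rparr>"
  have A': "Module.module R A'" unfolding A'_def by (rule submodule.submodule_is_module[OF H A])
  have B': "Module.module R B'" unfolding B'_def by (rule submodule.submodule_is_module[OF gH B])
  have g': "g \<in> mod_hom R A' B'" "g ` carrier A' = carrier B'"
    using g(1) HA by (auto simp: A'_def B'_def mod_hom_def subset_iff)
  have "f p \<in> g ` H" if "p \<in> carrier P" for p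
    using s(2)[OF that, symmetric] sH[OF that] by (rule image_eqI)
  then have f': "f \<in> mod_hom R P B'"
    using f by (auto simp: B'_def mod_hom_def)
  define enc :: "('a \<times> 'b) list \<Rightarrow> ('a, 'b) universe"
    where "enc w = concat (map (\<lambda>p. [Inl (fst p), Inr (snd p)]) w)" for w
  have enc: "enc v = enc w \<Longrightarrow> v = w" for v w
  proof (induction v arbitrary: w)
    case Nil then show ?case by (cases w) (auto simp: enc_def)
  next
    case (Cons p v) then show ?case by (cases w) (auto simp: enc_def prod_eq_iff)
  qed
  define a where "a = (\<lambda>x. enc (inv_into W (lincomb A s) x))"
  define b where "b = (\<lambda>y. a (inv_into H g y))"
  have a: "inj_on a (carrier A')"
    by (auto simp: inj_on_def A'_def a_def H_def dest!: enc inv_into_injective)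
  have b: "inj_on b (carrier B')"
  proof (rule inj_onI)
    fix x y assume *: "x \<in> carrier B'" "y \<in> carrier B'" "b x = b y"
    have "inv_into H g x = inv_into H g y"
      using a * by (auto simp: inj_on_def b_def A'_def B'_def inv_into_into)
    then show "x = y" using * by (auto simp: B'_def dest: inv_into_injective)
  qed
  note Ta = mod_transport[OF A' a] and Tb = mod_transport[OF B' b]
  define G where "G = (\<lambda>x. b (g (inv_into (carrier A') a x)))"
  have G: "G \<in> mod_hom R (mod_transport a A') (mod_transport b B')"
    unfolding G_def
    by (rule mod_hom_compose[OF _ Tb(2)]) (rule mod_hom_compose[OF Ta(3) g'(1)])
  have surj: "G ` carrier (mod_transport a A') = carrier (mod_transport b B')"
    by (simp add: G_def mod_transport_def image_image a g'(2)[symmetric] cong: image_cong)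
  have F: "(\<lambda>x. b (f x)) \<in> mod_hom R P (mod_transport b B')"
    by (rule mod_hom_compose[OF f' Tb(2)])
  obtain h where h: "h \<in> mod_hom R P (mod_transport a A')" "\<forall>x\<in>carrier P. G (h x) = b (f x)"
    using P[unfolded projective_module_def, THEN conjunct2, rule_format, OF Ta(1) Tb(1) G surj F]
    by blast
  have h1: "(\<lambda>x. inv_into (carrier A') a (h x)) \<in> mod_hom R P A'"
    by (rule mod_hom_compose[OF h(1) Ta(3)])
  show ?thesis
  proof (intro bexI ballI)
    show "(\<lambda>x. inv_into (carrier A') a (h x)) \<in> mod_hom R P A"
      using h1 HA by (auto simp: mod_hom_def A'_def)
    fix x assume x: "x \<in> carrier P"
    have "inv_into (carrier A') a (h x) \<in> carrier A'" using h1 x by (auto simp: mod_hom_def)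
    then have "g (inv_into (carrier A') a (h x)) \<in> carrier B'" using g'(1) by (auto simp: mod_hom_def)
    moreover have "f x \<in> carrier B'" using f' x by (auto simp: mod_hom_def)
    ultimately show "g (inv_into (carrier A') a (h x)) = f x"
      using h(2) x b by (auto simp: G_def inj_on_def)
  qed
qed

end

theory Submission
  imports Defs
begin

text \<open>Let \<open>P\<close> be a finite quasi-projective resolution of \<open>M \<noteq> 0\<close> and suppose \<open>Ext\<^sup>i(M, M) = 0\<close> for all
  \<open>i > 0\<close>. The homology of \<open>P\<close> being sums of copies of \<open>M\<close>, induction from the bottom of \<open>P\<close> shows
  \<open>Ext\<^sup>i(B, M) = 0\<close>, \<open>i > 0\<close>, for all modules \<open>B\<close> of boundaries. Let \<open>t\<close> be the top degree with nonzero
  homology. A projection of the cycles in degree \<open>t\<close> onto \<open>M\<close> that kills the boundaries extends to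
  \<open>P\<^sub>t\<close>, since \<open>Ext\<^sup>1\<close> of the boundaries in degree \<open>t - 1\<close> vanishes. Hence \<open>M\<close> is a direct summand of the
  cokernel of \<open>P\<^sub>t\<^sub>+\<^sub>1 \<rightarrow> P\<^sub>t\<close>, which has the finite projective resolution \<open>P\<^sub>\<ge>\<^sub>t\<close>, so some syzygy of \<open>M\<close> is projective.

  It remains to descend: if the syzygy \<open>K\<close> of a syzygy \<open>N\<close> of \<open>M\<close> is projective, then so is \<open>N\<close>. Here
  \<open>Ext\<^sup>1(N, -)\<close> is right exact on finitely generated modules, so \<open>E = Ext\<^sup>1(N, R)\<close> satisfies \<open>E \<otimes> M = 0\<close>;
  as \<open>E\<close> is annihilated by the annihilator of \<open>M\<close>, Nakayama's lemma gives \<open>E = 0\<close>.\<close>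

section \<open>Homomorphisms and short exact sequences\<close>

text \<open>In the first half everything rests on closure: the modules \<open>B\<close> without
  higher Ext against \<open>M\<close> include \<open>M\<close> and all projective modules and are
  closed under kernels of surjections. Cycles are kernels of a projective mapping onto boundaries,
  and boundaries are reached from cycles by removing copies of \<open>M\<close>, so the property
  climbs through \<open>P\<close>. Neither derived functors nor long exact sequences are formed:
  vanishing means that homomorphisms extend from a syzygy to its projective cover, in all degrees,
  and independence of the resolution comes from an explicit homotopy relation between syzygies. That
  formulation confines the modules to one type, so \<open>M\<close>, its syzygies and
  \<open>P\<close> are copied to a common one.

  In the descent, right exactness holds because \<open>K\<close> is projective, and Ext in degree 1
  of \<open>N\<close> against \<open>M\<close> vanishes because it is a higher Ext of
  \<open>M\<close>. No tensor product or localisation is used: \<open>E\<close> is the cokernel of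
  restricting functionals from the cover to \<open>K\<close>, finitely generated by a dual basis,
  and Nakayama's lemma delivers scalars congruent to 1. The generators of \<open>M\<close> are
  treated one by one.\<close>

lemma (in abelian_group) add_minus_cancel [simp]:
  assumes x: "x \<in> carrier G" and y: "y \<in> carrier G"
  shows "y \<oplus> (x \<ominus> y) = x" "(x \<ominus> y) \<oplus> y = x" "(x \<oplus> y) \<ominus> y = x" "(y \<oplus> x) \<ominus> y = x"
proof -
  show 1: "(x \<ominus> y) \<oplus> y = x" "(x \<oplus> y) \<ominus> y = x"
    using x y by (simp_all add: a_minus_def a_assoc l_neg r_neg)
  show "y \<oplus> (x \<ominus> y) = x" "(y \<oplus> x) \<ominus> y = x"
    using 1 x y by (simp_all add: a_comm[of y])
qed

lemma (in abelian_group) minus_eq_zero_iff [simp]: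
  assumes x: "x \<in> carrier G" and y: "y \<in> carrier G"
  shows "x \<ominus> y = \<zero> \<longleftrightarrow> x = y"
proof
  assume "x \<ominus> y = \<zero>"
  then show "x = y" using add_minus_cancel(2)[OF x y] y by simp
next
  assume "x = y" then show "x \<ominus> y = \<zero>" using y by (simp add: a_minus_def r_neg)
qed

lemma hom_closed: "f \<in> mod_hom R A B \<Longrightarrow> x \<in> carrier A \<Longrightarrow> f x \<in> carrier B"
  by (auto simp: mod_hom_def)

lemma hom_add: "f \<in> mod_hom R A B \<Longrightarrow> x \<in> carrier A \<Longrightarrow> y \<in> carrier A \<Longrightarrow>
    f (x \<oplus>\<^bsub>A\<^esub> y) = f x \<oplus>\<^bsub>B\<^esub> f y"
  by (auto simp: mod_hom_def)

lemma hom_smult: "f \<in> mod_hom R A B \<Longrightarrow> r \<in> carrier R \<Longrightarrow> x \<in> carrier A \<Longrightarrow>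
    f (r \<odot>\<^bsub>A\<^esub> x) = r \<odot>\<^bsub>B\<^esub> f x"
  by (auto simp: mod_hom_def)

lemma hom_zero:
  assumes "module R A" "module R B" "f \<in> mod_hom R A B"
  shows "f \<zero>\<^bsub>A\<^esub> = \<zero>\<^bsub>B\<^esub>"
proof -
  interpret A: Module.module R A by fact
  interpret B: Module.module R B by fact
  have "f (\<zero>\<^bsub>R\<^esub> \<odot>\<^bsub>A\<^esub> \<zero>\<^bsub>A\<^esub>) = \<zero>\<^bsub>R\<^esub> \<odot>\<^bsub>B\<^esub> f \<zero>\<^bsub>A\<^esub>"
    using assms(3) by (intro hom_smult) auto
  then show ?thesis using hom_closed[OF assms(3), of "\<zero>\<^bsub>A\<^esub>"] by simp
qed

lemma hom_neg:
  fixes B (structure)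
  assumes "module R A" "module R B" "f \<in> mod_hom R A B" "x \<in> carrier A"
  shows "f (\<ominus>\<^bsub>A\<^esub> x) = \<ominus> f x"
proof -
  interpret A: Module.module R A by fact
  interpret B: Module.module R B by fact
  have "f (\<ominus>\<^bsub>A\<^esub> x) \<oplus> f x = f (\<ominus>\<^bsub>A\<^esub> x \<oplus>\<^bsub>A\<^esub> x)"
    using assms by (simp add: hom_add)
  also have "\<dots> = \<zero>" using assms by (simp add: A.M.l_neg hom_zero)
  finally show ?thesis
    using hom_closed[OF assms(3)] assms(4) by (intro B.M.minus_equality[symmetric]) auto
qed

lemma hom_minus:
  assumes "module R A" "module R B" "f \<in> mod_hom R A B" "x \<in> carrier A" "y \<in> carrier A"
  shows "f (x \<ominus>\<^bsub>A\<^esub> y) = f x \<ominus>\<^bsub>B\<^esub> f y"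
proof -
  interpret A: Module.module R A by fact
  interpret B: Module.module R B by fact
  show ?thesis using assms by (simp add: a_minus_def hom_add[of f R A B] hom_neg)
qed

lemma hom_id: "(\<lambda>x. x) \<in> mod_hom R A A"
  by (auto simp: mod_hom_def)

lemma hom_const_zero:
  assumes "module R B" shows "(\<lambda>x. \<zero>\<^bsub>B\<^esub>) \<in> mod_hom R A B"
proof -
  interpret B: Module.module R B by fact
  show ?thesis by (auto simp: mod_hom_def)
qed

lemma hom_plus:
  fixes B (structure)
  assumes "module R A" "module R B" and f: "f \<in> mod_hom R A B" and g: "g \<in> mod_hom R A B"
  shows "(\<lambda>x. f x \<oplus> g x) \<in> mod_hom R A B"
proof -
  interpret B: Module.module R B by fact
  show ?thesis using hom_closed[OF f] hom_closed[OF g]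
    by (auto simp: mod_hom_def hom_add[OF f] hom_add[OF g] hom_smult[OF f] hom_smult[OF g]
        B.smult_r_distr B.M.a_ac)
qed

lemma hom_scale:
  fixes B (structure)
  assumes "module R A" "module R B" and f: "f \<in> mod_hom R A B" and r: "r \<in> carrier R"
  shows "(\<lambda>x. r \<odot> f x) \<in> mod_hom R A B"
proof -
  interpret A: Module.module R A by fact
  interpret B: Module.module R B by fact
  show ?thesis using hom_closed[OF f] r
    by (auto simp: mod_hom_def hom_add[OF f] hom_smult[OF f] B.smult_r_distr
        B.smult_assoc1[symmetric] A.R.m_comm)
qed

lemma hom_diff:
  fixes B (structure)
  assumes "module R A" "module R B" and f: "f \<in> mod_hom R A B" and g: "g \<in> mod_hom R A B"
  shows "(\<lambda>x. f x \<ominus> g x) \<in> mod_hom R A B"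
proof -
  interpret B: Module.module R B by fact
  show ?thesis using hom_closed[OF f] hom_closed[OF g]
    by (auto simp: mod_hom_def hom_add[OF f] hom_add[OF g] hom_smult[OF f] hom_smult[OF g]
        B.smult_r_distr B.M.a_ac a_minus_def B.M.minus_add B.smult_r_minus)
qed

lemma hom_restrict_dom:
  "f \<in> mod_hom R A B \<Longrightarrow> H \<subseteq> carrier A \<Longrightarrow> f \<in> mod_hom R (A\<lparr>carrier := H\<rparr>) B"
  by (auto simp: mod_hom_def subset_iff)

lemma hom_restrict_cod:
  "f \<in> mod_hom R A B \<Longrightarrow> (\<And>x. x \<in> carrier A \<Longrightarrow> f x \<in> H) \<Longrightarrow> f \<in> mod_hom R A (B\<lparr>carrier := H\<rparr>)"
  by (auto simp: mod_hom_def)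

lemma hom_extend_cod:
  "f \<in> mod_hom R A (B\<lparr>carrier := H\<rparr>) \<Longrightarrow> H \<subseteq> carrier B \<Longrightarrow> f \<in> mod_hom R A B"
  by (auto simp: mod_hom_def)

lemma hom_cong:
  assumes "module R A" and "f \<in> mod_hom R A B" "\<And>x. x \<in> carrier A \<Longrightarrow> g x = f x"
  shows "g \<in> mod_hom R A B"
proof -
  interpret A: Module.module R A by fact
  show ?thesis using assms by (auto simp: mod_hom_def)
qed

lemma submoduleD:
  fixes A (structure)
  assumes "module R A" "submodule H R A"
  shows "H \<subseteq> carrier A" "\<zero> \<in> H" "module R (A\<lparr>carrier := H\<rparr>)"
    and "x \<in> H \<Longrightarrow> y \<in> H \<Longrightarrow> x \<oplus> y \<in> H"
    and "x \<in> H \<Longrightarrow> y \<in> H \<Longrightarrow> x \<ominus> y \<in> H"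
    and "r \<in> carrier R \<Longrightarrow> x \<in> H \<Longrightarrow> r \<odot> x \<in> H"
proof -
  interpret A: Module.module R A by fact
  note E = A.submoduleE[OF assms(2)]
  show sub: "H \<subseteq> carrier A" by (rule E)
  obtain h where h: "h \<in> H" using E(2) by auto
  have "\<zero>\<^bsub>R\<^esub> \<odot> h \<in> H" by (rule E(4)) (use h in auto)
  then show "\<zero> \<in> H" using h sub by auto
  show "module R (A\<lparr>carrier := H\<rparr>)"
    by (rule submodule.submodule_is_module[OF assms(2) assms(1)])
  show "x \<in> H \<Longrightarrow> y \<in> H \<Longrightarrow> x \<oplus> y \<in> H" by (rule E)
  show "x \<in> H \<Longrightarrow> y \<in> H \<Longrightarrow> x \<ominus> y \<in> H" using E(3)[of y] E(5)[of x "\<ominus> y"] by (simp add: a_minus_def)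
  show "r \<in> carrier R \<Longrightarrow> x \<in> H \<Longrightarrow> r \<odot> x \<in> H" by (rule E)
qed

lemma submoduleI':
  fixes A (structure)
  assumes "module R A" "H \<subseteq> carrier A" "\<zero> \<in> H"
    and "\<And>x y. x \<in> H \<Longrightarrow> y \<in> H \<Longrightarrow> x \<oplus> y \<in> H"
    and s: "\<And>r x. r \<in> carrier R \<Longrightarrow> x \<in> H \<Longrightarrow> r \<odot> x \<in> H"
  shows "submodule H R A"
proof -
  interpret A: Module.module R A by fact
  show ?thesis
  proof (rule A.submoduleI)
    fix a assume a: "a \<in> H"
    then have "\<ominus> a = (\<ominus>\<^bsub>R\<^esub> \<one>\<^bsub>R\<^esub>) \<odot> a"
      using assms(2) by (auto simp: A.smult_l_minus)
    then show "\<ominus> a \<in> H" using s[OF _ a, of "\<ominus>\<^bsub>R\<^esub> \<one>\<^bsub>R\<^esub>"] by simp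
  qed (use assms in auto)
qed

lemma submodule_kernel:
  assumes "module R A" "module R B" and f: "f \<in> mod_hom R A B"
  shows "submodule {x \<in> carrier A. f x = \<zero>\<^bsub>B\<^esub>} R A"
proof -
  interpret A: Module.module R A by fact
  interpret B: Module.module R B by fact
  show ?thesis
    by (rule submoduleI'[OF assms(1)])
      (auto simp: hom_zero[OF assms] hom_add[OF f] hom_smult[OF f])
qed

lemma submodule_preimage:
  assumes "module R A" "module R B" and f: "f \<in> mod_hom R A B" and H: "submodule H R B"
  shows "submodule {x \<in> carrier A. f x \<in> H} R A"
proof -
  interpret A: Module.module R A by fact
  show ?thesis
    by (rule submoduleI'[OF assms(1)])
      (auto simp: hom_zero[OF assms(1-3)] hom_add[OF f] hom_smult[OF f] submoduleD[OF assms(2) H])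
qed

lemma submodule_common_kernel:
  fixes A (structure)
  assumes A: "module R A" and M: "\<And>j. j \<in> J \<Longrightarrow> module R (M j)" "\<And>j. j \<in> J \<Longrightarrow> f j \<in> mod_hom R A (M j)"
  shows "submodule {x \<in> carrier A. \<forall>j\<in>J. f j x = \<zero>\<^bsub>M j\<^esub>} R A"
proof -
  interpret A: Module.module R A by (rule A)
  have "\<zero>\<^bsub>M j\<^esub> \<oplus>\<^bsub>M j\<^esub> \<zero>\<^bsub>M j\<^esub> = \<zero>\<^bsub>M j\<^esub>" "r \<in> carrier R \<Longrightarrow> r \<odot>\<^bsub>M j\<^esub> \<zero>\<^bsub>M j\<^esub> = \<zero>\<^bsub>M j\<^esub>" if j: "j \<in> J" for j r
  proof -
    interpret M: Module.module R "M j" by (rule M(1)[OF j])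
    show "\<zero>\<^bsub>M j\<^esub> \<oplus>\<^bsub>M j\<^esub> \<zero>\<^bsub>M j\<^esub> = \<zero>\<^bsub>M j\<^esub>" "r \<in> carrier R \<Longrightarrow> r \<odot>\<^bsub>M j\<^esub> \<zero>\<^bsub>M j\<^esub> = \<zero>\<^bsub>M j\<^esub>" by auto
  qed
  then show ?thesis
    by (intro submoduleI'[OF A]) (auto simp: hom_zero[OF A M] hom_add[OF M(2)] hom_smult[OF M(2)])
qed

text \<open>The module axioms are equations, so they may be checked in a jointly injective family of
  coordinates; the inverse of \<open>x\<close> is \<open>(-1) x\<close>. Compatibility with zero is
  a separate hypothesis because deriving it from linearity would already need \<open>A\<close> to be
  a module. This yields products, free modules, Hom modules and powers.\<close>

lemma module_if_coordinates:
  fixes A :: "('a, 'd, 'n) module_scheme" and B :: "'j \<Rightarrow> ('a, 'c, 'm) module_scheme"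
  assumes R: "cring R" and B: "\<And>j. j \<in> J \<Longrightarrow> module R (B j)"
    and cl: "\<zero>\<^bsub>A\<^esub> \<in> carrier A" "\<And>x y. x \<in> carrier A \<Longrightarrow> y \<in> carrier A \<Longrightarrow> x \<oplus>\<^bsub>A\<^esub> y \<in> carrier A"
      "\<And>r x. r \<in> carrier R \<Longrightarrow> x \<in> carrier A \<Longrightarrow> r \<odot>\<^bsub>A\<^esub> x \<in> carrier A"
    and \<pi>: "\<And>j. j \<in> J \<Longrightarrow> \<pi> j \<in> mod_hom R A (B j)" "\<And>j. j \<in> J \<Longrightarrow> \<pi> j \<zero>\<^bsub>A\<^esub> = \<zero>\<^bsub>B j\<^esub>"
    and inj: "\<And>x y. x \<in> carrier A \<Longrightarrow> y \<in> carrier A \<Longrightarrow> (\<And>j. j \<in> J \<Longrightarrow> \<pi> j x = \<pi> j y) \<Longrightarrow> x = y"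
  shows "module R A"
proof -
  interpret R: cring R by (rule R)
  note B' = module.axioms(2)[OF B]
  note am = abelian_group.axioms(1)[OF B']
  note \<pi>' = hom_closed[OF \<pi>(1)] hom_add[OF \<pi>(1)] hom_smult[OF \<pi>(1)] \<pi>(2)
  show ?thesis
  proof (rule moduleI[OF R abelian_groupI], goal_cases)
    case (6 x)
    have "(\<ominus>\<^bsub>R\<^esub> \<one>\<^bsub>R\<^esub>) \<odot>\<^bsub>A\<^esub> x \<oplus>\<^bsub>A\<^esub> x = \<zero>\<^bsub>A\<^esub>"
      by (rule inj) (simp_all add: 6 cl \<pi>' module.smult_l_minus[OF B] module.smult_one[OF B] abelian_group.l_neg[OF B'])
    then show ?case using 6 cl(3) by (intro bexI[of _ "(\<ominus>\<^bsub>R\<^esub> \<one>\<^bsub>R\<^esub>) \<odot>\<^bsub>A\<^esub> x"]) auto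
  qed (auto intro!: inj simp: cl \<pi>' abelian_monoid.a_assoc[OF am] abelian_monoid.l_zero[OF am]
      abelian_monoid.a_comm[OF am] module.smult_l_distr[OF B] module.smult_r_distr[OF B]
      module.smult_assoc1[OF B] module.smult_one[OF B])
qed

lemma a_kernel_eq: "a_kernel A B f = {x \<in> carrier A. f x = \<zero>\<^bsub>B\<^esub>}"
  by (auto simp: a_kernel_def kernel_def)

text \<open>The universal property of a cokernel. The value at \<open>y\<close> is taken at an
  arbitrary preimage; two preimages differ by an element of the kernel of \<open>p\<close>, which
  \<open>f\<close> kills.\<close>

lemma surj_factor:
  fixes N (structure)
  assumes G: "module R G" and N: "module R N" and Y: "module R Y"
    and p: "p \<in> mod_hom R G N" "p ` carrier G = carrier N" and f: "f \<in> mod_hom R G Y"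
    and ker: "\<And>x. x \<in> carrier G \<Longrightarrow> p x = \<zero> \<Longrightarrow> f x = \<zero>\<^bsub>Y\<^esub>"
  shows "\<exists>g\<in>mod_hom R N Y. \<forall>x\<in>carrier G. g (p x) = f x"
proof -
  interpret G: Module.module R G by fact
  interpret N: Module.module R N by fact
  interpret Y: Module.module R Y by fact
  define s where "s = inv_into (carrier G) p"
  have s: "s y \<in> carrier G" "p (s y) = y" if "y \<in> carrier N" for y
    using that p(2) by (auto simp: s_def inv_into_into f_inv_into_f)
  have eq: "f x = f y" if "x \<in> carrier G" "y \<in> carrier G" "p x = p y" for x y
  proof -
    have "f (x \<ominus>\<^bsub>G\<^esub> y) = \<zero>\<^bsub>Y\<^esub>"
      using that hom_closed[OF p(1)] by (intro ker) (auto simp: hom_minus[OF G N p(1)])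
    then show ?thesis using that hom_closed[OF f] by (simp add: hom_minus[OF G Y f])
  qed
  have "(\<lambda>y. f (s y)) \<in> mod_hom R N Y"
    unfolding mod_hom_def
    using s hom_closed[OF f]
    by (auto simp: hom_add[OF f, symmetric] hom_smult[OF f, symmetric]
        hom_add[OF p(1)] hom_smult[OF p(1)] intro!: eq)
  moreover have "f (s (p x)) = f x" if "x \<in> carrier G" for x
    using that s hom_closed[OF p(1)] by (intro eq) auto
  ultimately show ?thesis by (intro bexI[of _ "\<lambda>y. f (s y)"]) auto
qed

text \<open>The injection \<open>i\<close> is kept as a map although most kernels below are literal
  submodules: the kernels of horseshoe covers contain a copy of \<open>K\<close> that is only
  embedded by pairing with zero.\<close>

definition ses ::
  "('a, 'r) ring_scheme \<Rightarrow> ('a, 'k, 'm1) module_scheme \<Rightarrow> ('k \<Rightarrow> 'g) \<Rightarrow> ('a, 'g, 'm2) module_scheme \<Rightarrow>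
     ('g \<Rightarrow> 'n) \<Rightarrow> ('a, 'n, 'm3) module_scheme \<Rightarrow> bool" where
  "ses R K i G p N \<longleftrightarrow> module R K \<and> module R G \<and> module R N \<and>
     i \<in> mod_hom R K G \<and> p \<in> mod_hom R G N \<and> inj_on i (carrier K) \<and>
     p ` carrier G = carrier N \<and> i ` carrier K = {x \<in> carrier G. p x = \<zero>\<^bsub>N\<^esub>}"

lemma sesD:
  assumes "ses R K i G p N"
  shows "module R K" "module R G" "module R N" "i \<in> mod_hom R K G" "p \<in> mod_hom R G N"
    "inj_on i (carrier K)" "p ` carrier G = carrier N" "i ` carrier K = {x \<in> carrier G. p x = \<zero>\<^bsub>N\<^esub>}"
    and "x \<in> carrier K \<Longrightarrow> p (i x) = \<zero>\<^bsub>N\<^esub>"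
  using assms unfolding ses_def by blast+

lemma ses_inclusion:
  assumes "module R G" "module R N" "p \<in> mod_hom R G N" "p ` carrier G = carrier N"
    and "H = {x \<in> carrier G. p x = \<zero>\<^bsub>N\<^esub>}"
  shows "ses R (G\<lparr>carrier := H\<rparr>) (\<lambda>x. x) G p N"
proof -
  have H: "submodule H R G" using submodule_kernel[OF assms(1-3)] assms(5) by simp
  show ?thesis unfolding ses_def
    using assms submoduleD(1,3)[OF assms(1) H] by (auto simp: mod_hom_def)
qed

lemma ses_lift:
  assumes s: "ses R K i G p N" and L: "module R L" and f: "f \<in> mod_hom R L G"
    and 0: "\<And>x. x \<in> carrier L \<Longrightarrow> p (f x) = \<zero>\<^bsub>N\<^esub>"
  shows "\<exists>g\<in>mod_hom R L K. \<forall>x\<in>carrier L. i (g x) = f x"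
proof -
  note s = sesD[OF s]
  interpret K: Module.module R K by (rule s)
  interpret L: Module.module R L by fact
  define g where "g = (\<lambda>x. inv_into (carrier K) i (f x))"
  have g: "g x \<in> carrier K" "i (g x) = f x" if "x \<in> carrier L" for x
  proof -
    have "f x \<in> i ` carrier K" using that s(8) 0 hom_closed[OF f] by auto
    then show "g x \<in> carrier K" "i (g x) = f x" by (auto simp: g_def inv_into_into f_inv_into_f)
  qed
  have "g \<in> mod_hom R L K"
    unfolding mod_hom_def
    using g by (auto intro!: inj_onD[OF s(6)] simp: hom_add[OF s(4)] hom_smult[OF s(4)]
        hom_add[OF f] hom_smult[OF f])
  then show ?thesis using g by blast
qed

lemma ses_iso:
  assumes s: "ses R K i G p N" and N': "module R N'" and f: "f \<in> mod_hom R N N'" "bij_betw f (carrier N) (carrier N')"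
  shows "ses R K i G (\<lambda>x. f (p x)) N'"
proof -
  note s = sesD[OF s]
  interpret N: Module.module R N by (rule s)
  have "f (p x) = f \<zero>\<^bsub>N\<^esub> \<longleftrightarrow> p x = \<zero>\<^bsub>N\<^esub>" if "x \<in> carrier G" for x
    by (rule inj_on_eq_iff[OF bij_betw_imp_inj_on[OF f(2)] hom_closed[OF s(5) that] N.M.zero_closed])
  then have "i ` carrier K = {x \<in> carrier G. f (p x) = \<zero>\<^bsub>N'\<^esub>}"
    using s(8) unfolding hom_zero[OF s(3) N' f(1)] by blast
  moreover have "(\<lambda>x. f (p x)) ` carrier G = carrier N'"
    using s(7) f(2) image_image[of f p "carrier G"] by (simp add: bij_betw_def)
  ultimately show ?thesis
    unfolding ses_def by (intro conjI s N' mod_hom_compose[OF s(5) f(1)])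
qed

text \<open>For projective \<open>G\<close> with quotient \<open>N = G/K\<close> this is the
  vanishing of Ext in degree 1 of \<open>N\<close> against \<open>Y\<close>, since that Ext is the
  cokernel of Hom(G, Y) -> Hom(K, Y).\<close>

definition hom_ext ::
  "('a, 'r) ring_scheme \<Rightarrow> ('a, 'k, 'm1) module_scheme \<Rightarrow> ('k \<Rightarrow> 'g) \<Rightarrow> ('a, 'g, 'm2) module_scheme \<Rightarrow>
     ('a, 'x, 'm3) module_scheme \<Rightarrow> bool" where
  "hom_ext R K i G Y \<longleftrightarrow>
     (\<forall>f\<in>mod_hom R K Y. \<exists>g\<in>mod_hom R G Y. \<forall>x\<in>carrier K. g (i x) = f x)"

section \<open>Projective modules\<close>

lemma projD: "projective_module R P \<Longrightarrow> module R P"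
  by (simp add: projective_module_def)

lemma projective_retract:
  fixes P :: "('a, 'p, 'm1) module_scheme" and Q :: "('a, 'q, 'm2) module_scheme"
  assumes P: "projective_module R P" and Q: "module R Q"
    and s: "s \<in> mod_hom R Q P" and t: "t \<in> mod_hom R P Q" and ts: "\<And>x. x \<in> carrier Q \<Longrightarrow> t (s x) = x"
  shows "projective_module R Q"
  unfolding projective_module_def
proof (intro conjI allI impI Q)
  fix A :: "('a, ('a, 'q) universe) module" and B :: "('a, ('a, 'q) universe) module" and g f
  assume *: "module R A" "module R B" "g \<in> mod_hom R A B" "g ` carrier A = carrier B" "f \<in> mod_hom R Q B"
  have ft: "(\<lambda>x. f (t x)) \<in> mod_hom R P B" using t *(5) by (rule mod_hom_compose)
  obtain h where h: "h \<in> mod_hom R P A" "\<forall>x\<in>carrier P. g (h x) = f (t x)"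
    using projective_module_lift[OF P *(1-4) ft] by blast
  show "\<exists>h\<in>mod_hom R Q A. \<forall>x\<in>carrier Q. g (h x) = f x"
    using h ts hom_closed[OF s] by (intro bexI[of _ "\<lambda>x. h (s x)"] mod_hom_compose[OF s]) auto
qed

lemma projective_zero:
  fixes Z :: "('a, 'c, 'm1) module_scheme"
  assumes "module R Z" "carrier Z = {\<zero>\<^bsub>Z\<^esub>}"
  shows "projective_module R Z"
  unfolding projective_module_def
proof (intro conjI allI impI assms(1))
  fix A :: "('a, ('a, 'c) universe) module" and B :: "('a, ('a, 'c) universe) module" and g f
  assume *: "module R A" "module R B" "g \<in> mod_hom R A B" "g ` carrier A = carrier B" "f \<in> mod_hom R Z B"
  show "\<exists>h\<in>mod_hom R Z A. \<forall>x\<in>carrier Z. g (h x) = f x"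
    using assms(2) hom_zero[OF assms(1) *(2,5)] hom_zero[OF *(1,2,3)]
    by (intro bexI[of _ "\<lambda>x. \<zero>\<^bsub>A\<^esub>"] hom_const_zero *) auto
qed

lemma projective_transport:
  assumes "projective_module R P" "inj_on e (carrier P)"
  shows "projective_module R (mod_transport e P)"
  by (rule projective_retract[OF assms(1) mod_transport(1,3,2)[OF projD[OF assms(1)] assms(2)]])
    (use assms(2) in \<open>auto simp: mod_transport_def\<close>)

text \<open>A homotopy between multiplication by \<open>r\<close> on \<open>K\<close> and a map
  through \<open>K'\<close>: the error \<open>h \<circ> i\<close> extends to \<open>G\<close>, so it
  is invisible in the cokernel of Hom(G, -) -> Hom(K, -). The square with \<alpha> serves to pull
  extensions back from \<open>G'\<close> to \<open>G\<close>.\<close>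

definition syzygy_rel ::
  "('a, 'r) ring_scheme \<Rightarrow> 'a \<Rightarrow> ('a, 'k, 'm1) module_scheme \<Rightarrow> ('k \<Rightarrow> 'g) \<Rightarrow> ('a, 'g, 'm2) module_scheme \<Rightarrow>
     ('a, 'l, 'm3) module_scheme \<Rightarrow> ('l \<Rightarrow> 'h) \<Rightarrow> ('a, 'h, 'm4) module_scheme \<Rightarrow> bool" where
  "syzygy_rel R r K i G K' i' G' \<longleftrightarrow>
     (\<exists>\<alpha>\<in>mod_hom R G G'. \<exists>a\<in>mod_hom R K K'. \<exists>b\<in>mod_hom R K' K. \<exists>h\<in>mod_hom R G K.
        (\<forall>x\<in>carrier K. \<alpha> (i x) = i' (a x)) \<and> (\<forall>x\<in>carrier K. b (a x) \<oplus>\<^bsub>K\<^esub> h (i x) = r \<odot>\<^bsub>K\<^esub> x))"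

text \<open>With \<open>r = 1\<close> this compares two projective resolutions of stably equivalent modules; with
  \<open>N' = 0\<close> it shows that a scalar annihilating \<open>N\<close> is null-homotopic on every resolution of \<open>N\<close>.\<close>

lemma syzygy_comparison:
  fixes G (structure)
  assumes s: "ses R K i G p N" and s': "ses R K' i' G' p' N'"
    and P: "projective_module R G" and P': "projective_module R G'"
    and a: "a \<in> mod_hom R N N'" and b: "b \<in> mod_hom R N' N" and w: "w \<in> mod_hom R N G"
    and r: "r \<in> carrier R"
    and eq: "\<And>x. x \<in> carrier N \<Longrightarrow> b (a x) \<oplus>\<^bsub>N\<^esub> p (w x) = r \<odot>\<^bsub>N\<^esub> x"
  shows "syzygy_rel R r K i G K' i' G'"
proof -
  note D = sesD[OF s] and D' = sesD[OF s']
  interpret K: Module.module R K by (rule D)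
  interpret G: Module.module R G by (rule D)
  interpret N: Module.module R N by (rule D)
  note p = D(5) and p' = D'(5) and i = D(4) and i' = D'(4)
  obtain \<alpha> where \<alpha>: "\<alpha> \<in> mod_hom R G G'" "\<forall>x\<in>carrier G. p' (\<alpha> x) = a (p x)"
    using projective_module_lift[OF P D'(2,3,5,7) mod_hom_compose[OF p a]] by blast
  obtain \<beta> where \<beta>: "\<beta> \<in> mod_hom R G' G" "\<forall>x\<in>carrier G'. p (\<beta> x) = b (p' x)"
    using projective_module_lift[OF P' D(2,3,5,7) mod_hom_compose[OF p' b]] by blast
  have "p' (\<alpha> (i x)) = \<zero>\<^bsub>N'\<^esub>" if "x \<in> carrier K" for x
    using that \<alpha>(2) hom_closed[OF i] D(9) hom_zero[OF D(3) D'(3) a] by auto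
  then obtain a' where a': "a' \<in> mod_hom R K K'" "\<forall>x\<in>carrier K. i' (a' x) = \<alpha> (i x)"
    using ses_lift[OF s' D(1) mod_hom_compose[OF i \<alpha>(1)]] by blast
  have "p (\<beta> (i' x)) = \<zero>\<^bsub>N\<^esub>" if "x \<in> carrier K'" for x
    using that \<beta>(2) hom_closed[OF i'] D'(9) hom_zero[OF D'(3) D(3) b] by auto
  then obtain b' where b': "b' \<in> mod_hom R K' K" "\<forall>x\<in>carrier K'. i (b' x) = \<beta> (i' x)"
    using ses_lift[OF s D'(1) mod_hom_compose[OF i' \<beta>(1)]] by blast
  \<comment> \<open>The failure on \<open>G\<close> of the identity \<open>b a + p w = r\<close>. It
    vanishes after \<open>p\<close>, so it takes values in \<open>K\<close>; this is the homotopy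
    \<open>h\<close>. On \<open>K\<close> the term \<open>w p\<close> disappears.\<close>
  let ?e = "\<lambda>y. (r \<odot> y \<ominus> \<beta> (\<alpha> y)) \<ominus> w (p y)"
  have e: "?e \<in> mod_hom R G G"
    by (intro hom_diff[OF D(2,2)] hom_scale[OF D(2,2)] hom_id r
        mod_hom_compose[OF \<alpha>(1) \<beta>(1)] mod_hom_compose[OF p w])
  have cl: "\<beta> (\<alpha> y) \<in> carrier G" "w (p y) \<in> carrier G" "\<alpha> y \<in> carrier G'" "p y \<in> carrier N"
    if "y \<in> carrier G" for y
    using that hom_closed[OF \<alpha>(1)] hom_closed[OF \<beta>(1)] hom_closed[OF w] hom_closed[OF p] by auto
  have "p (?e y) = \<zero>\<^bsub>N\<^esub>" if y: "y \<in> carrier G" for y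
  proof -
    have c2: "b (a (p y)) \<in> carrier N" "p (w (p y)) \<in> carrier N"
      using cl[OF y] a b by (auto intro!: hom_closed[OF b] hom_closed[OF a] hom_closed[OF p])
    have "p (?e y) = (r \<odot>\<^bsub>N\<^esub> p y \<ominus>\<^bsub>N\<^esub> b (a (p y))) \<ominus>\<^bsub>N\<^esub> p (w (p y))"
      using y r cl[OF y] \<alpha>(2) \<beta>(2) by (simp add: hom_minus[OF D(2,3) p] hom_smult[OF p])
    also have "\<dots> = \<zero>\<^bsub>N\<^esub>"
      using c2 eq[OF cl(4)[OF y], symmetric] by simp
    finally show ?thesis .
  qed
  then obtain h where h: "h \<in> mod_hom R G K" "\<forall>y\<in>carrier G. i (h y) = ?e y"
    using ses_lift[OF s D(2) e] by blast
  have "b' (a' x) \<oplus>\<^bsub>K\<^esub> h (i x) = r \<odot>\<^bsub>K\<^esub> x" if x: "x \<in> carrier K" for x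
  proof (rule inj_onD[OF D(6)])
    have ix: "i x \<in> carrier G" by (rule hom_closed[OF i x])
    have c: "b' (a' x) \<in> carrier K" "h (i x) \<in> carrier K" "a' x \<in> carrier K'"
      using hom_closed[OF a'(1) x] hom_closed[OF b'(1)] hom_closed[OF h(1) ix] by auto
    show "b' (a' x) \<oplus>\<^bsub>K\<^esub> h (i x) \<in> carrier K" "r \<odot>\<^bsub>K\<^esub> x \<in> carrier K" using c x r by auto
    have "i (b' (a' x) \<oplus>\<^bsub>K\<^esub> h (i x)) = \<beta> (\<alpha> (i x)) \<oplus> ?e (i x)"
      using c x b' a' h ix by (simp add: hom_add[OF i])
    also have "?e (i x) = r \<odot> i x \<ominus> \<beta> (\<alpha> (i x))"
      using x ix r cl[OF ix] by (simp add: D(9) hom_zero[OF D(3,2) w] a_minus_def)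
    also have "\<beta> (\<alpha> (i x)) \<oplus> (r \<odot> i x \<ominus> \<beta> (\<alpha> (i x))) = r \<odot> i x"
      using ix r cl[OF ix] by simp
    finally show "i (b' (a' x) \<oplus>\<^bsub>K\<^esub> h (i x)) = i (r \<odot>\<^bsub>K\<^esub> x)"
      using x r by (simp add: hom_smult[OF i])
  qed
  then show ?thesis unfolding syzygy_rel_def
    using \<alpha>(1) a' b'(1) h(1) by (intro bexI[of _ \<alpha>] bexI[of _ a'] bexI[of _ b'] bexI[of _ h]) auto
qed

section \<open>Vanishing of Ext\<close>

lemma hom_inj_zero_iff:
  assumes "module R A" "module R B" "f \<in> mod_hom R A B" "inj_on f (carrier A)" "x \<in> carrier A"
  shows "f x = \<zero>\<^bsub>B\<^esub> \<longleftrightarrow> x = \<zero>\<^bsub>A\<^esub>"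
proof -
  interpret A: Module.module R A by fact
  show ?thesis using hom_zero[OF assms(1-3)] inj_onD[OF assms(4) _ assms(5) A.M.zero_closed] by metis
qed

lemma hom_extE:
  assumes "hom_ext R K i G Y" "f \<in> mod_hom R K Y"
  obtains g where "g \<in> mod_hom R G Y" "\<And>x. x \<in> carrier K \<Longrightarrow> g (i x) = f x"
  using assms unfolding hom_ext_def by auto

text \<open>The relation on \<open>K\<close> is itself the hypothesis of
  \<open>syzygy_comparison\<close> for \<open>K\<close>: projectivity of \<open>G\<close> lifts the
  homotopy \<open>h\<close> through \<open>p\<close> to \<open>w\<close>, and
  \<open>w \<circ> i\<close> takes the place of the map from the resolved module to its
  cover.\<close>

lemma syzygy_rel_step:
  assumes rel: "syzygy_rel R r K i G K' i' G'" and r: "r \<in> carrier R"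
    and i: "i \<in> mod_hom R K G"
    and s: "ses R K1 i1 G1 p K" and s': "ses R K1' i1' G1' p' K'"
    and P: "projective_module R G" "projective_module R G1" "projective_module R G1'"
  shows "syzygy_rel R r K1 i1 G1 K1' i1' G1'"
proof -
  obtain a b h where h: "a \<in> mod_hom R K K'" "b \<in> mod_hom R K' K" "h \<in> mod_hom R G K"
      "\<forall>x\<in>carrier K. b (a x) \<oplus>\<^bsub>K\<^esub> h (i x) = r \<odot>\<^bsub>K\<^esub> x"
    using rel unfolding syzygy_rel_def by blast
  obtain w where w: "w \<in> mod_hom R G G1" "\<forall>x\<in>carrier G. p (w x) = h x"
    using projective_module_lift[OF P(1) sesD(2,3,5,7)[OF s] h(3)] by blast
  show ?thesis
    by (rule syzygy_comparison[OF s s' P(2,3) h(1,2) mod_hom_compose[OF i w(1)] r])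
      (use w(2) h(4) hom_closed[OF i] in auto)
qed

text \<open>A map \<open>f\<close> on \<open>K\<close> is \<open>f b a + f h i\<close>. The first
  summand extends by the hypothesis on \<open>K'\<close> followed by \<alpha>, and in the second one
  \<open>f h\<close> is already defined on \<open>G\<close>.\<close>

lemma syzygy_rel_hom_ext:
  assumes rel: "syzygy_rel R \<one>\<^bsub>R\<^esub> K i G K' i' G'"
    and mods: "module R K" "module R G" "module R Y"
    and i: "i \<in> mod_hom R K G" and ext: "hom_ext R K' i' G' Y"
  shows "hom_ext R K i G Y"
  unfolding hom_ext_def
proof
  fix f assume f: "f \<in> mod_hom R K Y"
  interpret K: Module.module R K by (rule mods)
  obtain \<alpha> a b h where h: "\<alpha> \<in> mod_hom R G G'" "a \<in> mod_hom R K K'" "b \<in> mod_hom R K' K" "h \<in> mod_hom R G K"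
      "\<And>x. x \<in> carrier K \<Longrightarrow> \<alpha> (i x) = i' (a x)"
      "\<And>x. x \<in> carrier K \<Longrightarrow> b (a x) \<oplus>\<^bsub>K\<^esub> h (i x) = \<one>\<^bsub>R\<^esub> \<odot>\<^bsub>K\<^esub> x"
    using rel unfolding syzygy_rel_def by blast
  obtain g where g: "g \<in> mod_hom R G' Y" "\<And>x. x \<in> carrier K' \<Longrightarrow> g (i' x) = f (b x)"
    by (rule hom_extE[OF ext mod_hom_compose[OF h(3) f]]) (rule that)
  have "g (\<alpha> (i x)) \<oplus>\<^bsub>Y\<^esub> f (h (i x)) = f x" if x: "x \<in> carrier K" for x
  proof -
    have ax: "a x \<in> carrier K'" by (rule hom_closed[OF h(2) x])
    have hx: "h (i x) \<in> carrier K" by (rule hom_closed[OF h(4) hom_closed[OF i x]])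
    have "f (b (a x) \<oplus>\<^bsub>K\<^esub> h (i x)) = f x" using x by (simp add: h(6))
    then show ?thesis
      by (simp add: h(5)[OF x] g(2)[OF ax] hom_add[OF f hom_closed[OF h(3) ax] hx])
  qed
  then show "\<exists>g\<in>mod_hom R G Y. \<forall>x\<in>carrier K. g (i x) = f x"
    by (intro bexI[of _ "\<lambda>y. g (\<alpha> y) \<oplus>\<^bsub>Y\<^esub> f (h y)"] hom_plus[OF mods(2,3)]
        mod_hom_compose[OF h(1) g(1)] mod_hom_compose[OF h(4) f]) auto
qed

text \<open>Interleaving makes \<open>nat \<Rightarrow> 'y\<close> closed under pairing.\<close>

definition pair_fun :: "(nat \<Rightarrow> 'y) \<Rightarrow> (nat \<Rightarrow> 'y) \<Rightarrow> nat \<Rightarrow> 'y" where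
  "pair_fun u v = (\<lambda>n. if even n then u (n div 2) else v (n div 2))"

definition fst_fun :: "(nat \<Rightarrow> 'y) \<Rightarrow> nat \<Rightarrow> 'y" where "fst_fun u = (\<lambda>n. u (2 * n))"
definition snd_fun :: "(nat \<Rightarrow> 'y) \<Rightarrow> nat \<Rightarrow> 'y" where "snd_fun u = (\<lambda>n. u (2 * n + 1))"

lemma fst_pair_fun [simp]: "fst_fun (pair_fun u v) = u"
  and snd_pair_fun [simp]: "snd_fun (pair_fun u v) = v"
  by (auto simp: fst_fun_def snd_fun_def pair_fun_def)

lemma pair_fst_snd_fun [simp]: "pair_fun (fst_fun u) (snd_fun u) = u"
  by (auto simp: fst_fun_def snd_fun_def pair_fun_def fun_eq_iff)

lemma pair_fun_eq_iff [simp]: "pair_fun u v = pair_fun u' v' \<longleftrightarrow> u = u' \<and> v = v'"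
  by (metis fst_pair_fun snd_pair_fun)

section \<open>Products on a fixed type and horseshoe covers\<close>

definition mod_prod ::
  "('a, nat \<Rightarrow> 'y) module \<Rightarrow> ('a, nat \<Rightarrow> 'y) module \<Rightarrow> ('a, nat \<Rightarrow> 'y) module" where
  "mod_prod A B =
     \<lparr>carrier = {u. fst_fun u \<in> carrier A \<and> snd_fun u \<in> carrier B},
      monoid.mult = undefined, monoid.one = undefined,
      ring.zero = pair_fun \<zero>\<^bsub>A\<^esub> \<zero>\<^bsub>B\<^esub>,
      ring.add = (\<lambda>u v. pair_fun (fst_fun u \<oplus>\<^bsub>A\<^esub> fst_fun v) (snd_fun u \<oplus>\<^bsub>B\<^esub> snd_fun v)),
      module.smult = (\<lambda>r u. pair_fun (r \<odot>\<^bsub>A\<^esub> fst_fun u) (r \<odot>\<^bsub>B\<^esub> snd_fun u))\<rparr>"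

lemma mod_prod_sel [simp]:
  "u \<in> carrier (mod_prod A B) \<longleftrightarrow> fst_fun u \<in> carrier A \<and> snd_fun u \<in> carrier B"
  "\<zero>\<^bsub>mod_prod A B\<^esub> = pair_fun \<zero>\<^bsub>A\<^esub> \<zero>\<^bsub>B\<^esub>"
  "u \<oplus>\<^bsub>mod_prod A B\<^esub> v = pair_fun (fst_fun u \<oplus>\<^bsub>A\<^esub> fst_fun v) (snd_fun u \<oplus>\<^bsub>B\<^esub> snd_fun v)"
  "r \<odot>\<^bsub>mod_prod A B\<^esub> u = pair_fun (r \<odot>\<^bsub>A\<^esub> fst_fun u) (r \<odot>\<^bsub>B\<^esub> snd_fun u)"
  by (simp_all add: mod_prod_def)

lemma hom_fst_fun: "fst_fun \<in> mod_hom R (mod_prod A B) A"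
  and hom_snd_fun: "snd_fun \<in> mod_hom R (mod_prod A B) B"
  by (auto simp: mod_hom_def)


lemma module_mod_prod:
  fixes A B :: "('a, nat \<Rightarrow> 'y) module"
  assumes A: "module R A" and B: "module R B" shows "module R (mod_prod A B)"
proof -
  interpret A: Module.module R A by (rule A)
  interpret B: Module.module R B by (rule B)
  show ?thesis
  proof (rule module_if_coordinates[where J = UNIV and \<pi> = "\<lambda>j. if j then fst_fun else snd_fun" and B = "\<lambda>j. if j then A else B"])
    show "x = y" if "\<And>j. j \<in> UNIV \<Longrightarrow> (if j then fst_fun else snd_fun) x = (if j then fst_fun else snd_fun) y" for x y :: "nat \<Rightarrow> 'y"
    proof -
      have "fst_fun x = fst_fun y" "snd_fun x = snd_fun y" using that[of True] that[of False] by simp_all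
      then show ?thesis by (metis pair_fst_snd_fun)
    qed
  qed (auto simp: A B A.R.is_cring hom_fst_fun hom_snd_fun)
qed

lemma hom_pair_zero:
  assumes "module R A" "module R B" shows "(\<lambda>x. pair_fun x \<zero>\<^bsub>B\<^esub>) \<in> mod_hom R A (mod_prod A B)"
proof -
  interpret B: Module.module R B by fact
  show ?thesis by (auto simp: mod_hom_def)
qed

lemma hom_zero_pair:
  assumes "module R A" "module R B" shows "(\<lambda>x. pair_fun \<zero>\<^bsub>A\<^esub> x) \<in> mod_hom R B (mod_prod A B)"
proof -
  interpret A: Module.module R A by fact
  show ?thesis by (auto simp: mod_hom_def)
qed

lemma projective_mod_prod:
  fixes A B :: "('a, nat \<Rightarrow> 'y) module"
  assumes A: "projective_module R A" and B: "projective_module R B"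
  shows "projective_module R (mod_prod A B)"
  unfolding projective_module_def
proof (intro conjI allI impI)
  note mA = projD[OF A] and mB = projD[OF B]
  show mP: "module R (mod_prod A B)" by (rule module_mod_prod[OF mA mB])
  fix C :: "('a, ('a, nat \<Rightarrow> 'y) universe) module" and D :: "('a, ('a, nat \<Rightarrow> 'y) universe) module" and g f
  assume *: "module R C" "module R D" "g \<in> mod_hom R C D" "g ` carrier C = carrier D"
    and f: "f \<in> mod_hom R (mod_prod A B) D"
  interpret A: Module.module R A by (rule mA)
  interpret B: Module.module R B by (rule mB)
  obtain k where k: "k \<in> mod_hom R A C" "\<And>x. x \<in> carrier A \<Longrightarrow> g (k x) = f (pair_fun x \<zero>\<^bsub>B\<^esub>)"
    using projective_module_lift[OF A * mod_hom_compose[OF hom_pair_zero[OF mA mB] f]] by blast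
  obtain l where l: "l \<in> mod_hom R B C" "\<And>x. x \<in> carrier B \<Longrightarrow> g (l x) = f (pair_fun \<zero>\<^bsub>A\<^esub> x)"
    using projective_module_lift[OF B * mod_hom_compose[OF hom_zero_pair[OF mA mB] f]] by blast
  show "\<exists>h\<in>mod_hom R (mod_prod A B) C. \<forall>x\<in>carrier (mod_prod A B). g (h x) = f x"
  proof (intro bexI[of _ "\<lambda>u. k (fst_fun u) \<oplus>\<^bsub>C\<^esub> l (snd_fun u)"] ballI)
    fix u assume u: "u \<in> carrier (mod_prod A B)"
    then have 1: "fst_fun u \<in> carrier A" "snd_fun u \<in> carrier B" by auto
    have "g (k (fst_fun u) \<oplus>\<^bsub>C\<^esub> l (snd_fun u)) = f (pair_fun (fst_fun u) \<zero>\<^bsub>B\<^esub>) \<oplus>\<^bsub>D\<^esub> f (pair_fun \<zero>\<^bsub>A\<^esub> (snd_fun u))"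
      using 1 hom_closed[OF k(1)] hom_closed[OF l(1)] by (simp add: hom_add[OF *(3)] k l)
    also have "\<dots> = f u"
      using 1 by (subst hom_add[OF f, symmetric]) auto
    finally show "g (k (fst_fun u) \<oplus>\<^bsub>C\<^esub> l (snd_fun u)) = f u" .
  qed (intro hom_plus[OF mP *(1)] mod_hom_compose[OF hom_fst_fun k(1)] mod_hom_compose[OF hom_snd_fun l(1)])
qed

text \<open>The kernel sequence of the horseshoe lemma. \<open>H\<close> will be the kernel of a map
  defined on the product of \<open>A\<close> and \<open>B\<close>: the first two conditions say that
  its projection to \<open>B\<close> is the kernel \<open>Z\<close> of \<open>q\<close>, the third
  one that it meets \<open>A\<close> in the kernel \<open>K\<close> of \<open>p\<close>.\<close>

lemma mod_prod_ses:
  fixes B (structure)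
  assumes H: "submodule H R (mod_prod A B)"
    and sA: "ses R K i A p A'" and sB: "ses R Z j B q B'"
    and 1: "\<And>u. u \<in> H \<Longrightarrow> q (snd_fun u) = \<zero>\<^bsub>B'\<^esub>"
    and 2: "\<And>y. y \<in> carrier B \<Longrightarrow> q y = \<zero>\<^bsub>B'\<^esub> \<Longrightarrow> \<exists>x\<in>carrier A. pair_fun x y \<in> H"
    and 3: "\<And>x. x \<in> carrier A \<Longrightarrow> pair_fun x \<zero> \<in> H \<longleftrightarrow> p x = \<zero>\<^bsub>A'\<^esub>"
  shows "\<exists>\<pi>. ses R K (\<lambda>k. pair_fun (i k) \<zero>) ((mod_prod A B)\<lparr>carrier := H\<rparr>) \<pi> Z \<and>
    (\<forall>u\<in>H. j (\<pi> u) = snd_fun u)"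
proof -
  note A = sesD[OF sA] and B = sesD[OF sB]
  have mP: "module R (mod_prod A B)" by (rule module_mod_prod[OF A(2) B(2)])
  note H = submoduleD[OF mP H]
  interpret K: Module.module R K by (rule A)
  interpret Z: Module.module R Z by (rule B)
  interpret A: Module.module R A by (rule A)
  interpret B: Module.module R B by (rule B)
  let ?H = "(mod_prod A B)\<lparr>carrier := H\<rparr>"
  have snd: "snd_fun \<in> mod_hom R ?H B" using hom_snd_fun H(1) by (rule hom_restrict_dom)
  obtain \<pi> where \<pi>: "\<pi> \<in> mod_hom R ?H Z" "\<And>u. u \<in> H \<Longrightarrow> j (\<pi> u) = snd_fun u"
    using ses_lift[OF sB H(3) snd] 1 by auto
  have HA: "fst_fun u \<in> carrier A" "snd_fun u \<in> carrier B" if "u \<in> H" for u using that H(1) by auto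
  have "\<pi> ` H = carrier Z"
  proof (intro equalityI subsetI)
    fix z assume z: "z \<in> carrier Z"
    obtain x where x: "x \<in> carrier A" "pair_fun x (j z) \<in> H"
      using 2[OF hom_closed[OF B(4) z]] B(9)[OF z] by blast
    have "\<pi> (pair_fun x (j z)) = z"
      using x z \<pi>(2)[OF x(2)] hom_closed[OF \<pi>(1), of "pair_fun x (j z)"] by (intro inj_onD[OF B(6)]) auto
    then show "z \<in> \<pi> ` H" using x(2) by (metis imageI)
  qed (use hom_closed[OF \<pi>(1)] in auto)
  moreover have "(\<lambda>k. pair_fun (i k) \<zero>) ` carrier K = {u \<in> H. \<pi> u = \<zero>\<^bsub>Z\<^esub>}"
  proof (intro equalityI subsetI)
    fix u assume "u \<in> {u \<in> H. \<pi> u = \<zero>\<^bsub>Z\<^esub>}"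
    then have u: "u \<in> H" "\<pi> u = \<zero>\<^bsub>Z\<^esub>" by auto
    have s0: "snd_fun u = \<zero>" using \<pi>(2)[OF u(1)] u(2) hom_zero[OF B(1,2,4)] by simp
    then have u': "pair_fun (fst_fun u) \<zero> = u" using pair_fst_snd_fun[of u] by simp
    then have "p (fst_fun u) = \<zero>\<^bsub>A'\<^esub>" using 3[OF HA(1)[OF u(1)]] u(1) by simp
    then have "fst_fun u \<in> i ` carrier K" using A(8) HA(1)[OF u(1)] by auto
    then obtain k where "k \<in> carrier K" "fst_fun u = i k" by auto
    then show "u \<in> (\<lambda>k. pair_fun (i k) \<zero>) ` carrier K" using u' by auto
  next
    fix u assume "u \<in> (\<lambda>k. pair_fun (i k) \<zero>) ` carrier K"
    then obtain k where k: "k \<in> carrier K" "u = pair_fun (i k) \<zero>" by auto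
    then have u: "u \<in> H" using 3[OF hom_closed[OF A(4) k(1)]] A(9) by auto
    have "\<pi> u = \<zero>\<^bsub>Z\<^esub>"
      using u k \<pi>(2)[OF u] hom_closed[OF \<pi>(1), of u] hom_zero[OF B(1,2,4)] by (intro inj_onD[OF B(6)]) auto
    then show "u \<in> {u \<in> H. \<pi> u = \<zero>\<^bsub>Z\<^esub>}" using u by auto
  qed
  moreover have "(\<lambda>k. pair_fun (i k) \<zero>) \<in> mod_hom R K ?H"
    by (intro hom_restrict_cod mod_hom_compose[OF A(4) hom_pair_zero[OF A(2) B(2)]])
      (use 3 A(9) hom_closed[OF A(4)] in auto)
  ultimately show ?thesis
    using \<pi> A(1,6) B(1) H(3) unfolding ses_def
    by (intro exI[of _ \<pi>]) (auto simp: inj_on_def)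
qed

text \<open>Extend along \<open>A\<close> first. What remains of \<open>f\<close> vanishes on
  \<open>K\<close>, hence factors through \<open>Z\<close>, and is extended along
  \<open>B\<close>.\<close>

lemma mod_prod_hom_ext:
  fixes Y (structure)
  assumes s: "ses R K (\<lambda>k. pair_fun (i k) \<zero>\<^bsub>B\<^esub>) ((mod_prod A B)\<lparr>carrier := H\<rparr>) \<pi> Z"
    and mods: "module R A" "module R B" "module R Y" and HP: "H \<subseteq> carrier (mod_prod A B)"
    and \<pi>: "\<And>u. u \<in> H \<Longrightarrow> j (\<pi> u) = snd_fun u"
    and eA: "hom_ext R K i A Y" and eB: "hom_ext R Z j B Y"
  shows "hom_ext R ((mod_prod A B)\<lparr>carrier := H\<rparr>) (\<lambda>x. x) (mod_prod A B) Y"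
  unfolding hom_ext_def
proof
  let ?H = "(mod_prod A B)\<lparr>carrier := H\<rparr>"
  fix f assume f: "f \<in> mod_hom R ?H Y"
  note s = sesD[OF s]
  interpret Y: Module.module R Y by fact
  have mP: "module R (mod_prod A B)" by (rule module_mod_prod[OF mods(1,2)])
  obtain g where g: "g \<in> mod_hom R A Y" "\<And>k. k \<in> carrier K \<Longrightarrow> g (i k) = f (pair_fun (i k) \<zero>\<^bsub>B\<^esub>)"
    by (rule hom_extE[OF eA mod_hom_compose[OF s(4) f]]) (rule that)
  have gf: "(\<lambda>u. g (fst_fun u)) \<in> mod_hom R ?H Y"
    by (intro mod_hom_compose[OF _ g(1)] hom_restrict_dom[OF hom_fst_fun HP])
  have "f u \<ominus> g (fst_fun u) = \<zero>" if u: "u \<in> carrier ?H" "\<pi> u = \<zero>\<^bsub>Z\<^esub>" for u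
  proof -
    have "u \<in> (\<lambda>k. pair_fun (i k) \<zero>\<^bsub>B\<^esub>) ` carrier K" using u s(8) by auto
    then obtain k where k: "k \<in> carrier K" "u = pair_fun (i k) \<zero>\<^bsub>B\<^esub>" by auto
    have "g (fst_fun u) = f u" using g(2)[OF k(1)] k(2) by simp
    then show ?thesis using hom_closed[OF f u(1)] by simp
  qed
  then obtain f2 where f2: "f2 \<in> mod_hom R Z Y" "\<And>u. u \<in> H \<Longrightarrow> f2 (\<pi> u) = f u \<ominus> g (fst_fun u)"
    using surj_factor[OF s(2,3) mods(3) s(5,7) hom_diff[OF s(2) mods(3) f gf]] by auto
  obtain l where l: "l \<in> mod_hom R B Y" "\<And>z. z \<in> carrier Z \<Longrightarrow> l (j z) = f2 z"
    by (rule hom_extE[OF eB f2(1)]) (rule that)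
  show "\<exists>g\<in>mod_hom R (mod_prod A B) Y. \<forall>x\<in>carrier ?H. g x = f x"
  proof (intro bexI[of _ "\<lambda>u. g (fst_fun u) \<oplus> l (snd_fun u)"] ballI)
    fix u assume "u \<in> carrier ?H"
    then have u: "u \<in> H" by simp
    have "l (snd_fun u) = f u \<ominus> g (fst_fun u)"
      using l(2)[of "\<pi> u"] \<pi>[OF u] f2(2)[OF u] hom_closed[OF s(5)] u by simp
    then show "g (fst_fun u) \<oplus> l (snd_fun u) = f u"
      using hom_closed[OF f] hom_closed[OF gf] u by simp
  qed (intro hom_plus[OF mP mods(3)] mod_hom_compose[OF hom_fst_fun g(1)] mod_hom_compose[OF hom_snd_fun l(1)])
qed

text \<open>\<open>ext_perp R Y N\<close> expresses that \<open>Ext\<^sup>i(N, Y) = 0\<close> for all \<open>i > 0\<close>. All syzygies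
  have to live on one type, which must therefore be closed under pairing.\<close>

coinductive ext_perp ::
  "('a, 'r) ring_scheme \<Rightarrow> ('a, 'x, 'm) module_scheme \<Rightarrow> ('a, nat \<Rightarrow> 'y) module \<Rightarrow> bool"
  for R Y where
  ext_perpI: "ses R K i (G :: ('a, nat \<Rightarrow> 'y) module) p N \<Longrightarrow> projective_module R G \<Longrightarrow> hom_ext R K i G Y \<Longrightarrow> ext_perp R Y K \<Longrightarrow> ext_perp R Y N"

text \<open>Vanishing in degree 1 does not depend on the cover: the given cover and the one hidden
  in \<open>ext_perp\<close> are compared by identities, with \<open>r = 1\<close> and
  \<open>w = 0\<close>. The given cover may live on any type.\<close>

lemma ext_perp_hom_ext:
  assumes N: "ext_perp R Y N" and Y: "module R Y" and s: "ses R K i G p N" and G: "projective_module R G"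
  shows "hom_ext R K i G Y"
proof -
  interpret N: Module.module R N by (rule sesD[OF s])
  from N show ?thesis
  proof cases
    case (ext_perpI K' i' G' p')
    note s' = ext_perpI(1-3)
  have "syzygy_rel R \<one>\<^bsub>R\<^esub> K i G K' i' G'"
    by (rule syzygy_comparison[OF s s'(1) G s'(2) hom_id hom_id hom_const_zero[OF sesD(2)[OF s]]])
      (use hom_zero[OF sesD(2,3,5)[OF s]] in auto)
  then show ?thesis
    by (rule syzygy_rel_hom_ext[OF _ sesD(1,2)[OF s] Y sesD(4)[OF s] s'(3)])
  qed
qed

section \<open>The class of modules without higher Ext against a fixed module\<close>

lemma ext_perp_zero:
  assumes "module R N" "carrier N = {\<zero>\<^bsub>N\<^esub>}" shows "ext_perp R Y N"
proof -
  have "module R N \<and> carrier N = {\<zero>\<^bsub>N\<^esub>}" using assms by simp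
  then show ?thesis
  proof (coinduction arbitrary: N)
    case ext_perp
    have "ses R N (\<lambda>x. x) N (\<lambda>x. x) N" using ext_perp by (auto simp: ses_def hom_id)
    moreover have "hom_ext R N (\<lambda>x. x) N Y" by (auto simp: hom_ext_def)
    moreover have "projective_module R N" using ext_perp by (intro projective_zero) auto
    ultimately show ?case using ext_perp by blast
  qed
qed

lemma ext_perp_projective:
  assumes N: "projective_module R N" and Y: "module R Y" shows "ext_perp R Y N"
proof -
  note mN = projD[OF N]
  interpret N: Module.module R N by (rule mN)
  interpret Y: Module.module R Y by (rule Y)
  let ?K = "N\<lparr>carrier := {\<zero>\<^bsub>N\<^esub>}\<rparr>"
  have s: "ses R ?K (\<lambda>x. x) N (\<lambda>x. x) N"
    by (rule ses_inclusion[OF mN mN hom_id]) auto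
  show ?thesis
  proof (rule ext_perpI[OF s N])
    show "ext_perp R Y ?K" by (rule ext_perp_zero[OF sesD(1)[OF s]]) simp
    show "hom_ext R ?K (\<lambda>x. x) N Y" unfolding hom_ext_def
    proof
      fix f assume "f \<in> mod_hom R ?K Y"
      from hom_zero[OF sesD(1)[OF s] Y this]
      show "\<exists>g\<in>mod_hom R N Y. \<forall>x\<in>carrier ?K. g x = f x"
        by (intro bexI[OF _ hom_const_zero[OF Y]]) auto
    qed
  qed
qed

text \<open>The horseshoe lemma as a coinduction: the sum of covers of \<open>K\<close> and
  \<open>Z\<close> covers \<open>W\<close>, and its kernel is an extension of the two syzygies, so
  being an extension of two modules of the class is an invariant.\<close>

lemma ext_perp_extension:
  fixes K W Z :: "('a, nat \<Rightarrow> 'y) module"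
  assumes "ses R K i W p Z" "ext_perp R Y K" "ext_perp R Y Z" and Y: "module R Y"
  shows "ext_perp R Y W"
proof -
  have "\<exists>(K :: ('a, nat \<Rightarrow> 'y) module) i (Z :: ('a, nat \<Rightarrow> 'y) module) p.
      ses R K i W p Z \<and> ext_perp R Y K \<and> ext_perp R Y Z"
    using assms by blast
  then show ?thesis
  proof (coinduction arbitrary: W)
    case ext_perp
    then obtain K Z :: "('a, nat \<Rightarrow> 'y) module" and i p
      where s: "ses R K i W p Z" and K: "ext_perp R Y K" and Z: "ext_perp R Y Z" by blast
    note D = sesD[OF s]
    from K obtain K1 A :: "('a, nat \<Rightarrow> 'y) module" and iA pA where
      sA: "ses R K1 iA A pA K" and A: "projective_module R A" "hom_ext R K1 iA A Y" "ext_perp R Y K1"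
      by (cases rule: ext_perp.cases) auto
    from Z obtain Z1 B :: "('a, nat \<Rightarrow> 'y) module" and iB pB where
      sB: "ses R Z1 iB B pB Z" and B: "projective_module R B" "hom_ext R Z1 iB B Y" "ext_perp R Y Z1"
      by (cases rule: ext_perp.cases) auto
    note DA = sesD[OF sA] and DB = sesD[OF sB]
    interpret Z: Module.module R Z by (rule D)
    interpret W: Module.module R W by (rule D)
    interpret A: Module.module R A by (rule DA)
    interpret B: Module.module R B by (rule DB)
    obtain \<sigma> where \<sigma>: "\<sigma> \<in> mod_hom R B W" "\<And>y. y \<in> carrier B \<Longrightarrow> p (\<sigma> y) = pB y"
      using projective_module_lift[OF B(1) D(2,3,5,7) DB(5)] by blast
    \<comment> \<open>The horseshoe map: \<open>A\<close> reaches the image of \<open>K\<close>, and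
      \<sigma> lifts the cover of \<open>Z\<close> to \<open>W\<close>.\<close>
    define q where "q = (\<lambda>u. i (pA (fst_fun u)) \<oplus>\<^bsub>W\<^esub> \<sigma> (snd_fun u))"
    have mP: "module R (mod_prod A B)" by (rule module_mod_prod[OF DA(2) DB(2)])
    have q: "q \<in> mod_hom R (mod_prod A B) W"
      unfolding q_def
      by (intro hom_plus[OF mP D(2)] mod_hom_compose[OF hom_fst_fun mod_hom_compose[OF DA(5) D(4)]]
          mod_hom_compose[OF hom_snd_fun \<sigma>(1)])
    have iA: "i (pA x) \<in> carrier W" "p (i (pA x)) = \<zero>\<^bsub>Z\<^esub>" if "x \<in> carrier A" for x
      using hom_closed[OF D(4) hom_closed[OF DA(5) that]] D(9)[OF hom_closed[OF DA(5) that]] by auto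
    have pre: "\<exists>x\<in>carrier A. i (pA x) = w" if "w \<in> carrier W" "p w = \<zero>\<^bsub>Z\<^esub>" for w
    proof -
      have "w \<in> i ` pA ` carrier A" using that D(8) DA(7) by auto
      then show ?thesis by auto
    qed
    have surj: "q ` carrier (mod_prod A B) = carrier W"
    proof (intro equalityI subsetI)
      fix w assume w: "w \<in> carrier W"
      then obtain y where y: "y \<in> carrier B" "pB y = p w" using DB(7) hom_closed[OF D(5)] by (metis imageE)
      have sy: "\<sigma> y \<in> carrier W" by (rule hom_closed[OF \<sigma>(1) y(1)])
      have "p (w \<ominus>\<^bsub>W\<^esub> \<sigma> y) = \<zero>\<^bsub>Z\<^esub>"
        using w sy y \<sigma>(2)[OF y(1)] hom_closed[OF D(5) w] by (simp add: hom_minus[OF D(2,3,5)])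
      then obtain x where x: "x \<in> carrier A" "i (pA x) = w \<ominus>\<^bsub>W\<^esub> \<sigma> y" using pre[of "w \<ominus>\<^bsub>W\<^esub> \<sigma> y"] w sy by auto
      have "q (pair_fun x y) = w" using x w sy by (simp add: q_def)
      then show "w \<in> q ` carrier (mod_prod A B)" using x(1) y(1) by (intro image_eqI[of _ _ "pair_fun x y"]) auto
    qed (use hom_closed[OF q] in blast)
    define H where "H = {u \<in> carrier (mod_prod A B). q u = \<zero>\<^bsub>W\<^esub>}"
    let ?H = "(mod_prod A B)\<lparr>carrier := H\<rparr>"
    have H: "submodule H R (mod_prod A B)" unfolding H_def by (rule submodule_kernel[OF mP D(2) q])
    have sH: "ses R ?H (\<lambda>x. x) (mod_prod A B) q W" by (rule ses_inclusion[OF mP D(2) q surj H_def])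
    have "\<exists>\<pi>. ses R K1 (\<lambda>k. pair_fun (iA k) \<zero>\<^bsub>B\<^esub>) ?H \<pi> Z1 \<and> (\<forall>u\<in>H. iB (\<pi> u) = snd_fun u)"
    proof (rule mod_prod_ses[OF H sA sB])
      fix u assume "u \<in> H"
      then have u: "fst_fun u \<in> carrier A" "snd_fun u \<in> carrier B" "q u = \<zero>\<^bsub>W\<^esub>" by (auto simp: H_def)
      have "p (q u) = pB (snd_fun u)"
        using u(1,2) iA hom_closed[OF \<sigma>(1)] hom_closed[OF DB(5)] unfolding q_def by (simp add: hom_add[OF D(5)] \<sigma>(2))
      then show "pB (snd_fun u) = \<zero>\<^bsub>Z\<^esub>" using u(3) hom_zero[OF D(2,3,5)] by simp
    next
      fix y assume y: "y \<in> carrier B" "pB y = \<zero>\<^bsub>Z\<^esub>"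
      then have sy: "\<sigma> y \<in> carrier W" "p (\<sigma> y) = \<zero>\<^bsub>Z\<^esub>" using hom_closed[OF \<sigma>(1)] \<sigma>(2) by auto
      have "p (\<ominus>\<^bsub>W\<^esub> \<sigma> y) = \<zero>\<^bsub>Z\<^esub>" using sy by (simp add: hom_neg[OF D(2,3,5)])
      then obtain x where x: "x \<in> carrier A" "i (pA x) = \<ominus>\<^bsub>W\<^esub> \<sigma> y" using pre[of "\<ominus>\<^bsub>W\<^esub> \<sigma> y"] sy by auto
      then show "\<exists>x\<in>carrier A. pair_fun x y \<in> H"
        using y sy by (intro bexI[of _ x]) (auto simp: H_def q_def W.M.l_neg)
    next
      fix x assume x: "x \<in> carrier A"
      interpret K: Module.module R K by (rule D)
      have "q (pair_fun x \<zero>\<^bsub>B\<^esub>) = i (pA x)" using iA[OF x] hom_zero[OF DB(2) D(2) \<sigma>(1)] by (simp add: q_def)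
      moreover have "i (pA x) = \<zero>\<^bsub>W\<^esub> \<longleftrightarrow> pA x = \<zero>\<^bsub>K\<^esub>"
        by (rule hom_inj_zero_iff[OF D(1,2,4,6) hom_closed[OF DA(5) x]])
      ultimately show "pair_fun x \<zero>\<^bsub>B\<^esub> \<in> H \<longleftrightarrow> pA x = \<zero>\<^bsub>K\<^esub>" using x by (simp add: H_def)
    qed
    then obtain \<pi> where \<pi>: "ses R K1 (\<lambda>k. pair_fun (iA k) \<zero>\<^bsub>B\<^esub>) ?H \<pi> Z1" "\<And>u. u \<in> H \<Longrightarrow> iB (\<pi> u) = snd_fun u"
      by blast
    have "hom_ext R ?H (\<lambda>x. x) (mod_prod A B) Y"
      by (rule mod_prod_hom_ext[OF \<pi>(1) DA(2) DB(2) Y _ \<pi>(2) A(2) B(2)]) (auto simp: H_def)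
    then show ?case
      using sH projective_mod_prod[OF A(1) B(1)] \<pi>(1) A(3) B(3) by blast
  qed
qed

text \<open>\<open>B\<close> is covered by the sum of the covers of \<open>Z\<close> and of the first syzygy of \<open>C\<close>; the kernel \<open>L\<close> of
  this cover is filtered by the second syzygy of \<open>C\<close>, the first syzygy of \<open>Z\<close> and the cover of \<open>C\<close>.\<close>

lemma ext_perp_kernel:
  fixes B Z C :: "('a, nat \<Rightarrow> 'y) module"
  assumes s: "ses R B i Z p C" and Z: "ext_perp R Y Z" and C: "ext_perp R Y C" and Y: "module R Y"
  shows "ext_perp R Y B"
proof -
  from Z obtain Z1 F :: "('a, nat \<Rightarrow> 'y) module" and iF pF where
    sF: "ses R Z1 iF F pF Z" and F: "projective_module R F" "hom_ext R Z1 iF F Y" "ext_perp R Y Z1"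
    by (cases rule: ext_perp.cases) auto
  from C obtain K G :: "('a, nat \<Rightarrow> 'y) module" and iG pG where
    sG: "ses R K iG G pG C" and G: "projective_module R G" "ext_perp R Y K"
    by (cases rule: ext_perp.cases) auto
  from G(2) obtain K1 A :: "('a, nat \<Rightarrow> 'y) module" and iA pA where
    sA: "ses R K1 iA A pA K" and A: "projective_module R A" "hom_ext R K1 iA A Y" "ext_perp R Y K1"
    by (cases rule: ext_perp.cases) auto
  note D = sesD[OF s] and DF = sesD[OF sF] and DG = sesD[OF sG] and DA = sesD[OF sA]
  interpret B: Module.module R B by (rule D)
  interpret Z: Module.module R Z by (rule D)
  interpret C: Module.module R C by (rule D)
  interpret A: Module.module R A by (rule DA)
  interpret F: Module.module R F by (rule DF)
  interpret G: Module.module R G by (rule DG)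
  interpret Y: Module.module R Y by (rule Y)
  let ?P = "mod_prod A F"
  have mP: "module R ?P" by (rule module_mod_prod[OF DA(2) DF(2)])
  interpret P: Module.module R ?P by (rule mP)
  obtain \<sigma> where \<sigma>: "\<sigma> \<in> mod_hom R G Z" "\<And>x. x \<in> carrier G \<Longrightarrow> p (\<sigma> x) = pG x"
    using projective_module_lift[OF G(1) D(2,3,5,7) DG(5)] by blast
  obtain \<gamma> where \<gamma>: "\<gamma> \<in> mod_hom R F G" "\<And>x. x \<in> carrier F \<Longrightarrow> pG (\<gamma> x) = p (pF x)"
    using projective_module_lift[OF F(1) DG(2,3,5,7) mod_hom_compose[OF DF(5) D(5)]] by blast
  \<comment> \<open>Built so that \<open>pG (m u) = p (pF (snd_fun u))\<close>; the summand
    \<open>A\<close> reaches all of the kernel of \<open>pG\<close>, which makes \<open>m\<close>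
    flexible enough for \<open>reach\<close>.\<close>
  define m where "m = (\<lambda>u. iG (pA (fst_fun u)) \<oplus>\<^bsub>G\<^esub> \<gamma> (snd_fun u))"
  have m: "m \<in> mod_hom R ?P G" unfolding m_def
    by (intro hom_plus[OF mP DG(2)] mod_hom_compose[OF hom_fst_fun mod_hom_compose[OF DA(5) DG(4)]]
        mod_hom_compose[OF hom_snd_fun \<gamma>(1)])
  have iA: "iG (pA x) \<in> carrier G" "pG (iG (pA x)) = \<zero>\<^bsub>C\<^esub>" if "x \<in> carrier A" for x
    using hom_closed[OF DG(4) hom_closed[OF DA(5) that]] DG(9)[OF hom_closed[OF DA(5) that]] by auto
  have pre: "\<exists>x\<in>carrier A. iG (pA x) = w" if "w \<in> carrier G" "pG w = \<zero>\<^bsub>C\<^esub>" for w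
  proof -
    have "w \<in> iG ` pA ` carrier A" using that DG(8) DA(7) by auto
    then show ?thesis by auto
  qed
  note cl = hom_closed[OF \<sigma>(1)] hom_closed[OF \<gamma>(1)] hom_closed[OF m] hom_closed[OF DF(5)] hom_closed[OF D(5)]
  have pGm: "pG (m u) = p (pF (snd_fun u))" if "u \<in> carrier ?P" for u
    using that iA cl unfolding m_def by (simp add: hom_add[OF DG(5)] \<gamma>(2))
  have reach: "\<exists>x\<in>carrier A. m (pair_fun x y) = g"
    if y: "y \<in> carrier F" and g: "g \<in> carrier G" and eq: "pG g = p (pF y)" for y g
  proof -
    have gy: "\<gamma> y \<in> carrier G" by (rule cl(2)[OF y])
    have "pG (g \<ominus>\<^bsub>G\<^esub> \<gamma> y) = \<zero>\<^bsub>C\<^esub>"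
      unfolding hom_minus[OF DG(2,3,5) g gy] \<gamma>(2)[OF y] eq using cl(4,5) y by simp
    then obtain x where x: "x \<in> carrier A" "iG (pA x) = g \<ominus>\<^bsub>G\<^esub> \<gamma> y"
      using pre[of "g \<ominus>\<^bsub>G\<^esub> \<gamma> y"] g gy by auto
    then have "m (pair_fun x y) = g" using g gy by (simp add: m_def)
    then show ?thesis using x(1) by blast
  qed
  \<comment> \<open>The pair of \<open>m\<close> and \<open>pF \<circ> snd_fun\<close> maps the
    product onto the pullback of \<open>pG\<close> and \<open>p\<close>. The lift \<sigma> splits
    this pullback into \<open>B\<close> and \<open>G\<close>; the two coordinates are
    \<open>c\<close> and \<open>m\<close>.\<close>
  let ?c = "\<lambda>u. pF (snd_fun u) \<ominus>\<^bsub>Z\<^esub> \<sigma> (m u)"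
  have c': "?c \<in> mod_hom R ?P Z"
    by (intro hom_diff[OF mP D(2)] mod_hom_compose[OF hom_snd_fun DF(5)] mod_hom_compose[OF m \<sigma>(1)])
  have "p (?c u) = \<zero>\<^bsub>C\<^esub>" if u: "u \<in> carrier ?P" for u
  proof -
    have 1: "m u \<in> carrier G" "pF (snd_fun u) \<in> carrier Z"
      using cl(3)[OF u] u cl(4)[of "snd_fun u"] by auto
    have "p (?c u) = p (pF (snd_fun u)) \<ominus>\<^bsub>C\<^esub> pG (m u)"
      unfolding hom_minus[OF D(2,3,5) 1(2) cl(1)[OF 1(1)]] \<sigma>(2)[OF 1(1)] ..
    then show ?thesis unfolding pGm[OF u] using cl(5)[OF 1(2)] by simp
  qed
  then obtain c where c: "c \<in> mod_hom R ?P B" "\<And>u. u \<in> carrier ?P \<Longrightarrow> i (c u) = ?c u"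
    using ses_lift[OF s mP c'] by blast
  have i_eq: "b = b'" if "b \<in> carrier B" "b' \<in> carrier B" "i b = i b'" for b b'
    using inj_onD[OF D(6)] that by blast
  have surj: "c ` carrier ?P = carrier B"
  proof (intro equalityI subsetI)
    fix b assume b: "b \<in> carrier B"
    then have ib: "i b \<in> carrier Z" by (rule hom_closed[OF D(4)])
    obtain y where y: "y \<in> carrier F" "pF y = i b" using ib DF(7) by (metis imageE)
    obtain x where x: "x \<in> carrier A" "m (pair_fun x y) = \<zero>\<^bsub>G\<^esub>"
      using reach[OF y(1), of "\<zero>\<^bsub>G\<^esub>"] y(2) D(9)[OF b] hom_zero[OF DG(2,3,5)] by auto
    have u: "pair_fun x y \<in> carrier ?P" using x y by simp
    have "c (pair_fun x y) = b"
    proof (rule i_eq[OF hom_closed[OF c(1) u] b])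
      show "i (c (pair_fun x y)) = i b"
        unfolding c(2)[OF u] x(2) hom_zero[OF DG(2) D(2) \<sigma>(1)] using y ib by (simp add: a_minus_def)
    qed
    then show "b \<in> c ` carrier ?P" using u by (metis imageI)
  qed (use hom_closed[OF c(1)] in blast)
  define L where "L = {u \<in> carrier ?P. c u = \<zero>\<^bsub>B\<^esub>}"
  \<comment> \<open>On the kernel \<open>L\<close> of the cover \<open>c\<close>, the map
    \<open>m\<close> is onto \<open>G\<close>; its kernel \<open>L0\<close> is the kernel of the map
    from the product to the pullback, an extension of \<open>Z1\<close> by
    \<open>K1\<close>.\<close>
  define L0 where "L0 = {u \<in> L. m u = \<zero>\<^bsub>G\<^esub>}"
  let ?L = "?P\<lparr>carrier := L\<rparr>" and ?LL = "?P\<lparr>carrier := L0\<rparr>"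
  have L: "submodule L R ?P" unfolding L_def by (rule submodule_kernel[OF mP D(1) c(1)])
  have sL: "ses R ?L (\<lambda>x. x) ?P c B" by (rule ses_inclusion[OF mP D(1) c(1) surj L_def])
  have mL: "module R ?L" by (rule submoduleD[OF mP L])
  have LP: "L \<subseteq> carrier ?P" by (auto simp: L_def)
  have L_iff: "u \<in> L \<longleftrightarrow> u \<in> carrier ?P \<and> pF (snd_fun u) = \<sigma> (m u)" for u
  proof (cases "u \<in> carrier ?P")
    case True
    have "c u = \<zero>\<^bsub>B\<^esub> \<longleftrightarrow> i (c u) = \<zero>\<^bsub>Z\<^esub>"
      by (rule hom_inj_zero_iff[OF D(1,2,4,6) hom_closed[OF c(1) True], symmetric])
    also have "\<dots> \<longleftrightarrow> pF (snd_fun u) = \<sigma> (m u)"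
      unfolding c(2)[OF True] using True cl(3)[OF True] cl(1,4) by (intro Z.M.minus_eq_zero_iff) auto
    finally show ?thesis using True by (simp add: L_def)
  qed (auto simp: L_def)
  have mL': "m \<in> mod_hom R ?L G" by (rule hom_restrict_dom[OF m LP])
  have "m ` L = carrier G"
  proof (intro equalityI subsetI)
    fix g assume g: "g \<in> carrier G"
    then obtain y where y: "y \<in> carrier F" "pF y = \<sigma> g" using DF(7) cl(1)[OF g] by (metis imageE)
    obtain x where x: "x \<in> carrier A" "m (pair_fun x y) = g"
      using reach[OF y(1) g] y(2) \<sigma>(2)[OF g] by auto
    have "pair_fun x y \<in> L" using x y by (simp add: L_iff)
    then show "g \<in> m ` L" using x(2) by (metis imageI)
  qed (use cl(3) LP in blast)
  then have sL0: "ses R (?L\<lparr>carrier := L0\<rparr>) (\<lambda>x. x) ?L m G"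
    by (intro ses_inclusion[OF mL DG(2) mL']) (auto simp: L0_def)
  then have sL0: "ses R ?LL (\<lambda>x. x) ?L m G" by simp
  have "submodule {u \<in> carrier ?P. c u = \<zero>\<^bsub>B\<^esub> \<and> m u = \<zero>\<^bsub>G\<^esub>} R ?P"
    by (rule submoduleI'[OF mP])
      (auto simp: hom_zero[OF mP D(1) c(1), simplified] hom_zero[OF mP DG(2) m, simplified]
        hom_add[OF c(1), simplified] hom_add[OF m, simplified]
        hom_smult[OF c(1), simplified] hom_smult[OF m, simplified])
  also have "{u \<in> carrier ?P. c u = \<zero>\<^bsub>B\<^esub> \<and> m u = \<zero>\<^bsub>G\<^esub>} = L0" by (auto simp: L0_def L_def)
  finally have L0: "submodule L0 R ?P" .
  have L0_iff: "u \<in> L0 \<longleftrightarrow> u \<in> carrier ?P \<and> pF (snd_fun u) = \<zero>\<^bsub>Z\<^esub> \<and> m u = \<zero>\<^bsub>G\<^esub>" for u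
    unfolding L0_def mem_Collect_eq L_iff using hom_zero[OF DG(2) D(2) \<sigma>(1)] by auto
  have "\<exists>\<pi>. ses R K1 (\<lambda>k. pair_fun (iA k) \<zero>\<^bsub>F\<^esub>) ?LL \<pi> Z1 \<and> (\<forall>u\<in>L0. iF (\<pi> u) = snd_fun u)"
  proof (rule mod_prod_ses[OF L0 sA sF])
    fix u assume "u \<in> L0" then show "pF (snd_fun u) = \<zero>\<^bsub>Z\<^esub>" by (simp add: L0_iff)
  next
    fix y assume y: "y \<in> carrier F" "pF y = \<zero>\<^bsub>Z\<^esub>"
    obtain x where x: "x \<in> carrier A" "m (pair_fun x y) = \<zero>\<^bsub>G\<^esub>"
      using reach[OF y(1), of "\<zero>\<^bsub>G\<^esub>"] y(2) hom_zero[OF DG(2,3,5)] hom_zero[OF D(2,3,5)] by auto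
    then show "\<exists>x\<in>carrier A. pair_fun x y \<in> L0" using y by (intro bexI[of _ x]) (auto simp: L0_iff)
  next
    fix x assume x: "x \<in> carrier A"
    interpret K: Module.module R K by (rule DG)
    have "m (pair_fun x \<zero>\<^bsub>F\<^esub>) = iG (pA x)" using iA[OF x] hom_zero[OF DF(2) DG(2) \<gamma>(1)] by (simp add: m_def)
    moreover have "iG (pA x) = \<zero>\<^bsub>G\<^esub> \<longleftrightarrow> pA x = \<zero>\<^bsub>K\<^esub>"
      by (rule hom_inj_zero_iff[OF DG(1,2,4,6) hom_closed[OF DA(5) x]])
    ultimately show "pair_fun x \<zero>\<^bsub>F\<^esub> \<in> L0 \<longleftrightarrow> pA x = \<zero>\<^bsub>K\<^esub>"
      using x hom_zero[OF DF(2,3,5)] by (simp add: L0_iff)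
  qed
  then obtain \<pi> where \<pi>: "ses R K1 (\<lambda>k. pair_fun (iA k) \<zero>\<^bsub>F\<^esub>) ?LL \<pi> Z1" "\<And>u. u \<in> L0 \<Longrightarrow> iF (\<pi> u) = snd_fun u"
    by blast
  have pL0: "ext_perp R Y ?LL" by (rule ext_perp_extension[OF \<pi>(1) A(3) F(3) Y])
  have pL: "ext_perp R Y ?L" by (rule ext_perp_extension[OF sL0 pL0 ext_perp_projective[OF G(1) Y] Y])
  have e0: "hom_ext R ?LL (\<lambda>x. x) ?P Y"
    by (rule mod_prod_hom_ext[OF \<pi>(1) DA(2) DF(2) Y _ \<pi>(2) A(2) F(2)]) (use LP in \<open>auto simp: L0_def\<close>)
  have "hom_ext R ?L (\<lambda>x. x) ?P Y"
    unfolding hom_ext_def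
  proof
    fix f assume f: "f \<in> mod_hom R ?L Y"
    \<comment> \<open>Extend \<open>f\<close> from \<open>L0\<close> to the product first; the error
      on \<open>L\<close> factors through \<open>m\<close>, and \<open>m\<close> is defined on the
      whole product.\<close>
    have f0: "f \<in> mod_hom R ?LL Y" using f by (auto simp: mod_hom_def L0_def)
    obtain g where g: "g \<in> mod_hom R ?P Y" "\<And>u. u \<in> carrier ?LL \<Longrightarrow> g u = f u"
      by (rule hom_extE[OF e0 f0]) (rule that)
    have gL: "g \<in> mod_hom R ?L Y" by (rule hom_restrict_dom[OF g(1) LP])
    have "f u \<ominus>\<^bsub>Y\<^esub> g u = \<zero>\<^bsub>Y\<^esub>" if "u \<in> carrier ?L" "m u = \<zero>\<^bsub>G\<^esub>" for u
      using that hom_closed[OF f that(1)] g(2)[of u] by (simp add: L0_def)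
    then obtain h where h: "h \<in> mod_hom R G Y" "\<And>u. u \<in> L \<Longrightarrow> h (m u) = f u \<ominus>\<^bsub>Y\<^esub> g u"
      using surj_factor[OF sesD(2,3)[OF sL0] Y sesD(5,7)[OF sL0] hom_diff[OF mL Y f gL]] by auto
    show "\<exists>g\<in>mod_hom R ?P Y. \<forall>x\<in>carrier ?L. g x = f x"
    proof (intro bexI[of _ "\<lambda>u. g u \<oplus>\<^bsub>Y\<^esub> h (m u)"] ballI)
      fix u assume "u \<in> carrier ?L"
      then show "g u \<oplus>\<^bsub>Y\<^esub> h (m u) = f u" using hom_closed[OF f] hom_closed[OF gL] h(2) by simp
    qed (intro hom_plus[OF mP Y] g(1) mod_hom_compose[OF m h(1)])
  qed
  then show ?thesis by (rule ext_perpI[OF sL projective_mod_prod[OF A(1) F(1)] _ pL])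
qed

section \<open>Spans and Nakayama's lemma\<close>

text \<open>The base \<open>T\<close> lets Nakayama's lemma work modulo a submodule without
  quotients; with \<open>I\<close> the whole ring and \<open>T\<close> zero this is the ordinary
  span.\<close>

primrec span_over ::
  "('a, 'b, 'm) module_scheme \<Rightarrow> 'a set \<Rightarrow> 'b set \<Rightarrow> 'b list \<Rightarrow> 'b set" where
  "span_over A I T [] = T"
| "span_over A I T (e # es) = {a \<odot>\<^bsub>A\<^esub> e \<oplus>\<^bsub>A\<^esub> y | a y. a \<in> I \<and> y \<in> span_over A I T es}"

lemma span_over_ConsI:
  "a \<in> I \<Longrightarrow> y \<in> span_over A I T es \<Longrightarrow> a \<odot>\<^bsub>A\<^esub> e \<oplus>\<^bsub>A\<^esub> y \<in> span_over A I T (e # es)"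
  by auto

lemma span_over_carrier_update [simp]: "span_over (A\<lparr>carrier := H\<rparr>) I T es = span_over A I T es"
  by (induction es) auto

lemma idealD:
  fixes R (structure)
  assumes "cring R" "ideal I R"
  shows "I \<subseteq> carrier R" "\<zero> \<in> I" "a \<in> I \<Longrightarrow> b \<in> I \<Longrightarrow> a \<oplus> b \<in> I"
    "a \<in> I \<Longrightarrow> b \<in> I \<Longrightarrow> a \<ominus> b \<in> I"
    "r \<in> carrier R \<Longrightarrow> a \<in> I \<Longrightarrow> r \<otimes> a \<in> I" "r \<in> carrier R \<Longrightarrow> a \<in> I \<Longrightarrow> a \<otimes> r \<in> I"
proof -
  interpret ideal I R by fact
  show "I \<subseteq> carrier R" "\<zero> \<in> I" "a \<in> I \<Longrightarrow> b \<in> I \<Longrightarrow> a \<oplus> b \<in> I"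
    "a \<in> I \<Longrightarrow> b \<in> I \<Longrightarrow> a \<ominus> b \<in> I"
    "r \<in> carrier R \<Longrightarrow> a \<in> I \<Longrightarrow> r \<otimes> a \<in> I" "r \<in> carrier R \<Longrightarrow> a \<in> I \<Longrightarrow> a \<otimes> r \<in> I"
    using a_subset I_l_closed I_r_closed by (auto simp: a_minus_def)
qed

lemma cring_idealI:
  fixes R (structure)
  assumes "cring R" "I \<subseteq> carrier R" "\<zero> \<in> I"
    "\<And>a b. a \<in> I \<Longrightarrow> b \<in> I \<Longrightarrow> a \<oplus> b \<in> I" and m: "\<And>r a. r \<in> carrier R \<Longrightarrow> a \<in> I \<Longrightarrow> r \<otimes> a \<in> I"
  shows "ideal I R"
proof -
  interpret cring R by fact
  have neg: "\<ominus> a \<in> I" if "a \<in> I" for a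
    using m[OF _ that, of "\<ominus> \<one>"] that assms(2) by (auto simp: l_minus)
  have "subgroup I (add_monoid R)"
    by (rule add.subgroupI) (use assms neg in \<open>auto simp: a_inv_def\<close>)
  then show ?thesis
  proof (rule idealI[OF ring_axioms])
    fix a x assume "a \<in> I" "x \<in> carrier R"
    then show "x \<otimes> a \<in> I" "a \<otimes> x \<in> I" using m[of x a] assms(2) m_comm[of a x] by auto
  qed
qed

lemma submodule_span_over:
  fixes A (structure)
  assumes A: "module R A" and I: "ideal I R" and T: "submodule T R A" and es: "set es \<subseteq> carrier A"
  shows "submodule (span_over A I T es) R A"
  using es
proof (induction es)
  case (Cons e es)
  interpret A: Module.module R A by (rule A)
  have cR: "cring R" by (rule A.R.is_cring)
  note J = idealD[OF cR I]
  have e: "e \<in> carrier A" and S: "submodule (span_over A I T es) R A" using Cons by auto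
  note S = submoduleD[OF A S]
  let ?H = "span_over A I T (e # es)"
  show ?case
  proof (rule submoduleI'[OF A])
    show "?H \<subseteq> carrier A" using J(1) S(1) e by auto
    show "\<zero> \<in> ?H" using J(2) S(2) e by (auto intro!: exI[of _ "\<zero>\<^bsub>R\<^esub>"] exI[of _ "\<zero>"])
    fix x y assume "x \<in> ?H" "y \<in> ?H"
    then obtain a x' b y' where *: "x = a \<odot> e \<oplus> x'" "y = b \<odot> e \<oplus> y'"
      "a \<in> I" "b \<in> I" "x' \<in> span_over A I T es" "y' \<in> span_over A I T es" by auto
    then have c: "a \<in> carrier R" "b \<in> carrier R" "x' \<in> carrier A" "y' \<in> carrier A" using J(1) S(1) by auto
    have "x \<oplus> y = (a \<oplus>\<^bsub>R\<^esub> b) \<odot> e \<oplus> (x' \<oplus> y')"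
      using c e unfolding * by (simp add: A.smult_l_distr A.M.a_ac)
    then show "x \<oplus> y \<in> ?H" using span_over_ConsI[OF J(3)[OF *(3,4)] S(4)[OF *(5,6)]] by metis
  next
    fix r x assume r: "r \<in> carrier R" and "x \<in> ?H"
    then obtain a x' where *: "x = a \<odot> e \<oplus> x'" "a \<in> I" "x' \<in> span_over A I T es" by auto
    then have c: "a \<in> carrier R" "x' \<in> carrier A" using J(1) S(1) by auto
    have "r \<odot> x = (r \<otimes>\<^bsub>R\<^esub> a) \<odot> e \<oplus> r \<odot> x'"
      using c e r unfolding * by (simp add: A.smult_r_distr A.smult_assoc1)
    then show "r \<odot> x \<in> ?H" using span_over_ConsI[OF J(5)[OF r *(2)] S(6)[OF r *(3)]] by metis
  qed
qed (use T in simp)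

lemma span_over_subset:
  assumes A: "module R A" and H: "submodule H R A" "T \<subseteq> H"
    and "\<And>a e. a \<in> I \<Longrightarrow> e \<in> set es \<Longrightarrow> a \<odot>\<^bsub>A\<^esub> e \<in> H"
  shows "span_over A I T es \<subseteq> H"
  using assms(4)
proof (induction es)
  case (Cons e es)
  then show ?case using submoduleD(4)[OF A H(1)] by auto
qed (use H in simp)

lemma subset_span_over:
  fixes A (structure)
  assumes A: "module R A" and I: "ideal I R" and T: "submodule T R A" and es: "set es \<subseteq> carrier A"
  shows "T \<subseteq> span_over A I T es" "a \<in> I \<Longrightarrow> e \<in> set es \<Longrightarrow> a \<odot> e \<in> span_over A I T es"
proof -
  interpret A: Module.module R A by (rule A)
  note J = idealD[OF A.R.is_cring I]
  show 1: "T \<subseteq> span_over A I T es" using es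
  proof (induction es)
    case (Cons e es)
    show ?case
    proof
      fix t assume "t \<in> T"
      then have "t \<in> span_over A I T es" "t \<in> carrier A" using Cons submoduleD(1)[OF A T] by auto
      then show "t \<in> span_over A I T (e # es)" using Cons.prems J(2)
        by (auto intro!: exI[of _ "\<zero>\<^bsub>R\<^esub>"] exI[of _ t])
    qed
  qed simp
  show "a \<odot> e \<in> span_over A I T es" if "a \<in> I" "e \<in> set es" using es that
  proof (induction es)
    case (Cons f es)
    have S: "submodule (span_over A I T es) R A" by (rule submodule_span_over[OF A I T]) (use Cons in auto)
    note S = submoduleD[OF A S]
    have aR: "a \<in> carrier R" using Cons(3) J(1) by auto
    show ?case
    proof (cases "e = f")
      case True
      then show ?thesis using S(2) Cons(2,3) aR by (auto intro!: exI[of _ a] exI[of _ "\<zero>"])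
    next
      case False
      then have "a \<odot> e \<in> span_over A I T es" "e \<in> carrier A" using Cons by auto
      then show ?thesis using Cons.prems J(2) aR
        by (auto intro!: exI[of _ "\<zero>\<^bsub>R\<^esub>"] exI[of _ "a \<odot> e"])
    qed
  qed simp
qed

lemma submodule_scale_preimage:
  assumes A: "module R A" and c: "c \<in> carrier R" and H: "submodule H R A"
  shows "submodule {x \<in> carrier A. c \<odot>\<^bsub>A\<^esub> x \<in> H} R A"
  by (rule submodule_preimage[OF A A hom_scale[OF A A hom_id c] H])

text \<open>Proved without determinants. After enlarging \<open>T\<close> by the first generator,
  induction gives \<open>c\<close>, congruent to 1 modulo \<open>I\<close>, that moves the other
  generators into \<open>T + R e0\<close>; the relation for \<open>e0\<close> then yields
  \<open>d\<close> with \<open>d e0\<close> in \<open>T\<close>, and \<open>d c\<close> works for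
  all.\<close>

lemma nakayama:
  fixes E (structure)
  assumes E: "module R E" and I: "ideal I R" and "submodule T R E" and "set es \<subseteq> carrier E"
    and "\<And>e. e \<in> set es \<Longrightarrow> e \<in> span_over E I T es"
  shows "\<exists>c\<in>carrier R. \<one>\<^bsub>R\<^esub> \<ominus>\<^bsub>R\<^esub> c \<in> I \<and> (\<forall>e\<in>set es. c \<odot> e \<in> T)"
  using assms(3-5)
proof (induction es arbitrary: T)
  case Nil
  interpret E: Module.module R E by (rule E)
  show ?case using idealD(2)[OF E.R.is_cring I] by (intro bexI[of _ "\<one>\<^bsub>R\<^esub>"]) (auto simp: a_minus_def E.R.r_neg)
next
  case (Cons e0 es)
  interpret E: Module.module R E by (rule E)
  note J = idealD[OF E.R.is_cring I]
  have e0: "e0 \<in> carrier E" and es: "set es \<subseteq> carrier E" using Cons.prems by auto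
  note T = Cons.prems(1)
  note TD = submoduleD[OF E T]
  let ?T = "span_over E (carrier R) T [e0]"
  have T': "submodule ?T R E" by (rule submodule_span_over[OF E E.R.oneideal T]) (use e0 in simp)
  have T'D: "T \<subseteq> ?T" "\<And>a. a \<in> carrier R \<Longrightarrow> a \<odot> e0 \<in> ?T"
    using subset_span_over[OF E E.R.oneideal T, of "[e0]"] e0 by auto
  have S': "submodule (span_over E I ?T es) R E" by (rule submodule_span_over[OF E I T' es])
  have TS': "?T \<subseteq> span_over E I ?T es" by (rule subset_span_over[OF E I T' es])
  have sub: "span_over E I T es \<subseteq> span_over E I ?T es"
    by (rule span_over_subset[OF E S']) (use T'D(1) TS' subset_span_over(2)[OF E I T' es] in auto)
  have "e \<in> span_over E I ?T es" if e: "e \<in> set es" for e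
  proof -
    obtain a y where *: "e = a \<odot> e0 \<oplus> y" "a \<in> I" "y \<in> span_over E I T es"
      using Cons.prems(3)[of e] e by auto
    have "a \<odot> e0 \<in> span_over E I ?T es" using T'D(2) TS' *(2) J(1) by blast
    moreover have "y \<in> span_over E I ?T es" using sub *(3) by blast
    ultimately show ?thesis unfolding *(1) by (rule submoduleD(4)[OF E S'])
  qed
  then obtain c where c: "c \<in> carrier R" "\<one>\<^bsub>R\<^esub> \<ominus>\<^bsub>R\<^esub> c \<in> I" "\<And>e. e \<in> set es \<Longrightarrow> c \<odot> e \<in> ?T"
    using Cons.IH[OF T' es] by blast
  \<comment> \<open>Scaling by \<open>c\<close> turns \<open>I\<close>-multiples of the other
    generators into \<open>I\<close>-multiples of \<open>e0\<close> modulo \<open>T\<close>, so the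
    scaled relation for \<open>e0\<close> involves \<open>e0\<close> alone.\<close>
  let ?S = "span_over E I T [e0]"
  have S: "submodule ?S R E" by (rule submodule_span_over[OF E I T]) (use e0 in simp)
  have TS: "T \<subseteq> ?S" by (rule subset_span_over[OF E I T]) (use e0 in simp)
  have "span_over E I T es \<subseteq> {x \<in> carrier E. c \<odot> x \<in> ?S}"
  proof (rule span_over_subset[OF E submodule_scale_preimage[OF E c(1) S]])
    show "T \<subseteq> {x \<in> carrier E. c \<odot> x \<in> ?S}" using TD(1) TD(6)[OF c(1)] TS by blast
    fix a e assume a: "a \<in> I" and e: "e \<in> set es"
    then have ae: "a \<in> carrier R" "e \<in> carrier E" using J(1) es by auto
    obtain r t where rt: "c \<odot> e = r \<odot> e0 \<oplus> t" "r \<in> carrier R" "t \<in> T" using c(3)[OF e] by auto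
    have "c \<odot> (a \<odot> e) = a \<odot> (c \<odot> e)"
      using ae c(1) by (simp add: E.smult_assoc1[symmetric] E.R.m_comm)
    also have "\<dots> = (a \<otimes>\<^bsub>R\<^esub> r) \<odot> e0 \<oplus> a \<odot> t"
      using rt ae e0 TD(1) by (simp add: subset_iff E.smult_r_distr E.smult_assoc1)
    also have "\<dots> \<in> ?S" using J(6)[OF rt(2) a] TD(6)[OF ae(1) rt(3)] by auto
    finally show "a \<odot> e \<in> {x \<in> carrier E. c \<odot> x \<in> ?S}" using ae by simp
  qed
  moreover obtain a y where ay: "e0 = a \<odot> e0 \<oplus> y" "a \<in> I" "y \<in> span_over E I T es"
    using Cons.prems(3)[of e0] by auto
  ultimately obtain b t where bt: "c \<odot> y = b \<odot> e0 \<oplus> t" "b \<in> I" "t \<in> T" and y: "y \<in> carrier E"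
    by auto
  have R: "a \<in> carrier R" "b \<in> carrier R" "t \<in> carrier E" using ay(2) bt J(1) TD(1) by auto
  \<comment> \<open>From \<open>c e0 = (c a + b) e0 + t\<close>. Both \<open>a\<close> and
    \<open>b\<close> lie in \<open>I\<close>, so \<open>d\<close> is congruent to \<open>c\<close>,
    hence to 1.\<close>
  define d where "d = c \<ominus>\<^bsub>R\<^esub> (c \<otimes>\<^bsub>R\<^esub> a \<oplus>\<^bsub>R\<^esub> b)"
  have d: "d \<in> carrier R" using c(1) R by (simp add: d_def)
  have "c \<odot> e0 = c \<odot> (a \<odot> e0 \<oplus> y)" using ay(1) by simp
  also have "\<dots> = (c \<otimes>\<^bsub>R\<^esub> a \<oplus>\<^bsub>R\<^esub> b) \<odot> e0 \<oplus> t"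
    using c(1) R e0 y bt(1) by (simp add: E.smult_r_distr E.smult_assoc1 E.smult_l_distr E.M.a_assoc)
  finally have ce0: "c \<odot> e0 = (c \<otimes>\<^bsub>R\<^esub> a \<oplus>\<^bsub>R\<^esub> b) \<odot> e0 \<oplus> t" .
  have "d \<odot> e0 = c \<odot> e0 \<ominus> (c \<otimes>\<^bsub>R\<^esub> a \<oplus>\<^bsub>R\<^esub> b) \<odot> e0"
    using c(1) R e0 by (simp add: d_def a_minus_def E.smult_l_distr E.smult_l_minus del: E.R.minus_add)
  also have "\<dots> = t" using c(1) R e0 by (simp add: ce0)
  finally have de0: "d \<odot> e0 \<in> T" using bt(3) by simp
  have "\<one>\<^bsub>R\<^esub> \<ominus>\<^bsub>R\<^esub> d = (\<one>\<^bsub>R\<^esub> \<ominus>\<^bsub>R\<^esub> c) \<oplus>\<^bsub>R\<^esub> (c \<otimes>\<^bsub>R\<^esub> a \<oplus>\<^bsub>R\<^esub> b)"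
    using c(1) R unfolding d_def by algebra
  then have d1: "\<one>\<^bsub>R\<^esub> \<ominus>\<^bsub>R\<^esub> d \<in> I" using c R ay(2) bt(2) by (simp add: J)
  have "\<one>\<^bsub>R\<^esub> \<ominus>\<^bsub>R\<^esub> d \<otimes>\<^bsub>R\<^esub> c = (\<one>\<^bsub>R\<^esub> \<ominus>\<^bsub>R\<^esub> d) \<oplus>\<^bsub>R\<^esub> d \<otimes>\<^bsub>R\<^esub> (\<one>\<^bsub>R\<^esub> \<ominus>\<^bsub>R\<^esub> c)"
    using c(1) d by algebra
  then have dc: "\<one>\<^bsub>R\<^esub> \<ominus>\<^bsub>R\<^esub> d \<otimes>\<^bsub>R\<^esub> c \<in> I" using d1 c(2) d by (simp add: J)
  show ?case
  proof (intro bexI[of _ "d \<otimes>\<^bsub>R\<^esub> c"] conjI ballI dc)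
    fix e assume "e \<in> set (e0 # es)"
    then consider "e = e0" | "e \<in> set es" by auto
    then show "(d \<otimes>\<^bsub>R\<^esub> c) \<odot> e \<in> T"
    proof cases
      case 1
      then have "(d \<otimes>\<^bsub>R\<^esub> c) \<odot> e = c \<odot> (d \<odot> e0)"
        using c(1) d e0 by (simp add: E.smult_assoc1[symmetric] E.R.m_comm)
      then show ?thesis using TD(6)[OF c(1) de0] by simp
    next
      case 2
      then obtain r t' where rt: "c \<odot> e = r \<odot> e0 \<oplus> t'" "r \<in> carrier R" "t' \<in> T" using c(3)[OF 2] by auto
      have t': "t' \<in> carrier E" using rt(3) TD(1) by auto
      have "(d \<otimes>\<^bsub>R\<^esub> c) \<odot> e = d \<odot> (r \<odot> e0 \<oplus> t')"
        using rt(1)[symmetric] 2 es c(1) d by (simp add: E.smult_assoc1 subset_iff)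
      also have "\<dots> = r \<odot> (d \<odot> e0) \<oplus> d \<odot> t'"
        using t' rt(2) d e0 by (simp add: E.smult_r_distr E.smult_assoc1[symmetric] E.R.m_comm)
      also have "\<dots> \<in> T" using TD(6)[OF rt(2) de0] TD(6)[OF d rt(3)] by (rule TD(4))
      finally show ?thesis .
    qed
  qed (use d c(1) in simp)
qed

section \<open>Finite generation over Noetherian rings\<close>

definition fin_gen :: "('a, 'r) ring_scheme \<Rightarrow> ('a, 'b, 'm) module_scheme \<Rightarrow> bool" where
  "fin_gen R A \<longleftrightarrow> (\<exists>es. set es \<subseteq> carrier A \<and> carrier A = span_over A (carrier R) {\<zero>\<^bsub>A\<^esub>} es)"

lemma submodule_zero:
  assumes A: "module R A" shows "submodule {\<zero>\<^bsub>A\<^esub>} R A"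
proof -
  interpret A: Module.module R A by (rule A)
  show ?thesis by (rule submoduleI'[OF A]) auto
qed

lemma submodule_span:
  assumes A: "module R A" and es: "set es \<subseteq> carrier A"
  shows "submodule (span_over A (carrier R) {\<zero>\<^bsub>A\<^esub>} es) R A"
proof -
  interpret A: Module.module R A by (rule A)
  show ?thesis by (rule submodule_span_over[OF A A.R.oneideal submodule_zero[OF A] es])
qed

lemma elements_in_span:
  fixes A (structure)
  assumes A: "module R A" and es: "set es \<subseteq> carrier A"
  shows "set es \<subseteq> span_over A (carrier R) {\<zero>} es"
proof
  interpret A: Module.module R A by (rule A)
  fix e assume e: "e \<in> set es"
  then show "e \<in> span_over A (carrier R) {\<zero>} es"
    using subset_span_over(2)[OF A A.R.oneideal submodule_zero[OF A] es A.R.one_closed e] es by auto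
qed

lemma fin_gen_if_finitely_generated:
  fixes A (structure)
  assumes A: "module R A" and "finitely_generated_module R A"
  shows "fin_gen R A"
proof -
  obtain S where S: "S \<subseteq> carrier A" "finite S" "carrier A = \<Inter>{H. submodule H R A \<and> S \<subseteq> H}"
    using assms(2) unfolding finitely_generated_module_def by auto
  obtain es where es: "set es = S" using finite_list[OF S(2)] by blast
  have sub: "submodule (span_over A (carrier R) {\<zero>} es) R A"
    by (rule submodule_span[OF A]) (use es S in auto)
  have "S \<subseteq> span_over A (carrier R) {\<zero>} es"
    using elements_in_span[OF A, of es] es S(1) by auto
  then have "carrier A \<subseteq> span_over A (carrier R) {\<zero>} es" using S(3) sub by blast
  then show ?thesis unfolding fin_gen_def using submoduleD(1)[OF A sub] es S(1) by blast
qed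

text \<open>As in Hilbert's basis theorem: the coefficients of \<open>N\<close> along
  \<open>e\<close> form a finitely generated ideal; lifts of its generators to \<open>N\<close>,
  together with generators of the part of \<open>N\<close> in the span of \<open>es\<close>,
  generate \<open>N\<close>.\<close>

lemma noetherian_submodule_generators:
  fixes A (structure)
  assumes R: "cring R" "noetherian_ring R" and A: "module R A"
    and "set es \<subseteq> carrier A" "submodule N R A" "N \<subseteq> span_over A (carrier R) {\<zero>} es"
  shows "\<exists>vs. set vs \<subseteq> N \<and> N = span_over A (carrier R) {\<zero>} vs"
  using assms(4-6)
proof (induction es arbitrary: N)
  case Nil
  then show ?case using submoduleD(2)[OF A Nil(2)] by (intro exI[of _ "[]"]) auto
next
  case (Cons e es)
  interpret A: Module.module R A by (rule A)
  let ?sp = "span_over A (carrier R) {\<zero>}"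
  have e: "e \<in> carrier A" and es: "set es \<subseteq> carrier A" using Cons.prems by auto
  note N = submoduleD[OF A Cons.prems(2)]
  have S: "submodule (?sp es) R A" by (rule submodule_span[OF A es])
  note SD = submoduleD[OF A S]
  \<comment> \<open>Stated for every submodule, since it is applied to \<open>N\<close> to obtain
    \<open>B\<close> and to the candidate \<open>?W\<close>, whose coefficient ideal contains
    \<open>B\<close> and therefore that of \<open>N\<close>.\<close>
  have idl: "ideal {a \<in> carrier R. \<exists>y\<in>?sp es. a \<odot> e \<oplus> y \<in> V} R" if V: "submodule V R A" for V
  proof (rule cring_idealI[OF R(1)])
    note VD = submoduleD[OF A V]
    show "\<zero>\<^bsub>R\<^esub> \<in> {a \<in> carrier R. \<exists>y\<in>?sp es. a \<odot> e \<oplus> y \<in> V}"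
      using VD(2) SD(2) e by (auto intro!: bexI[of _ "\<zero>"])
    fix a b assume "a \<in> {a \<in> carrier R. \<exists>y\<in>?sp es. a \<odot> e \<oplus> y \<in> V}"
      "b \<in> {a \<in> carrier R. \<exists>y\<in>?sp es. a \<odot> e \<oplus> y \<in> V}"
    then obtain y z where *: "a \<in> carrier R" "b \<in> carrier R" "y \<in> ?sp es" "z \<in> ?sp es"
      "a \<odot> e \<oplus> y \<in> V" "b \<odot> e \<oplus> z \<in> V" by auto
    then have yz: "y \<in> carrier A" "z \<in> carrier A" using SD(1) by auto
    have "(a \<oplus>\<^bsub>R\<^esub> b) \<odot> e \<oplus> (y \<oplus> z) = (a \<odot> e \<oplus> y) \<oplus> (b \<odot> e \<oplus> z)"
      using * yz e by (simp add: A.smult_l_distr A.M.a_ac)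
    also have "\<dots> \<in> V" using *(5,6) by (rule VD(4))
    finally show "a \<oplus>\<^bsub>R\<^esub> b \<in> {a \<in> carrier R. \<exists>y\<in>?sp es. a \<odot> e \<oplus> y \<in> V}"
      using * SD(4)[OF *(3,4)] by auto
  next
    note VD = submoduleD[OF A V]
    fix r a assume r: "r \<in> carrier R" and "a \<in> {a \<in> carrier R. \<exists>y\<in>?sp es. a \<odot> e \<oplus> y \<in> V}"
    then obtain y where *: "a \<in> carrier R" "y \<in> ?sp es" "a \<odot> e \<oplus> y \<in> V" by auto
    then have y: "y \<in> carrier A" using SD(1) by auto
    have "(r \<otimes>\<^bsub>R\<^esub> a) \<odot> e \<oplus> r \<odot> y = r \<odot> (a \<odot> e \<oplus> y)"
      using * y e r by (simp add: A.smult_r_distr A.smult_assoc1)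
    also have "\<dots> \<in> V" using r *(3) by (rule VD(6))
    finally show "r \<otimes>\<^bsub>R\<^esub> a \<in> {a \<in> carrier R. \<exists>y\<in>?sp es. a \<odot> e \<oplus> y \<in> V}"
      using * r SD(6)[OF r *(2)] by auto
  qed auto
  obtain B where B: "B \<subseteq> carrier R" "finite B"
      "{a \<in> carrier R. \<exists>y\<in>?sp es. a \<odot> e \<oplus> y \<in> N} = Idl\<^bsub>R\<^esub> B"
    using noetherian_ring.finetely_gen[OF R(2) idl[OF Cons.prems(2)]] by blast
  obtain bs where bs: "set bs = B" using finite_list[OF B(2)] by blast
  have "\<forall>b\<in>B. \<exists>y\<in>?sp es. b \<odot> e \<oplus> y \<in> N"
    using A.R.genideal_self[OF B(1)] B(3) by blast
  then obtain y where y: "\<And>b. b \<in> B \<Longrightarrow> y b \<in> ?sp es" "\<And>b. b \<in> B \<Longrightarrow> b \<odot> e \<oplus> y b \<in> N" by metis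
  define ws where "ws = map (\<lambda>b. b \<odot> e \<oplus> y b) bs"
  have ws: "set ws \<subseteq> N" using y bs by (auto simp: ws_def)
  have "submodule (N \<inter> ?sp es) R A"
    by (rule submoduleI'[OF A]) (use N SD in auto)
  then obtain us where us: "set us \<subseteq> N \<inter> ?sp es" "N \<inter> ?sp es = ?sp us"
    using Cons.IH[OF es] by blast
  let ?W = "?sp (ws @ us)"
  have wsA: "set (ws @ us) \<subseteq> carrier A" using ws us(1) N(1) by auto
  have W: "submodule ?W R A" by (rule submodule_span[OF A wsA])
  note WD = submoduleD[OF A W]
  have elW: "set (ws @ us) \<subseteq> ?W" by (rule elements_in_span[OF A wsA])
  have "?W \<subseteq> N"
    by (rule span_over_subset[OF A Cons.prems(2)]) (use N(2) N(6) ws us(1) in auto)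
  moreover have "N \<subseteq> ?W"
  proof
    fix x assume x: "x \<in> N"
    then obtain a z where az: "x = a \<odot> e \<oplus> z" "a \<in> carrier R" "z \<in> ?sp es" using Cons.prems(3) by auto
    have "B \<subseteq> {a \<in> carrier R. \<exists>y\<in>?sp es. a \<odot> e \<oplus> y \<in> ?W}"
    proof
      fix b assume b: "b \<in> B"
      then have "b \<odot> e \<oplus> y b \<in> ?W" using elW bs by (auto simp: ws_def)
      then show "b \<in> {a \<in> carrier R. \<exists>y\<in>?sp es. a \<odot> e \<oplus> y \<in> ?W}" using b y(1) B(1) by blast
    qed
    then have "Idl\<^bsub>R\<^esub> B \<subseteq> {a \<in> carrier R. \<exists>y\<in>?sp es. a \<odot> e \<oplus> y \<in> ?W}"
      by (rule A.R.genideal_minimal[OF idl[OF W]])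
    moreover have "a \<in> Idl\<^bsub>R\<^esub> B" unfolding B(3)[symmetric] using az x by auto
    ultimately obtain z' where z': "z' \<in> ?sp es" "a \<odot> e \<oplus> z' \<in> ?W" by blast
    let ?w = "a \<odot> e \<oplus> z'"
    have zA: "z \<in> carrier A" "z' \<in> carrier A" "a \<odot> e \<in> carrier A" using az z' SD(1) e by auto
    have "x \<ominus> ?w = z \<ominus> z'"
      unfolding az(1) using zA by (simp add: a_minus_def A.M.minus_add A.M.a_ac A.M.r_neg1 A.M.r_neg A.M.r_neg2)
    moreover have "z \<ominus> z' \<in> ?sp es" by (rule SD(5)[OF az(3) z'(1)])
    moreover have wN: "?w \<in> N" using z'(2) \<open>?W \<subseteq> N\<close> by blast
    moreover have "x \<ominus> ?w \<in> N" by (rule N(5)[OF x wN])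
    ultimately have "x \<ominus> ?w \<in> ?sp us" using us(2) by auto
    moreover have "?sp us \<subseteq> ?W"
      by (rule span_over_subset[OF A W]) (use elW WD(2,6) in auto)
    ultimately have "(x \<ominus> ?w) \<oplus> ?w \<in> ?W" using WD(4) z'(2) by blast
    then show "x \<in> ?W" using zA x N(1) by (simp add: subset_iff)
  qed
  ultimately show ?case using ws us(1) by (intro exI[of _ "ws @ us"]) auto
qed

section \<open>Free modules and splitting\<close>

definition reg_mod :: "('a, 'r) ring_scheme \<Rightarrow> ('a, 'a) module" where
  "reg_mod R =
     \<lparr>carrier = carrier R, monoid.mult = undefined, monoid.one = undefined,
      ring.zero = \<zero>\<^bsub>R\<^esub>, ring.add = (\<lambda>x y. x \<oplus>\<^bsub>R\<^esub> y), module.smult = (\<lambda>r x. r \<otimes>\<^bsub>R\<^esub> x)\<rparr>"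

lemma reg_mod_sel [simp]:
  "carrier (reg_mod R) = carrier R" "\<zero>\<^bsub>reg_mod R\<^esub> = \<zero>\<^bsub>R\<^esub>"
  "x \<oplus>\<^bsub>reg_mod R\<^esub> y = x \<oplus>\<^bsub>R\<^esub> y" "r \<odot>\<^bsub>reg_mod R\<^esub> x = r \<otimes>\<^bsub>R\<^esub> x"
  by (simp_all add: reg_mod_def)

lemma module_reg_mod:
  assumes "cring R" shows "module R (reg_mod R)"
proof -
  interpret cring R by fact
  show ?thesis
  proof (rule moduleI)
    show "abelian_group (reg_mod R)"
    proof (rule abelian_groupI, goal_cases)
      case (6 x)
      then show ?case by (intro bexI[of _ "\<ominus>\<^bsub>R\<^esub> x"]) (auto simp: l_neg)
    qed (auto simp: a_ac)
  qed (auto simp: assms l_distr r_distr m_assoc)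
qed

lemma reg_mod_minus:
  assumes R: "cring R" and x: "x \<in> carrier R" and y: "y \<in> carrier R"
  shows "x \<ominus>\<^bsub>reg_mod R\<^esub> y = x \<ominus>\<^bsub>R\<^esub> y"
proof -
  interpret cring R by (rule R)
  interpret E: Module.module R "reg_mod R" by (rule module_reg_mod[OF R])
  have "(x \<ominus>\<^bsub>reg_mod R\<^esub> y) \<oplus>\<^bsub>R\<^esub> y = x" and c: "x \<ominus>\<^bsub>reg_mod R\<^esub> y \<in> carrier R"
    using E.M.add_minus_cancel(2)[of x y] E.M.minus_closed[of x y] x y by auto
  then show ?thesis using add_minus_cancel(3)[OF c y] by simp
qed

text \<open>Lists instead of functions on an index set: a single injection of \<open>'a list\<close>
  then copies free modules of every rank to a common type.\<close>

definition free_mod :: "('a, 'r) ring_scheme \<Rightarrow> nat \<Rightarrow> ('a, 'a list) module" where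
  "free_mod R n =
     \<lparr>carrier = {xs. length xs = n \<and> set xs \<subseteq> carrier R}, monoid.mult = undefined, monoid.one = undefined,
      ring.zero = replicate n \<zero>\<^bsub>R\<^esub>, ring.add = map2 (\<lambda>x y. x \<oplus>\<^bsub>R\<^esub> y),
      module.smult = (\<lambda>r. map (\<lambda>x. r \<otimes>\<^bsub>R\<^esub> x))\<rparr>"

lemma free_mod_sel [simp]:
  "xs \<in> carrier (free_mod R n) \<longleftrightarrow> length xs = n \<and> set xs \<subseteq> carrier R"
  "\<zero>\<^bsub>free_mod R n\<^esub> = replicate n \<zero>\<^bsub>R\<^esub>"
  "xs \<oplus>\<^bsub>free_mod R n\<^esub> ys = map2 (\<lambda>x y. x \<oplus>\<^bsub>R\<^esub> y) xs ys"
  "r \<odot>\<^bsub>free_mod R n\<^esub> xs = map (\<lambda>x. r \<otimes>\<^bsub>R\<^esub> x) xs"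
  by (simp_all add: free_mod_def)

lemma module_free_mod:
  assumes "cring R" shows "module R (free_mod R n)"
proof -
  interpret cring R by fact
  have nth: "xs ! k \<in> carrier R" if "set xs \<subseteq> carrier R" "k < length xs" for xs k
    using that nth_mem by blast
  show ?thesis
  proof (rule module_if_coordinates[where J = "{..<n}" and \<pi> = "\<lambda>k xs. xs ! k" and B = "\<lambda>k. reg_mod R", OF assms module_reg_mod[OF assms]])
    show "(\<lambda>xs. xs ! k) \<in> mod_hom R (free_mod R n) (reg_mod R)" if "k \<in> {..<n}" for k
      using that by (auto simp: mod_hom_def nth)
  qed (auto simp: subset_iff nth_equalityI dest: set_zip_leftD set_zip_rightD)
qed

abbreviation lincomb_zip :: "('a, 'b, 'm) module_scheme \<Rightarrow> 'a list \<Rightarrow> 'b list \<Rightarrow> 'b" where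
  "lincomb_zip A xs es \<equiv> lincomb A (\<lambda>e. e) (zip xs es)"

lemma lincomb_zip_closed:
  assumes A: "module R A" and "set xs \<subseteq> carrier R" "set es \<subseteq> carrier A"
  shows "lincomb_zip A xs es \<in> carrier A"
proof -
  interpret A: Module.module R A by (rule A)
  show ?thesis using assms(2,3)
  proof (induction xs arbitrary: es)
    case (Cons x xs) then show ?case by (cases es) auto
  qed simp
qed

lemma hom_lincomb_zip:
  assumes A: "module R A" and es: "set es \<subseteq> carrier A"
  shows "(\<lambda>xs. lincomb_zip A xs es) \<in> mod_hom R (free_mod R (length es)) A"
proof -
  interpret A: Module.module R A by (rule A)
  have "lincomb_zip A (map2 (\<lambda>x y. x \<oplus>\<^bsub>R\<^esub> y) xs ys) es = lincomb_zip A xs es \<oplus>\<^bsub>A\<^esub> lincomb_zip A ys es"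
    if "length xs = length es" "length ys = length es" "set xs \<subseteq> carrier R" "set ys \<subseteq> carrier R" for xs ys
    using that es
  proof (induction es arbitrary: xs ys)
    case (Cons e es)
    then obtain x xs' y ys' where *: "xs = x # xs'" "ys = y # ys'" by (metis length_Suc_conv)
    show ?case using Cons.prems Cons.IH[of xs' ys'] lincomb_zip_closed[OF A, of xs' es] lincomb_zip_closed[OF A, of ys' es]
      unfolding * by (simp add: A.smult_l_distr A.M.a_ac)
  qed simp
  moreover have "lincomb_zip A (map (\<lambda>x. r \<otimes>\<^bsub>R\<^esub> x) xs) es = r \<odot>\<^bsub>A\<^esub> lincomb_zip A xs es"
    if "length xs = length es" "set xs \<subseteq> carrier R" "r \<in> carrier R" for xs r
    using that es
  proof (induction es arbitrary: xs)
    case (Cons e es)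
    then obtain x xs' where *: "xs = x # xs'" by (metis length_Suc_conv)
    show ?case using Cons.prems Cons.IH[of xs'] lincomb_zip_closed[OF A, of xs' es]
      unfolding * by (simp add: A.smult_r_distr A.smult_assoc1)
  qed simp
  ultimately show ?thesis using lincomb_zip_closed[OF A] es by (auto simp: mod_hom_def)
qed

lemma lincomb_zip_image:
  "(\<lambda>xs. lincomb_zip A xs es) ` carrier (free_mod R (length es)) = span_over A (carrier R) {\<zero>\<^bsub>A\<^esub>} es"
proof (induction es)
  case (Cons e es)
  show ?case
  proof (intro equalityI subsetI)
    fix y assume "y \<in> (\<lambda>xs. lincomb_zip A xs (e # es)) ` carrier (free_mod R (length (e # es)))"
    then obtain xs where xs: "length xs = Suc (length es)" "set xs \<subseteq> carrier R" "y = lincomb_zip A xs (e # es)" by auto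
    then obtain x xs' where *: "xs = x # xs'" by (metis length_Suc_conv)
    have "lincomb_zip A xs' es \<in> span_over A (carrier R) {\<zero>\<^bsub>A\<^esub>} es"
      unfolding Cons.IH[symmetric] using xs * by (intro imageI) simp
    then show "y \<in> span_over A (carrier R) {\<zero>\<^bsub>A\<^esub>} (e # es)" using xs * by auto
  next
    fix y assume "y \<in> span_over A (carrier R) {\<zero>\<^bsub>A\<^esub>} (e # es)"
    then obtain a z where *: "y = a \<odot>\<^bsub>A\<^esub> e \<oplus>\<^bsub>A\<^esub> z" "a \<in> carrier R" "z \<in> span_over A (carrier R) {\<zero>\<^bsub>A\<^esub>} es" by auto
    from *(3) obtain xs where xs: "length xs = length es" "set xs \<subseteq> carrier R" "z = lincomb_zip A xs es"
      unfolding Cons.IH[symmetric] by auto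
    show "y \<in> (\<lambda>xs. lincomb_zip A xs (e # es)) ` carrier (free_mod R (length (e # es)))"
      using * xs by (intro image_eqI[of _ _ "a # xs"]) auto
  qed
qed (auto intro: image_eqI[of _ _ "[]"])

lemma hom_of_lincomb_zip:
  assumes "module R A" "module R B" and f: "f \<in> mod_hom R A B" and "set xs \<subseteq> carrier R" "set es \<subseteq> carrier A"
  shows "f (lincomb_zip A xs es) = lincomb_zip B xs (map f es)"
  using assms(4,5)
proof (induction xs arbitrary: es)
  case (Cons x xs)
  interpret A: Module.module R A by fact
  show ?case using Cons lincomb_zip_closed[OF assms(1)]
    by (cases es) (auto simp: hom_zero[OF assms(1,2) f] hom_add[OF f] hom_smult[OF f])
qed (simp add: hom_zero[OF assms(1,2) f])

lemma free_mod_hom_eq: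
  assumes B: "module R B" and "f \<in> mod_hom R (free_mod R n) B"
  shows "\<exists>es. length es = n \<and> set es \<subseteq> carrier B \<and> (\<forall>xs\<in>carrier (free_mod R n). f xs = lincomb_zip B xs es)"
  using assms(2)
proof (induction n arbitrary: f)
  case 0
  interpret B: Module.module R B by (rule B)
  have "f (\<zero>\<^bsub>free_mod R 0\<^esub>) = \<zero>\<^bsub>B\<^esub>" by (rule hom_zero[OF module_free_mod[OF B.R.is_cring] B 0])
  then show ?case by (intro exI[of _ "[]"]) auto
next
  case (Suc n)
  interpret B: Module.module R B by (rule B)
  have mF: "module R (free_mod R k)" for k by (rule module_free_mod[OF B.R.is_cring])
  have z: "map2 (\<lambda>x y. x \<oplus>\<^bsub>R\<^esub> y) (replicate n \<zero>\<^bsub>R\<^esub>) xs = xs" if "length xs = n" "set xs \<subseteq> carrier R" for xs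
  proof -
    interpret F: Module.module R "free_mod R n" by (rule mF)
    show ?thesis using F.M.l_zero[of xs] that by simp
  qed
  have inc: "(\<lambda>xs. \<zero>\<^bsub>R\<^esub> # xs) \<in> mod_hom R (free_mod R n) (free_mod R (Suc n))" by (auto simp: mod_hom_def)
  obtain es where es: "length es = n" "set es \<subseteq> carrier B"
    "\<And>xs. length xs = n \<Longrightarrow> set xs \<subseteq> carrier R \<Longrightarrow> f (\<zero>\<^bsub>R\<^esub> # xs) = lincomb_zip B xs es"
    using Suc.IH[OF mod_hom_compose[OF inc Suc.prems]] by auto
  let ?u = "\<one>\<^bsub>R\<^esub> # replicate n \<zero>\<^bsub>R\<^esub>"
  have u: "?u \<in> carrier (free_mod R (Suc n))" by auto
  show ?case
  proof (intro exI[of _ "f ?u # es"] conjI ballI)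
    show "length (f ?u # es) = Suc n" using es by simp
    show "set (f ?u # es) \<subseteq> carrier B" using es hom_closed[OF Suc.prems u] by simp
    fix ys assume "ys \<in> carrier (free_mod R (Suc n))"
    then obtain x xs where ys: "ys = x # xs" "x \<in> carrier R" "length xs = n" "set xs \<subseteq> carrier R"
      by (auto simp: length_Suc_conv)
    have "ys = (x \<odot>\<^bsub>free_mod R (Suc n)\<^esub> ?u) \<oplus>\<^bsub>free_mod R (Suc n)\<^esub> (\<zero>\<^bsub>R\<^esub> # xs)"
      using ys z by (simp add: map_replicate_const)
    then have "f ys = f ((x \<odot>\<^bsub>free_mod R (Suc n)\<^esub> ?u) \<oplus>\<^bsub>free_mod R (Suc n)\<^esub> (\<zero>\<^bsub>R\<^esub> # xs))" by (rule arg_cong)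
    also have "\<dots> = f (x \<odot>\<^bsub>free_mod R (Suc n)\<^esub> ?u) \<oplus>\<^bsub>B\<^esub> f (\<zero>\<^bsub>R\<^esub> # xs)"
      by (rule hom_add[OF Suc.prems]) (use ys in \<open>auto simp: map_replicate_const\<close>)
    also have "f (x \<odot>\<^bsub>free_mod R (Suc n)\<^esub> ?u) = x \<odot>\<^bsub>B\<^esub> f ?u"
      by (rule hom_smult[OF Suc.prems ys(2) u])
    finally show "f ys = lincomb_zip B ys (f ?u # es)" using ys es(3) by simp
  qed
qed

lemma projective_free_mod:
  fixes R :: "('a, 'r) ring_scheme"
  assumes R: "cring R" shows "projective_module R (free_mod R n)"
  unfolding projective_module_def
proof (intro conjI allI impI module_free_mod[OF R])
  fix A :: "('a, ('a, 'a list) universe) module" and B :: "('a, ('a, 'a list) universe) module" and g f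
  assume *: "module R A" "module R B" "g \<in> mod_hom R A B" "g ` carrier A = carrier B" "f \<in> mod_hom R (free_mod R n) B"
  obtain bs where bs: "length bs = n" "set bs \<subseteq> carrier B"
    "\<And>xs. xs \<in> carrier (free_mod R n) \<Longrightarrow> f xs = lincomb_zip B xs bs"
    using free_mod_hom_eq[OF *(2,5)] by blast
  define as where "as = map (inv_into (carrier A) g) bs"
  have as: "set as \<subseteq> carrier A" "map g as = bs" "length as = n"
    using bs *(4) by (auto simp: as_def subset_iff inv_into_into f_inv_into_f map_idI)
  show "\<exists>h\<in>mod_hom R (free_mod R n) A. \<forall>x\<in>carrier (free_mod R n). g (h x) = f x"
    using hom_lincomb_zip[OF *(1) as(1)] as bs(3) hom_of_lincomb_zip[OF *(1-3) _ as(1)]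
    by (intro bexI[of _ "\<lambda>xs. lincomb_zip A xs as"]) auto
qed

lemma fin_gen_cover:
  assumes A: "module R A" and "fin_gen R A"
  shows "\<exists>es. set es \<subseteq> carrier A \<and> (\<lambda>xs. lincomb_zip A xs es) ` carrier (free_mod R (length es)) = carrier A"
  using assms unfolding fin_gen_def lincomb_zip_image by metis

section \<open>Functionals on a projective module and the splitting criterion\<close>

lemma mod_Hom_sel [simp]:
  "f \<in> carrier (mod_Hom R A B) \<longleftrightarrow> f \<in> mod_hom R A B \<and> f \<in> extensional (carrier A)"
  "\<zero>\<^bsub>mod_Hom R A B\<^esub> = (\<lambda>x\<in>carrier A. \<zero>\<^bsub>B\<^esub>)"
  "f \<oplus>\<^bsub>mod_Hom R A B\<^esub> g = (\<lambda>x\<in>carrier A. f x \<oplus>\<^bsub>B\<^esub> g x)"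
  "r \<odot>\<^bsub>mod_Hom R A B\<^esub> f = (\<lambda>x\<in>carrier A. r \<odot>\<^bsub>B\<^esub> f x)"
  by (simp_all add: mod_Hom_def)

lemma hom_restrict_iff:
  assumes "module R A" shows "(\<lambda>x\<in>carrier A. f x) \<in> mod_hom R A B \<longleftrightarrow> f \<in> mod_hom R A B"
proof
  assume "(\<lambda>x\<in>carrier A. f x) \<in> mod_hom R A B"
  then show "f \<in> mod_hom R A B" by (rule hom_cong[OF assms]) auto
next
  assume "f \<in> mod_hom R A B"
  then show "(\<lambda>x\<in>carrier A. f x) \<in> mod_hom R A B" by (rule hom_cong[OF assms]) auto
qed

lemma module_mod_Hom:
  assumes A: "module R A" and B: "module R B" shows "module R (mod_Hom R A B)"
proof -
  interpret A: Module.module R A by (rule A)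
  show ?thesis
  proof (rule module_if_coordinates[where J = "carrier A" and \<pi> = "\<lambda>x f. f x" and B = "\<lambda>x. B", OF A.R.is_cring B])
    show "(\<lambda>f. f x) \<in> mod_hom R (mod_Hom R A B) B" if "x \<in> carrier A" for x
      using that hom_closed[where R = R and A = A and B = B] by (auto simp: mod_hom_def[of R "mod_Hom R A B"])
    show "f = g" if "f \<in> carrier (mod_Hom R A B)" "g \<in> carrier (mod_Hom R A B)" "\<And>x. x \<in> carrier A \<Longrightarrow> f x = g x" for f g
      using that by (intro extensionalityI[of _ "carrier A"]) auto
  qed (auto simp: hom_restrict_iff[OF A] hom_plus[OF A B] hom_scale[OF A B] hom_const_zero[OF B])
qed

text \<open>\<open>K\<close> is a direct summand of a free module with basis dual to \<open>bs\<close>, so every functional on \<open>K\<close> is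
  a combination of the \<open>bs\<close> with coefficients among its values.\<close>

lemma projective_dual_basis:
  fixes K :: "('a, 'k, 'm) module_scheme"
  assumes K: "module R K" "projective_module R K" "fin_gen R K"
  shows "\<exists>ks bs. set ks \<subseteq> carrier K \<and> length bs = length ks \<and> set bs \<subseteq> carrier (mod_Hom R K (reg_mod R)) \<and>
    (\<forall>x\<in>carrier K. lincomb_zip K (map (\<lambda>b. b x) bs) ks = x) \<and>
    (\<forall>I T f. ideal I R \<longrightarrow> submodule T R (mod_Hom R K (reg_mod R)) \<longrightarrow> f \<in> carrier (mod_Hom R K (reg_mod R)) \<longrightarrow>
       f ` carrier K \<subseteq> I \<longrightarrow> f \<in> span_over (mod_Hom R K (reg_mod R)) I T bs)"
proof -
  let ?E = "mod_Hom R K (reg_mod R)"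
  interpret K: Module.module R K by (rule K)
  have reg: "module R (reg_mod R)" by (rule module_reg_mod[OF K.R.is_cring])
  have E: "module R ?E" by (rule module_mod_Hom[OF K(1) reg])
  obtain ks where ks: "set ks \<subseteq> carrier K"
      "(\<lambda>xs. lincomb_zip K xs ks) ` carrier (free_mod R (length ks)) = carrier K"
    using fin_gen_cover[OF K(1,3)] by blast
  obtain s where s: "s \<in> mod_hom R K (free_mod R (length ks))" "\<And>x. x \<in> carrier K \<Longrightarrow> lincomb_zip K (s x) ks = x"
    using projective_module_lift[OF K(2) module_free_mod[OF K.R.is_cring] K(1) hom_lincomb_zip[OF K(1) ks(1)] ks(2) hom_id]
    by blast
  have sc: "length (s x) = length ks" "set (s x) \<subseteq> carrier R" if "x \<in> carrier K" for x
    using hom_closed[OF s(1) that] by auto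
  have sn: "s x ! n \<in> carrier R" if "x \<in> carrier K" "n < length ks" for x n
    using sc[OF that(1)] that(2) nth_mem[of n "s x"] by auto
  \<comment> \<open>The coordinates of a section \<open>s\<close> of the free cover; restriction
    makes them members of \<open>mod_Hom\<close>, whose elements are extensional.\<close>
  define bs where "bs = map (\<lambda>n. \<lambda>x\<in>carrier K. s x ! n) [0..<length ks]"
  have bs: "map (\<lambda>b. b x) bs = s x" if "x \<in> carrier K" for x
    using sc[OF that] that by (intro nth_equalityI) (auto simp: bs_def)
  have bE: "set bs \<subseteq> carrier ?E"
  proof -
    have "(\<lambda>x. s x ! n) \<in> mod_hom R K (reg_mod R)" if "n < length ks" for n
      using that sc sn by (auto simp: mod_hom_def hom_add[OF s(1)] hom_smult[OF s(1)])
    then show ?thesis by (auto simp: bs_def hom_restrict_iff[OF K(1)])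
  qed
  have comb: "(\<lambda>x\<in>carrier K. lincomb_zip (reg_mod R) (map (\<lambda>b. b x) cs) rs) \<in> span_over ?E I T cs"
    if I: "ideal I R" and T: "submodule T R ?E" and "set cs \<subseteq> carrier ?E" "length rs = length cs" "set rs \<subseteq> I" for I T cs rs
    using that(3-5)
  proof (induction cs arbitrary: rs)
    case Nil
    then show ?case using submoduleD(2)[OF E T] by (simp add: restrict_def)
  next
    case (Cons c cs)
    then obtain r rs' where rs: "rs = r # rs'" by (metis length_Suc_conv list.size(4) Suc_eq_plus1)
    have rI: "r \<in> I" "r \<in> carrier R" "set rs' \<subseteq> carrier R" using Cons.prems rs idealD(1)[OF K.R.is_cring I] by auto
    have c: "b x \<in> carrier R" if "b \<in> set (c # cs)" "x \<in> carrier K" for b x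
      using Cons.prems(1) that hom_closed[of b R K "reg_mod R" x] by auto
    have l: "lincomb_zip (reg_mod R) (map (\<lambda>b. b x) cs) rs' \<in> carrier R" if "x \<in> carrier K" for x
      using lincomb_zip_closed[OF reg, of "map (\<lambda>b. b x) cs" rs'] c that rI by auto
    let ?g = "\<lambda>x\<in>carrier K. lincomb_zip (reg_mod R) (map (\<lambda>b. b x) cs) rs'"
    have "(\<lambda>x\<in>carrier K. lincomb_zip (reg_mod R) (map (\<lambda>b. b x) (c # cs)) rs) = r \<odot>\<^bsub>?E\<^esub> c \<oplus>\<^bsub>?E\<^esub> ?g"
      using c rI l by (auto simp: fun_eq_iff rs K.R.m_comm)
    also have "\<dots> \<in> span_over ?E I T (c # cs)"
      by (rule span_over_ConsI[OF rI(1) Cons.IH]) (use Cons.prems rs in auto)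
    finally show ?case .
  qed
  have "f \<in> span_over ?E I T bs"
    if I: "ideal I R" and T: "submodule T R ?E" and f: "f \<in> carrier ?E" "f ` carrier K \<subseteq> I" for I T f
  proof -
    have f': "f \<in> mod_hom R K (reg_mod R)" "f \<in> extensional (carrier K)" using f by auto
    \<comment> \<open>Apply \<open>f\<close> to the expansion of \<open>x\<close> in
      \<open>ks\<close>; read as a combination of the \<open>bs\<close>, its coefficients are values
      of \<open>f\<close> and so lie in \<open>I\<close>.\<close>
    have "f x = lincomb_zip (reg_mod R) (map (\<lambda>b. b x) bs) (map f ks)" if x: "x \<in> carrier K" for x
      using hom_of_lincomb_zip[OF K(1) reg f'(1) sc(2)[OF x] ks(1)] unfolding s(2)[OF x] bs[OF x] .
    then have "f = (\<lambda>x\<in>carrier K. lincomb_zip (reg_mod R) (map (\<lambda>b. b x) bs) (map f ks))"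
      using f'(2) by (auto simp: fun_eq_iff extensional_def)
    also have "\<dots> \<in> span_over ?E I T bs"
      by (rule comb[OF I T bE]) (use f(2) ks(1) in \<open>auto simp: bs_def\<close>)
    finally show ?thesis .
  qed
  then show ?thesis using ks(1) bE bs s(2)
    by (intro exI[of _ ks] exI[of _ bs]) (auto simp: bs_def)
qed

text \<open>Let \<open>J\<close> be the ideal of all \<open>r\<close> for which \<open>r f\<close> extends to \<open>F\<close> for every functional \<open>f\<close> on \<open>K\<close>.
  Starting from the generators of \<open>M\<close>, an element \<open>j\<close> of \<open>J\<close> is modified until \<open>1 - j\<close> annihilates \<open>M\<close>.
  If \<open>(1 - j) M\<close> is contained in the span of \<open>e, e\<^sub>2, \<dots>\<close>, extending \<open>x \<mapsto> f(x) e\<close> to a homomorphism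
  from \<open>F\<close> to \<open>M\<close> and reading off the coefficient of \<open>e\<close> shows that \<open>f\<close> extends modulo the ideal
  of all \<open>r\<close> with \<open>r e\<close> in the span of \<open>e\<^sub>2, \<dots>\<close>; then Nakayama's lemma applies.\<close>

lemma split_if_hom_ext:
  fixes R :: "('a, 'r) ring_scheme" (structure) and M :: "('a, 'b, 'm) module_scheme" and K :: "('a, 'k, 'm1) module_scheme" and F :: "('a, 'f, 'm2) module_scheme"
  assumes K: "module R K" "projective_module R K" "fin_gen R K"
    and F: "projective_module R F" and i: "i \<in> mod_hom R K F"
    and M: "module R M" "fin_gen R M" and ext: "hom_ext R K i F M"
    and ann: "\<And>r. r \<in> carrier R \<Longrightarrow> (\<And>m. m \<in> carrier M \<Longrightarrow> r \<odot>\<^bsub>M\<^esub> m = \<zero>\<^bsub>M\<^esub>) \<Longrightarrow>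
      \<exists>h\<in>mod_hom R F K. \<forall>x\<in>carrier K. h (i x) = r \<odot>\<^bsub>K\<^esub> x"
  shows "\<exists>h\<in>mod_hom R F K. \<forall>x\<in>carrier K. h (i x) = x"
proof -
  let ?E = "mod_Hom R K (reg_mod R)"
  interpret K: Module.module R K by (rule K)
  interpret M: Module.module R M by (rule M)
  note mF = projD[OF F]
  have reg: "module R (reg_mod R)" by (rule module_reg_mod[OF K.R.is_cring])
  have E: "module R ?E" by (rule module_mod_Hom[OF K(1) reg])
  interpret E: Module.module R ?E by (rule E)
  obtain ks bs where ks: "set ks \<subseteq> carrier K" and bs: "length bs = length ks" "set bs \<subseteq> carrier ?E"
    and lin: "\<And>x. x \<in> carrier K \<Longrightarrow> lincomb_zip K (map (\<lambda>b. b x) bs) ks = x"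
    and expand: "\<And>I T f. ideal I R \<Longrightarrow> submodule T R ?E \<Longrightarrow> f \<in> carrier ?E \<Longrightarrow> f ` carrier K \<subseteq> I \<Longrightarrow> f \<in> span_over ?E I T bs"
    using projective_dual_basis[OF K] by metis
  \<comment> \<open>The image of the functionals on \<open>F\<close>; for injective
    \<open>i\<close>, the quotient of \<open>?E\<close> by \<open>T\<close> is Ext in degree 1 of
    the cokernel of \<open>i\<close> against \<open>R\<close>.\<close>
  define T where "T = {f \<in> carrier ?E. \<exists>g\<in>mod_hom R F (reg_mod R). \<forall>x\<in>carrier K. g (i x) = f x}"
  have T: "submodule T R ?E"
  proof (rule submoduleI'[OF E])
    show "\<zero>\<^bsub>?E\<^esub> \<in> T" using E.M.zero_closed hom_const_zero[OF reg, of F] unfolding T_def by auto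
    fix f f' assume "f \<in> T" "f' \<in> T"
    then obtain g g' where *: "f \<in> carrier ?E" "f' \<in> carrier ?E" "g \<in> mod_hom R F (reg_mod R)" "g' \<in> mod_hom R F (reg_mod R)"
      "\<forall>x\<in>carrier K. g (i x) = f x" "\<forall>x\<in>carrier K. g' (i x) = f' x" by (auto simp: T_def)
    show "f \<oplus>\<^bsub>?E\<^esub> f' \<in> T" unfolding T_def
      using E.M.a_closed[OF *(1,2)] hom_plus[OF mF reg *(3,4)] *(5,6) by (auto intro!: bexI[of _ "\<lambda>x. g x \<oplus> g' x"])
  next
    fix r f assume r: "r \<in> carrier R" and "f \<in> T"
    then obtain g where *: "f \<in> carrier ?E" "g \<in> mod_hom R F (reg_mod R)" "\<forall>x\<in>carrier K. g (i x) = f x"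
      by (auto simp: T_def)
    show "r \<odot>\<^bsub>?E\<^esub> f \<in> T" unfolding T_def
      using E.smult_closed[OF r *(1)] hom_scale[OF mF reg *(2) r] *(3) by (auto intro!: bexI[of _ "\<lambda>x. r \<otimes> g x"])
  qed (auto simp: T_def)
  note TD = submoduleD[OF E T]
  define J where "J = {j \<in> carrier R. \<forall>f\<in>carrier ?E. j \<odot>\<^bsub>?E\<^esub> f \<in> T}"
  let ?sp = "span_over M (carrier R) {\<zero>\<^bsub>M\<^esub>}"
  \<comment> \<open>Induction removes the generators of \<open>M\<close> one at a time; it is
    started below with \<open>j = 0\<close> and all generators, and ends with the empty list, whose
    span is zero.\<close>
  have "\<exists>j\<in>J. \<forall>m\<in>carrier M. (\<one> \<ominus> j) \<odot>\<^bsub>M\<^esub> m = \<zero>\<^bsub>M\<^esub>"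
    if "set es \<subseteq> carrier M" "\<exists>j\<in>J. \<forall>m\<in>carrier M. (\<one> \<ominus> j) \<odot>\<^bsub>M\<^esub> m \<in> ?sp es" for es
    using that
  proof (induction es)
    case (Cons e es)
    have e: "e \<in> carrier M" and es: "set es \<subseteq> carrier M" and ees: "set (e # es) \<subseteq> carrier M" using Cons.prems by auto
    obtain j where j: "j \<in> J" "\<And>m. m \<in> carrier M \<Longrightarrow> (\<one> \<ominus> j) \<odot>\<^bsub>M\<^esub> m \<in> ?sp (e # es)"
      using Cons.prems by blast
    have jR: "j \<in> carrier R" "\<one> \<ominus> j \<in> carrier R" using j(1) by (auto simp: J_def)
    have S: "submodule (?sp es) R M" by (rule submodule_span[OF M(1) es])
    note SD = submoduleD[OF M(1) S]
    have S': "submodule (?sp (e # es)) R M" by (rule submodule_span[OF M(1) ees])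
    have mS': "module R (M\<lparr>carrier := ?sp (e # es)\<rparr>)" by (rule submoduleD[OF M(1) S'])
    define I where "I = {r \<in> carrier R. r \<odot>\<^bsub>M\<^esub> e \<in> ?sp es}"
    have I: "ideal I R" unfolding I_def
      by (rule cring_idealI[OF K.R.is_cring]) (use SD e in \<open>auto simp: M.smult_l_distr M.smult_assoc1\<close>)
    have "f \<in> span_over ?E I T bs" if f: "f \<in> carrier ?E" for f
    proof -
      have f': "f \<in> mod_hom R K (reg_mod R)" using f by simp
      have fR: "f x \<in> carrier R" if "x \<in> carrier K" for x using hom_closed[OF f' that] by simp
      have "(\<lambda>r. r \<odot>\<^bsub>M\<^esub> e) \<in> mod_hom R (reg_mod R) M"
        using e by (auto simp: mod_hom_def M.smult_l_distr M.smult_assoc1)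
      note fe = mod_hom_compose[OF f' this]
      obtain g where g: "g \<in> mod_hom R F M" "\<And>x. x \<in> carrier K \<Longrightarrow> g (i x) = f x \<odot>\<^bsub>M\<^esub> e"
        by (rule hom_extE[OF ext fe]) (rule that)
      \<comment> \<open>Multiplication by \<open>1 - j\<close> brings \<open>g\<close> into the span
        of \<open>e # es\<close>, so it lifts to the free module on these generators.\<close>
      have g': "(\<lambda>y. (\<one> \<ominus> j) \<odot>\<^bsub>M\<^esub> g y) \<in> mod_hom R F (M\<lparr>carrier := ?sp (e # es)\<rparr>)"
        by (rule hom_restrict_cod[OF hom_scale[OF mF M(1) g(1) jR(2)]]) (rule j(2)[OF hom_closed[OF g(1)]])
      have lz: "(\<lambda>xs. lincomb_zip M xs (e # es)) \<in> mod_hom R (free_mod R (length (e # es))) (M\<lparr>carrier := ?sp (e # es)\<rparr>)"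
        by (rule hom_restrict_cod[OF hom_lincomb_zip[OF M(1) ees]]) (use lincomb_zip_image[where R = R and es = "e # es"] in blast)
      have im: "(\<lambda>xs. lincomb_zip M xs (e # es)) ` carrier (free_mod R (length (e # es))) = carrier (M\<lparr>carrier := ?sp (e # es)\<rparr>)"
        using lincomb_zip_image[where R = R and A = M and es = "e # es"] by simp
      obtain \<Gamma> where \<Gamma>: "\<Gamma> \<in> mod_hom R F (free_mod R (length (e # es)))"
          "\<And>y. y \<in> carrier F \<Longrightarrow> lincomb_zip M (\<Gamma> y) (e # es) = (\<one> \<ominus> j) \<odot>\<^bsub>M\<^esub> g y"
        using projective_module_lift[OF F module_free_mod[OF K.R.is_cring] mS' lz im g'] by auto
      have \<Gamma>c: "\<exists>r rs. \<Gamma> y = r # rs \<and> length rs = length es \<and> r \<in> carrier R \<and> set rs \<subseteq> carrier R" if "y \<in> carrier F" for y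
        using hom_closed[OF \<Gamma>(1) that] by (auto simp: length_Suc_conv)
      let ?h = "\<lambda>y. hd (\<Gamma> y)"
      have hR: "?h y \<in> carrier R" if "y \<in> carrier F" for y using \<Gamma>c[OF that] by auto
      have h: "?h \<in> mod_hom R F (reg_mod R)"
        unfolding mod_hom_def
      proof (intro CollectI conjI ballI)
        show "?h \<in> carrier F \<rightarrow> carrier (reg_mod R)" using hR by auto
        fix x y assume x: "x \<in> carrier F" and y: "y \<in> carrier F"
        show "?h (x \<oplus>\<^bsub>F\<^esub> y) = ?h x \<oplus>\<^bsub>reg_mod R\<^esub> ?h y" 
          using \<Gamma>c[OF x] \<Gamma>c[OF y] by (auto simp: hom_add[OF \<Gamma>(1) x y])
      next
        fix r x assume r: "r \<in> carrier R" and x: "x \<in> carrier F"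
        show "?h (r \<odot>\<^bsub>F\<^esub> x) = r \<odot>\<^bsub>reg_mod R\<^esub> ?h x"
          using \<Gamma>c[OF x] by (auto simp: hom_smult[OF \<Gamma>(1) r x])
      qed
      have hi: "(\<lambda>x. ?h (i x)) \<in> mod_hom R K (reg_mod R)" by (rule mod_hom_compose[OF i h])
      define t where "t = (\<lambda>x\<in>carrier K. ?h (i x))"
      have t: "t \<in> T" unfolding T_def using hi h by (auto simp: t_def hom_restrict_iff[OF K(1)])
      \<comment> \<open>Modulo the other generators, \<open>(1 - j) f(x) e\<close> equals
        \<open>?h (i x)\<close> times \<open>e\<close>, so the difference of the two coefficients
        lies in \<open>I\<close>.\<close>
      define a where "a = (\<lambda>x\<in>carrier K. (\<one> \<ominus> j) \<otimes> f x \<ominus> ?h (i x))"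
      have a: "a \<in> carrier ?E"
      proof -
        have "(\<lambda>x. (\<one> \<ominus> j) \<otimes> f x \<ominus> ?h (i x)) \<in> mod_hom R K (reg_mod R)"
          by (rule hom_cong[OF K(1) hom_diff[OF K(1) reg hom_scale[OF K(1) reg f' jR(2)] hi]])
            (use fR jR hR hom_closed[OF i] in \<open>simp add: reg_mod_minus[OF K.R.is_cring]\<close>)
        then show ?thesis by (simp add: a_def hom_restrict_iff[OF K(1)])
      qed
      have aI: "a x \<in> I" if x: "x \<in> carrier K" for x
      proof -
        have ix: "i x \<in> carrier F" by (rule hom_closed[OF i x])
        obtain r rs where rs: "\<Gamma> (i x) = r # rs" "length rs = length es" "r \<in> carrier R" "set rs \<subseteq> carrier R"
          using \<Gamma>c[OF ix] by blast
        have l: "lincomb_zip M rs es \<in> ?sp es"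
          unfolding lincomb_zip_image[where R = R, symmetric] using rs by (intro imageI) simp
        then have lM: "lincomb_zip M rs es \<in> carrier M" using SD(1) by blast
        have ax: "a x = (\<one> \<ominus> j) \<otimes> f x \<ominus> r" using x rs by (simp add: a_def)
        have "((\<one> \<ominus> j) \<otimes> f x) \<odot>\<^bsub>M\<^esub> e = r \<odot>\<^bsub>M\<^esub> e \<oplus>\<^bsub>M\<^esub> lincomb_zip M rs es"
          using \<Gamma>(2)[OF ix] g(2)[OF x] rs(1) e jR fR[OF x] by (simp add: M.smult_assoc1)
        then have "a x \<odot>\<^bsub>M\<^esub> e = lincomb_zip M rs es"
          using rs(3) e lM jR fR[OF x] by (simp add: ax a_minus_def M.smult_l_distr M.smult_l_minus) (simp flip: a_minus_def)
        then show ?thesis using l rs(3) jR fR[OF x] by (simp add: I_def ax)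
      qed
      have jf: "j \<odot>\<^bsub>?E\<^esub> f \<in> T" using j(1) f by (auto simp: J_def)
      \<comment> \<open>\<open>j f\<close> and \<open>t\<close> extend to \<open>F\<close>, and
        \<open>a\<close> has values in \<open>I\<close>, so it is an \<open>I\<close>-combination of
        the dual basis modulo \<open>T\<close>: this is the hypothesis of
        \<open>nakayama\<close>.\<close>
      have "f = (j \<odot>\<^bsub>?E\<^esub> f \<oplus>\<^bsub>?E\<^esub> t) \<oplus>\<^bsub>?E\<^esub> a"
      proof (rule extensionalityI[of _ "carrier K"])
        fix x assume x: "x \<in> carrier K"
        have "?h (i x) \<in> carrier R" using hR hom_closed[OF i x] by blast
        then have "f x = (j \<otimes> f x \<oplus> ?h (i x)) \<oplus> ((\<one> \<ominus> j) \<otimes> f x \<ominus> ?h (i x))"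
          using fR[OF x] jR(1) by algebra
        then show "f x = ((j \<odot>\<^bsub>?E\<^esub> f \<oplus>\<^bsub>?E\<^esub> t) \<oplus>\<^bsub>?E\<^esub> a) x" using x by (simp add: t_def a_def)
      qed (use f in auto)
      also have "\<dots> \<in> span_over ?E I T bs"
      proof (rule submoduleD(4)[OF E submodule_span_over[OF E I T bs(2)]])
        show "j \<odot>\<^bsub>?E\<^esub> f \<oplus>\<^bsub>?E\<^esub> t \<in> span_over ?E I T bs"
          using TD(4)[OF jf t] subset_span_over(1)[OF E I T bs(2)] by blast
        show "a \<in> span_over ?E I T bs" by (rule expand[OF I T a]) (use aI in auto)
      qed
      finally show ?thesis .
    qed
    then obtain c where c: "c \<in> carrier R" "\<one> \<ominus> c \<in> I" "\<And>b. b \<in> set bs \<Longrightarrow> c \<odot>\<^bsub>?E\<^esub> b \<in> T"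
      using nakayama[OF E I T bs(2)] bs(2) by blast
    have cE: "c \<odot>\<^bsub>?E\<^esub> f \<in> T" if f: "f \<in> carrier ?E" for f
    proof -
      have "f ` carrier K \<subseteq> carrier R" using f hom_closed[of f R K "reg_mod R"] by auto
      then have "f \<in> span_over ?E (carrier R) T bs" by (rule expand[OF K.R.oneideal T f])
      also have "\<dots> \<subseteq> {f \<in> carrier ?E. c \<odot>\<^bsub>?E\<^esub> f \<in> T}"
      proof (rule span_over_subset[OF E submodule_scale_preimage[OF E c(1) T]])
        show "T \<subseteq> {f \<in> carrier ?E. c \<odot>\<^bsub>?E\<^esub> f \<in> T}" using TD(1) TD(6)[OF c(1)] by blast
        fix a b assume a: "a \<in> carrier R" and b: "b \<in> set bs"
        have bE: "b \<in> carrier ?E" using b bs(2) by blast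
        have "c \<odot>\<^bsub>?E\<^esub> (a \<odot>\<^bsub>?E\<^esub> b) = a \<odot>\<^bsub>?E\<^esub> (c \<odot>\<^bsub>?E\<^esub> b)"
          using a bE c(1) by (simp only: E.smult_assoc1[symmetric] K.R.m_comm)
        then show "a \<odot>\<^bsub>?E\<^esub> b \<in> {f \<in> carrier ?E. c \<odot>\<^bsub>?E\<^esub> f \<in> T}"
          using TD(6)[OF a c(3)[OF b]] E.smult_closed[OF a bE] by (simp del: mod_Hom_sel)
      qed
      finally show ?thesis by simp
    qed
    \<comment> \<open>Chosen so that \<open>1 - ?j = (1 - c)(1 - j)\<close>: the factor
      \<open>1 - c\<close> in \<open>I\<close> removes \<open>e\<close> from the span, while
      \<open>c\<close> and \<open>j\<close> both multiply \<open>?E\<close> into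
      \<open>T\<close>.\<close>
    let ?j = "c \<oplus> (\<one> \<ominus> c) \<otimes> j"
    have c1: "\<one> \<ominus> c \<in> carrier R" using c(1) by simp
    have jJ: "?j \<in> J" unfolding J_def
    proof (intro CollectI conjI ballI)
      show "?j \<in> carrier R" using c(1) jR by simp
      fix f assume f: "f \<in> carrier ?E"
      have "?j \<odot>\<^bsub>?E\<^esub> f = c \<odot>\<^bsub>?E\<^esub> f \<oplus>\<^bsub>?E\<^esub> (\<one> \<ominus> c) \<odot>\<^bsub>?E\<^esub> (j \<odot>\<^bsub>?E\<^esub> f)"
        using f c(1) c1 jR by (simp only: E.smult_l_distr E.smult_assoc1 K.R.m_closed)
      also have "\<dots> \<in> T"
        by (rule TD(4)[OF cE[OF f] TD(6)[OF c1]]) (use j(1) f in \<open>auto simp: J_def\<close>)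
      finally show "?j \<odot>\<^bsub>?E\<^esub> f \<in> T" .
    qed
    have "(\<one> \<ominus> ?j) \<odot>\<^bsub>M\<^esub> m \<in> ?sp es" if m: "m \<in> carrier M" for m
    proof -
      have "\<one> \<ominus> ?j = (\<one> \<ominus> c) \<otimes> (\<one> \<ominus> j)" using c(1) jR(1) by algebra
      then have eq: "(\<one> \<ominus> ?j) \<odot>\<^bsub>M\<^esub> m = (\<one> \<ominus> c) \<odot>\<^bsub>M\<^esub> ((\<one> \<ominus> j) \<odot>\<^bsub>M\<^esub> m)"
        using c1 jR m by (simp add: M.smult_assoc1)
      obtain r y where ry: "(\<one> \<ominus> j) \<odot>\<^bsub>M\<^esub> m = r \<odot>\<^bsub>M\<^esub> e \<oplus>\<^bsub>M\<^esub> y" "r \<in> carrier R" "y \<in> ?sp es"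
        using j(2)[OF m] by auto
      have yM: "y \<in> carrier M" using ry(3) SD(1) by blast
      have "(\<one> \<ominus> c) \<odot>\<^bsub>M\<^esub> (r \<odot>\<^bsub>M\<^esub> e \<oplus>\<^bsub>M\<^esub> y) = r \<odot>\<^bsub>M\<^esub> ((\<one> \<ominus> c) \<odot>\<^bsub>M\<^esub> e) \<oplus>\<^bsub>M\<^esub> (\<one> \<ominus> c) \<odot>\<^bsub>M\<^esub> y"
        using c1 e yM ry(2) by (simp add: M.smult_r_distr M.smult_assoc1[symmetric] K.R.m_comm)
      also have "\<dots> \<in> ?sp es"
        by (rule SD(4)[OF SD(6)[OF ry(2)] SD(6)[OF c1 ry(3)]]) (use c(2) in \<open>simp add: I_def\<close>)
      finally show ?thesis unfolding eq ry(1) .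
    qed
    then show ?case using Cons.IH[OF es] jJ by blast
  qed auto
  moreover obtain ms where ms: "set ms \<subseteq> carrier M" "carrier M = ?sp ms" using M(2) unfolding fin_gen_def by blast
  moreover have "\<zero> \<in> J" using TD(2) by (auto simp: J_def simp del: mod_Hom_sel)
  moreover have "\<forall>m\<in>carrier M. (\<one> \<ominus> \<zero>) \<odot>\<^bsub>M\<^esub> m \<in> ?sp ms" unfolding ms(2)[symmetric] by simp
  ultimately obtain j where j: "j \<in> J" "\<And>m. m \<in> carrier M \<Longrightarrow> (\<one> \<ominus> j) \<odot>\<^bsub>M\<^esub> m = \<zero>\<^bsub>M\<^esub>"
    by blast
  have jR: "j \<in> carrier R" "\<one> \<ominus> j \<in> carrier R" using j(1) by (auto simp: J_def)
  \<comment> \<open>Since \<open>1 - j\<close> annihilates \<open>M\<close>, multiplication by it on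
    \<open>K\<close> extends to \<open>F\<close>. For a functional \<open>b\<close>,
    \<open>j b\<close> extends because \<open>j\<close> is in \<open>J\<close>, and
    \<open>(1 - j) b\<close> extends as \<open>b \<circ> h\<close>; their sum is
    \<open>b\<close>.\<close>
  obtain h where h: "h \<in> mod_hom R F K" "\<And>x. x \<in> carrier K \<Longrightarrow> h (i x) = (\<one> \<ominus> j) \<odot>\<^bsub>K\<^esub> x"
    using ann[OF jR(2) j(2)] by blast
  have "\<exists>g\<in>mod_hom R F (reg_mod R). \<forall>x\<in>carrier K. g (i x) = b x" if b: "b \<in> set bs" for b
  proof -
    have bE: "b \<in> carrier ?E" using b bs(2) by blast
    then have b': "b \<in> mod_hom R K (reg_mod R)" by simp
    have "j \<odot>\<^bsub>?E\<^esub> b \<in> T" using j(1) bE by (auto simp: J_def simp del: mod_Hom_sel)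
    then obtain g where g: "g \<in> mod_hom R F (reg_mod R)" "\<And>x. x \<in> carrier K \<Longrightarrow> g (i x) = j \<otimes> b x"
      unfolding T_def by auto
    show ?thesis
    proof (intro bexI ballI)
      show "(\<lambda>y. g y \<oplus>\<^bsub>reg_mod R\<^esub> b (h y)) \<in> mod_hom R F (reg_mod R)"
        by (rule hom_plus[OF mF reg g(1) mod_hom_compose[OF h(1) b']])
      fix x assume x: "x \<in> carrier K"
      have bx: "b x \<in> carrier R" using hom_closed[OF b' x] by simp
      have "b (h (i x)) = (\<one> \<ominus> j) \<otimes> b x" using hom_smult[OF b' jR(2) x] h(2)[OF x] by simp
      moreover have "j \<otimes> b x \<oplus> (\<one> \<ominus> j) \<otimes> b x = b x" using bx jR(1) by algebra
      ultimately show "g (i x) \<oplus>\<^bsub>reg_mod R\<^esub> b (h (i x)) = b x" using g(2)[OF x] by simp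
    qed
  qed
  then obtain \<psi> where \<psi>: "\<And>b. b \<in> set bs \<Longrightarrow> \<psi> b \<in> mod_hom R F (reg_mod R)"
      "\<And>b x. b \<in> set bs \<Longrightarrow> x \<in> carrier K \<Longrightarrow> \<psi> b (i x) = b x" by metis
  \<comment> \<open>Extending the whole dual basis gives a map to a free module; followed by the
    combination with \<open>ks\<close> it is a left inverse of \<open>i\<close>.\<close>
  have \<Psi>: "(\<lambda>y. map (\<lambda>b. \<psi> b y) bs) \<in> mod_hom R F (free_mod R (length ks))"
    using hom_closed[OF \<psi>(1)] bs(1)
    by (auto simp: mod_hom_def hom_add[OF \<psi>(1)] hom_smult[OF \<psi>(1)] zip_map1 zip_map2 zip_same_conv_map)
  show ?thesis
  proof (intro bexI[OF _ mod_hom_compose[OF \<Psi> hom_lincomb_zip[OF K(1) ks]]] ballI)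
    fix x assume x: "x \<in> carrier K"
    have *: "map (\<lambda>b. \<psi> b (i x)) bs = map (\<lambda>b. b x) bs" using \<psi>(2) x by simp
    show "lincomb_zip K (map (\<lambda>b. \<psi> b (i x)) bs) ks = x" unfolding * by (rule lin[OF x])
  qed
qed

text \<open>The map \<open>y - i (h y)\<close> vanishes on the kernel of \<open>p\<close>, so it
  descends to a section of \<open>p\<close>, which makes \<open>N\<close> a retract of
  \<open>F\<close>.\<close>

lemma projective_if_split:
  fixes N :: "('a, 'n, 'm) module_scheme"
  assumes s: "ses R K i F p N" and F: "projective_module R F" and h: "h \<in> mod_hom R F K" "\<And>x. x \<in> carrier K \<Longrightarrow> h (i x) = x"
  shows "projective_module R N"
proof -
  note D = sesD[OF s]
  interpret F: Module.module R F by (rule D)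
  interpret N: Module.module R N by (rule D)
  have e: "(\<lambda>y. y \<ominus>\<^bsub>F\<^esub> i (h y)) \<in> mod_hom R F F"
    by (rule hom_diff[OF D(2,2) hom_id mod_hom_compose[OF h(1) D(4)]])
  have "y \<ominus>\<^bsub>F\<^esub> i (h y) = \<zero>\<^bsub>F\<^esub>" if "y \<in> carrier F" "p y = \<zero>\<^bsub>N\<^esub>" for y
  proof -
    have "y \<in> i ` carrier K" using that D(8) by auto
    then obtain x where "x \<in> carrier K" "y = i x" by auto
    then show ?thesis using h(2) hom_closed[OF D(4)] by simp
  qed
  then obtain \<sigma> where \<sigma>: "\<sigma> \<in> mod_hom R N F" "\<And>y. y \<in> carrier F \<Longrightarrow> \<sigma> (p y) = y \<ominus>\<^bsub>F\<^esub> i (h y)"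
    using surj_factor[OF D(2,3,2,5,7) e] by blast
  show ?thesis
  proof (rule projective_retract[OF F D(3) \<sigma>(1) D(5)])
    fix x assume "x \<in> carrier N"
    then obtain y where y: "y \<in> carrier F" "x = p y" using D(7) by auto
    have hy: "h y \<in> carrier K" by (rule hom_closed[OF h(1) y(1)])
    show "p (\<sigma> x) = x"
      unfolding y(2) \<sigma>(2)[OF y(1)] hom_minus[OF D(2,3,5) y(1) hom_closed[OF D(4) hy]] D(9)[OF hy]
      using hom_closed[OF D(5) y(1)] by (simp add: a_minus_def)
  qed
qed

section \<open>Projective resolutions and complexes\<close>

lemma mod_transport_iso:
  assumes A: "module R A" and e: "inj_on e (carrier A)"
  shows "module R (mod_transport e A)" "e \<in> mod_hom R A (mod_transport e A)"
    "inv_into (carrier A) e \<in> mod_hom R (mod_transport e A) A"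
    "bij_betw e (carrier A) (carrier (mod_transport e A))"
    "carrier (mod_transport e A) = e ` carrier A"
    "x \<in> carrier A \<Longrightarrow> inv_into (carrier A) e (e x) = x"
  using mod_transport[OF A e] e by (auto simp: mod_transport_def bij_betw_def)

text \<open>\<open>K k\<close> is the syzygy of order \<open>k + 1\<close>, as a submodule of \<open>G k\<close>.\<close>

definition resolved_by ::
  "('a, 'r) ring_scheme \<Rightarrow> ('a, 'b, 'm) module_scheme \<Rightarrow> (nat \<Rightarrow> ('a, 'c) module) \<Rightarrow> (nat \<Rightarrow> ('a, 'c) module) \<Rightarrow>
     ('c \<Rightarrow> 'b) \<Rightarrow> (nat \<Rightarrow> 'c \<Rightarrow> 'c) \<Rightarrow> bool" where
  "resolved_by R N K G e p \<longleftrightarrow> ses R (K 0) (\<lambda>x. x) (G 0) e N \<and>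
     (\<forall>k. ses R (K (Suc k)) (\<lambda>x. x) (G (Suc k)) (p k) (K k)) \<and> (\<forall>k. projective_module R (G k))"

lemma resolved_byD:
  assumes "resolved_by R N K G e p"
  shows "ses R (K 0) (\<lambda>x. x) (G 0) e N" "ses R (K (Suc k)) (\<lambda>x. x) (G (Suc k)) (p k) (K k)"
    "projective_module R (G k)" "module R (K k)" "module R (G k)" "(\<lambda>x. x) \<in> mod_hom R (K k) (G k)"
proof -
  note r = assms[unfolded resolved_by_def]
  show "ses R (K 0) (\<lambda>x. x) (G 0) e N" "ses R (K (Suc k)) (\<lambda>x. x) (G (Suc k)) (p k) (K k)"
    "projective_module R (G k)" using r by blast+
  show "module R (K k)" "module R (G k)" "(\<lambda>x. x) \<in> mod_hom R (K k) (G k)"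
    using r by (cases k; blast dest: sesD(1,2,4))+
qed

text \<open>The syzygies of the resolution themselves form the coinduction invariant, so vanishing
  in each degree along one resolution suffices.\<close>

lemma ext_perp_if_resolved:
  fixes N :: "('a, nat \<Rightarrow> 'y) module" and K G :: "nat \<Rightarrow> ('a, nat \<Rightarrow> 'y) module"
  assumes r: "resolved_by R N K G e p" and ext: "\<And>k. hom_ext R (K k) (\<lambda>x. x) (G k) Y"
  shows "ext_perp R Y N"
proof -
  note r = resolved_byD[OF r]
  have "ext_perp R Y A" if "\<exists>j. A = K j" for A
    using that
  proof (coinduction arbitrary: A)
    case ext_perp
    then obtain k where "A = K k" by blast
    then show ?case using r(2)[of k] r(3)[of "Suc k"] ext[of "Suc k"] by blast
  qed
  then show ?thesis by (intro ext_perpI[OF r(1,3) ext]) blast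
qed

text \<open>The second chain is not asked to resolve a module: it is also applied to the part of a
  complex above its top nonzero homology, where the relation at index 0 is made by hand.\<close>

lemma syzygy_rel_chain:
  assumes rel: "syzygy_rel R r (K 0) (\<lambda>x. x) (G 0) (K' 0) (\<lambda>x. x) (G' 0)" and r: "r \<in> carrier R"
    and res: "resolved_by R N K G e p"
    and s': "\<And>k. ses R (K' (Suc k)) (\<lambda>x. x) (G' (Suc k)) (p' k) (K' k)" "\<And>k. projective_module R (G' k)"
  shows "syzygy_rel R r (K k) (\<lambda>x. x) (G k) (K' k) (\<lambda>x. x) (G' k)"
proof (induction k)
  case (Suc k)
  note res = resolved_byD[OF res]
  show ?case by (rule syzygy_rel_step[OF Suc r res(6,2) s'(1) res(3,3) s'(2)])
qed (rule rel)

lemma syzygy_rel_resolutions: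
  assumes res: "resolved_by R N K G e p" and res': "resolved_by R N' K' G' e' p'"
    and a: "a \<in> mod_hom R N N'" and b: "b \<in> mod_hom R N' N" and w: "w \<in> mod_hom R N (G 0)" and r: "r \<in> carrier R"
    and eq: "\<And>x. x \<in> carrier N \<Longrightarrow> b (a x) \<oplus>\<^bsub>N\<^esub> e (w x) = r \<odot>\<^bsub>N\<^esub> x"
  shows "syzygy_rel R r (K k) (\<lambda>x. x) (G k) (K' k) (\<lambda>x. x) (G' k)"
proof (rule syzygy_rel_chain[where K' = K' and G' = G', OF _ r res resolved_byD(2,3)[OF res']])
  note res = resolved_byD[OF res] and res' = resolved_byD[OF res']
  show "syzygy_rel R r (K 0) (\<lambda>x. x) (G 0) (K' 0) (\<lambda>x. x) (G' 0)"
    by (rule syzygy_comparison[OF res(1) res'(1) res(3) res'(3) a b w r eq])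
qed

text \<open>When \<open>K'\<close> is zero, the map through it disappears and the homotopy alone is
  multiplication by \<open>r\<close>.\<close>

lemma syzygy_rel_zero:
  assumes rel: "syzygy_rel R r K i G K' i' G'" and K: "module R K" "module R K'" and K': "carrier K' = {\<zero>\<^bsub>K'\<^esub>}"
    and i: "i \<in> mod_hom R K G" and r: "r \<in> carrier R"
  shows "\<exists>h\<in>mod_hom R G K. \<forall>x\<in>carrier K. h (i x) = r \<odot>\<^bsub>K\<^esub> x"
proof -
  interpret K: Module.module R K by (rule K)
  obtain a b h where h: "a \<in> mod_hom R K K'" "b \<in> mod_hom R K' K" "h \<in> mod_hom R G K"
      "\<And>x. x \<in> carrier K \<Longrightarrow> b (a x) \<oplus>\<^bsub>K\<^esub> h (i x) = r \<odot>\<^bsub>K\<^esub> x"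
    using rel unfolding syzygy_rel_def by blast
  have "h (i x) = r \<odot>\<^bsub>K\<^esub> x" if x: "x \<in> carrier K" for x
  proof -
    have "a x = \<zero>\<^bsub>K'\<^esub>" using hom_closed[OF h(1) x] K' by simp
    then show ?thesis using h(4)[OF x] hom_zero[OF K(2,1) h(2)] hom_closed[OF h(3) hom_closed[OF i x]] by simp
  qed
  then show ?thesis using h(3) by blast
qed

text \<open>Comparison with the zero resolution. Two cases matter: \<open>r\<close> annihilates
  \<open>N\<close>, with \<open>w = 0\<close>; or \<open>N\<close> is projective, with
  \<open>r = 1\<close> and \<open>w\<close> a section of \<open>e\<close>.\<close>

lemma syzygy_rel_zero_chain:
  assumes res: "resolved_by R N K G e p" and r: "r \<in> carrier R"
    and w: "w \<in> mod_hom R N (G 0)" "\<And>x. x \<in> carrier N \<Longrightarrow> e (w x) = r \<odot>\<^bsub>N\<^esub> x"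
  shows "\<exists>h\<in>mod_hom R (G k) (K k). \<forall>x\<in>carrier (K k). h x = r \<odot>\<^bsub>K k\<^esub> x"
proof -
  note D = resolved_byD[OF res]
  have mN: "module R N" by (rule sesD(3)[OF D(1)])
  interpret N: Module.module R N by (rule mN)
  let ?Z = "(K 0)\<lparr>carrier := {\<zero>\<^bsub>K 0\<^esub>}\<rparr>"
  have mZ: "module R ?Z" by (rule submoduleD[OF D(4) submodule_zero[OF D(4)]])
  have Z: "projective_module R ?Z" by (rule projective_zero[OF mZ]) simp
  have "ses R ?Z (\<lambda>x. x) ?Z (\<lambda>x. x) ?Z" using mZ by (auto simp: ses_def hom_id)
  then have "resolved_by R ?Z (\<lambda>k. ?Z) (\<lambda>k. ?Z) (\<lambda>x. x) (\<lambda>k x. x)" using Z by (simp add: resolved_by_def)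
  from syzygy_rel_resolutions[OF res this hom_const_zero[OF mZ] hom_const_zero[OF mN] w(1) r]
  have "syzygy_rel R r (K k) (\<lambda>x. x) (G k) ?Z (\<lambda>x. x) ?Z" using w(2) r by simp
  then show ?thesis
    by (rule syzygy_rel_zero[OF _ D(4) mZ _ D(6) r]) simp
qed

text \<open>The splitting criterion applies at every stage because a scalar killing \<open>M\<close>
  is null-homotopic on the whole resolution: its multiplication on each \<open>K k\<close> extends
  to \<open>G k\<close>. A split \<open>K k\<close> makes the preceding syzygy a retract of a
  projective.\<close>

lemma projective_if_projective_syzygy:
  assumes res: "resolved_by R M K G e p" and fg: "fin_gen R M" "\<And>k. fin_gen R (K k)"
    and ext: "\<And>k. hom_ext R (K k) (\<lambda>x. x) (G k) M" and n: "projective_module R (K n)"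
  shows "projective_module R M"
proof -
  note D = resolved_byD[OF res]
  have M: "module R M" by (rule sesD(3)[OF D(1)])
  have split: "\<exists>h\<in>mod_hom R (G k) (K k). \<forall>x\<in>carrier (K k). h x = x" if "projective_module R (K k)" for k
  proof (rule split_if_hom_ext[OF D(4) that fg(2) D(3,6) M fg(1) ext])
    fix r assume r: "r \<in> carrier R" "\<And>m. m \<in> carrier M \<Longrightarrow> r \<odot>\<^bsub>M\<^esub> m = \<zero>\<^bsub>M\<^esub>"
    show "\<exists>h\<in>mod_hom R (G k) (K k). \<forall>x\<in>carrier (K k). h x = r \<odot>\<^bsub>K k\<^esub> x"
      by (rule syzygy_rel_zero_chain[OF res r(1) hom_const_zero[OF D(5)]])
        (simp add: r(2) hom_zero[OF sesD(2,3,5)[OF D(1)]])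
  qed
  from n have "projective_module R (K 0)"
  proof (induction n)
    case (Suc n)
    obtain h where h: "h \<in> mod_hom R (G (Suc n)) (K (Suc n))" "\<And>x. x \<in> carrier (K (Suc n)) \<Longrightarrow> h x = x"
      using split[OF Suc.prems] by blast
    show ?case by (rule Suc.IH[OF projective_if_split[OF D(2,3) h]])
  qed
  then obtain h where h: "h \<in> mod_hom R (G 0) (K 0)" "\<And>x. x \<in> carrier (K 0) \<Longrightarrow> h x = x"
    using split by blast
  show ?thesis by (rule projective_if_split[OF D(1,3) h])
qed

section \<open>Homology and Hom complexes\<close>

lemma quotient_hom:
  fixes A (structure)
  assumes A: "module R A" and H: "submodule H R A"
  shows "(\<lambda>x. H +> x) \<in> mod_hom R A (mod_quotient A H)"
    "(\<lambda>x. H +> x) ` carrier A = carrier (mod_quotient A H)"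
    "x \<in> carrier A \<Longrightarrow> H +> x = H +> \<zero> \<longleftrightarrow> x \<in> H"
proof -
  interpret A: Module.module R A by (rule A)
  note HD = submoduleD[OF A H]
  have sg: "subgroup H (add_monoid A)" using H by (rule submodule.axioms)
  interpret H: abelian_subgroup H A
    by (rule abelian_subgroupI3[OF additive_subgroupI[OF sg] A.M.abelian_group_axioms])
  \<comment> \<open>Scalar multiplication on \<open>mod_quotient\<close> is a union over
    representatives, which collapses because every representative gives the same coset.\<close>
  have "(\<Union>y\<in>H +> x. H +> (r \<odot> y)) = H +> (r \<odot> x)" if x: "x \<in> carrier A" and r: "r \<in> carrier R" for x r
  proof -
    have "H +> (r \<odot> y) = H +> (r \<odot> x)" if "y \<in> H +> x" for y
    proof -
      obtain h where h: "h \<in> H" "y = h \<oplus> x" using \<open>y \<in> H +> x\<close> by (auto simp: a_r_coset_def')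
      have "r \<odot> y = r \<odot> h \<oplus> r \<odot> x" using h HD(1) x r by (auto simp: A.smult_r_distr)
      then have "r \<odot> y \<in> H +> (r \<odot> x)" using HD(6)[OF r h(1)] by (auto simp: a_r_coset_def')
      then show ?thesis using A.M.a_repr_independence[OF _ _ sg] x r by auto
    qed
    moreover have "H +> x \<noteq> {}" using H.a_rcos_self[OF x] by blast
    ultimately show ?thesis by auto
  qed
  then show "(\<lambda>x. H +> x) \<in> mod_hom R A (mod_quotient A H)"
    using A.M.a_rcosetsI[OF HD(1)] by (auto simp: mod_hom_def mod_quotient_def H.a_rcos_sum)
  show "(\<lambda>x. H +> x) ` carrier A = carrier (mod_quotient A H)"
    by (auto simp: mod_quotient_def A_RCOSETS_def')
  show "H +> x = H +> \<zero> \<longleftrightarrow> x \<in> H" if "x \<in> carrier A"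
    using A.M.a_coset_join1[OF _ that sg] A.M.a_coset_join2[OF that sg] HD(1) by auto
qed

lemma zero_mod_quotient_iff:
  fixes A (structure)
  assumes A: "module R A" and H: "submodule H R A"
  shows "zero_module (mod_quotient A H) \<longleftrightarrow> carrier A \<subseteq> H"
proof -
  interpret A: Module.module R A by (rule A)
  note q = quotient_hom[OF A H]
  have "\<zero>\<^bsub>mod_quotient A H\<^esub> = H +> \<zero>"
    using submoduleD(1)[OF A H] by (simp add: mod_quotient_def)
  then have "zero_module (mod_quotient A H) \<longleftrightarrow> (\<forall>x\<in>carrier A. H +> x = H +> \<zero>)"
    using A.M.zero_closed unfolding zero_module_def q(2)[symmetric] by auto
  then show ?thesis using q(3) by auto
qed

definition cycles :: "('a, 'b) mod_complex \<Rightarrow> int \<Rightarrow> 'b set" where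
  "cycles C i = {x \<in> carrier (obj C i). bd C i x = \<zero>\<^bsub>obj C (i - 1)\<^esub>}"

definition boundaries :: "('a, 'b) mod_complex \<Rightarrow> int \<Rightarrow> 'b set" where
  "boundaries C i = bd C (i + 1) ` carrier (obj C (i + 1))"

abbreviation cycle_mod :: "('a, 'b) mod_complex \<Rightarrow> int \<Rightarrow> ('a, 'b) module" where
  "cycle_mod C i \<equiv> (obj C i)\<lparr>carrier := cycles C i\<rparr>"

abbreviation boundary_mod :: "('a, 'b) mod_complex \<Rightarrow> int \<Rightarrow> ('a, 'b) module" where
  "boundary_mod C i \<equiv> (obj C i)\<lparr>carrier := boundaries C i\<rparr>"

lemma homology_eq: "homology C i = mod_quotient (cycle_mod C i) (boundaries C i)"
  by (simp add: homology_def cycles_def boundaries_def a_kernel_eq)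

lemma is_complexD:
  assumes "is_complex R C"
  shows "module R (obj C i)" "bd C i \<in> mod_hom R (obj C i) (obj C (i - 1))"
    "bd C (i + 1) \<in> mod_hom R (obj C (i + 1)) (obj C i)"
    "x \<in> carrier (obj C i) \<Longrightarrow> bd C (i - 1) (bd C i x) = \<zero>\<^bsub>obj C (i - 2)\<^esub>"
proof -
  note C = assms[unfolded is_complex_def]
  show "module R (obj C i)" "bd C i \<in> mod_hom R (obj C i) (obj C (i - 1))"
    "x \<in> carrier (obj C i) \<Longrightarrow> bd C (i - 1) (bd C i x) = \<zero>\<^bsub>obj C (i - 2)\<^esub>" using C by blast+
  have "bd C (i + 1) \<in> mod_hom R (obj C (i + 1)) (obj C ((i + 1) - 1))" using C by blast
  then show "bd C (i + 1) \<in> mod_hom R (obj C (i + 1)) (obj C i)" by simp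
qed

lemma cycles_boundaries:
  assumes C: "is_complex R C"
  shows "submodule (cycles C i) R (obj C i)" "submodule (boundaries C i) R (obj C i)"
    "boundaries C i \<subseteq> cycles C i" "submodule (boundaries C i) R (cycle_mod C i)"
    "module R (cycle_mod C i)" "module R (boundary_mod C i)"
    "ses R (cycle_mod C (i + 1)) (\<lambda>x. x) (obj C (i + 1)) (bd C (i + 1)) (boundary_mod C i)"
proof -
  note D = is_complexD[OF C]
  show Z: "submodule (cycles C i) R (obj C i)" for i
    unfolding cycles_def by (rule submodule_kernel[OF D(1,1,2)])
  show B: "submodule (boundaries C i) R (obj C i)"
    unfolding boundaries_def
    by (rule submodule_image[OF D(1,1) D(3)]) (rule module.carrier_is_submodule[OF D(1)])
  have "bd C i (bd C (i + 1) x) = \<zero>\<^bsub>obj C (i - 1)\<^esub>" if "x \<in> carrier (obj C (i + 1))" for x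
    using D(4)[OF that] by (simp add: algebra_simps)
  then show BZ: "boundaries C i \<subseteq> cycles C i"
    using hom_closed[OF D(3)] by (auto simp: boundaries_def cycles_def)
  show mZ: "module R (cycle_mod C i)" and mB: "module R (boundary_mod C i)"
    by (rule submoduleD[OF D(1) Z] submoduleD[OF D(1) B])+
  show "submodule (boundaries C i) R (cycle_mod C i)"
    by (rule submoduleI'[OF mZ]) (use BZ submoduleD[OF D(1) B] in auto)
  have bB: "bd C (i + 1) \<in> mod_hom R (obj C (i + 1)) (boundary_mod C i)"
    by (rule hom_restrict_cod[OF D(3)]) (auto simp: boundaries_def)
  show "ses R (cycle_mod C (i + 1)) (\<lambda>x. x) (obj C (i + 1)) (bd C (i + 1)) (boundary_mod C i)"
    by (rule ses_inclusion[OF D(1) mB bB]) (auto simp: boundaries_def cycles_def)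
qed

lemma zero_homology_iff:
  assumes C: "is_complex R C"
  shows "zero_module (homology C i) \<longleftrightarrow> cycles C i = boundaries C i"
  unfolding homology_eq zero_mod_quotient_iff[OF cycles_boundaries(5,4)[OF C]]
  using cycles_boundaries(3)[OF C] by auto

lemma is_complex_Hom_complex:
  assumes F: "is_complex R F" and N: "module R N"
  shows "is_complex R (Hom_complex R F N)"
  unfolding is_complex_def
proof (intro conjI allI ballI)
  note D = is_complexD[OF F]
  fix j
  show "module R (obj (Hom_complex R F N) j)" by (simp add: Hom_complex_def module_mod_Hom[OF D(1) N])
  have d: "bd F (1 - j) \<in> mod_hom R (obj F (1 - j)) (obj F (- j))" for j using D(2)[of "1 - j"] by simp
  have c: "f (bd F (1 - j) x) \<in> carrier N"
    if "f \<in> mod_hom R (obj F (- j)) N" "x \<in> carrier (obj F (1 - j))" for f x j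
    by (rule hom_closed[OF that(1) hom_closed[OF d that(2)]])
  show "bd (Hom_complex R F N) j \<in> mod_hom R (obj (Hom_complex R F N) j) (obj (Hom_complex R F N) (j - 1))"
    using c[of _ j] hom_closed[OF d[of j]]
    by (auto simp: Hom_complex_def mod_hom_def[of R "mod_Hom R A B" for A B] hom_restrict_iff[OF D(1)]
        fun_eq_iff intro!: mod_hom_compose[OF d])
  fix f assume "f \<in> carrier (obj (Hom_complex R F N) j)"
  then have f: "f \<in> mod_hom R (obj F (- j)) N" by (simp add: Hom_complex_def)
  have "f (bd F (1 - j) (bd F (2 - j) x)) = \<zero>\<^bsub>N\<^esub>" if "x \<in> carrier (obj F (2 - j))" for x
    using D(4)[OF that] hom_zero[OF D(1) N f] by (simp add: algebra_simps)
  moreover have "bd F (2 - j) x \<in> carrier (obj F (1 - j))" if "x \<in> carrier (obj F (2 - j))" for x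
    using hom_closed[OF D(2) that] by (simp add: algebra_simps)
  ultimately show "bd (Hom_complex R F N) (j - 1) (bd (Hom_complex R F N) j f) = \<zero>\<^bsub>obj (Hom_complex R F N) (j - 2)\<^esub>"
    by (auto simp: Hom_complex_def fun_eq_iff algebra_simps)
qed

text \<open>A cocycle on degree \<open>i + 1\<close> kills the boundaries, which by exactness are
  all cycles, so it is a map on the module of boundaries in degree \<open>i\<close>; it is a
  coboundary exactly if this map extends to \<open>obj F i\<close>. Homological degree
  \<open>- i - 1\<close> is cohomological degree \<open>i + 1\<close>.\<close>

lemma zero_Hom_homology_iff:
  fixes N (structure)
  assumes F: "is_complex R F" and N: "module R N" and exact: "cycles F (i + 1) = boundaries F (i + 1)"
  shows "zero_module (homology (Hom_complex R F N) (- i - 1)) \<longleftrightarrow> hom_ext R (boundary_mod F i) (\<lambda>x. x) (obj F i) N"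
proof -
  let ?H = "Hom_complex R F N"
  note D = is_complexD[OF F]
  interpret N: Module.module R N by (rule N)
  note s = sesD[OF cycles_boundaries(7)[OF F, of i]]
  have d: "bd F (i + 1) \<in> mod_hom R (obj F (i + 1)) (obj F i)" by (rule D)
  have cyc: "f \<in> cycles ?H (- i - 1) \<longleftrightarrow> f \<in> mod_hom R (obj F (i + 1)) N \<and> f \<in> extensional (carrier (obj F (i + 1))) \<and>
      (\<forall>x\<in>carrier (obj F (i + 2)). f (bd F (i + 2) x) = \<zero>)" for f
    by (auto simp: cycles_def Hom_complex_def algebra_simps fun_eq_iff)
  have bou: "boundaries ?H (- i - 1) = (\<lambda>g. \<lambda>x\<in>carrier (obj F (i + 1)). g (bd F (i + 1) x)) ` carrier (mod_Hom R (obj F i) N)"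
    by (simp add: boundaries_def Hom_complex_def algebra_simps)
  have kill: "(\<forall>x\<in>carrier (obj F (i + 2)). f (bd F (i + 2) x) = \<zero>) \<longleftrightarrow> (\<forall>y\<in>cycles F (i + 1). f y = \<zero>)" for f
    unfolding exact boundaries_def by (auto simp: algebra_simps)
  show ?thesis
    unfolding zero_homology_iff[OF is_complex_Hom_complex[OF F N]]
  proof
    assume eq: "cycles ?H (- i - 1) = boundaries ?H (- i - 1)"
    show "hom_ext R (boundary_mod F i) (\<lambda>x. x) (obj F i) N" unfolding hom_ext_def
    proof
      fix f assume f: "f \<in> mod_hom R (boundary_mod F i) N"
      have fd: "(\<lambda>x. f (bd F (i + 1) x)) \<in> mod_hom R (obj F (i + 1)) N" by (rule mod_hom_compose[OF s(5) f])
      have "f (bd F (i + 1) y) = \<zero>" if "y \<in> cycles F (i + 1)" for y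
        using s(9)[of y] that hom_zero[OF s(3) N f] by simp
      then have "(\<lambda>x\<in>carrier (obj F (i + 1)). f (bd F (i + 1) x)) \<in> cycles ?H (- i - 1)"
        unfolding cyc kill using fd by (auto simp: hom_restrict_iff[OF D(1)] cycles_def)
      then obtain g where g: "g \<in> mod_hom R (obj F i) N"
        "(\<lambda>x\<in>carrier (obj F (i + 1)). f (bd F (i + 1) x)) = (\<lambda>x\<in>carrier (obj F (i + 1)). g (bd F (i + 1) x))"
        unfolding eq bou by auto
      have "f (bd F (i + 1) x) = g (bd F (i + 1) x)" if "x \<in> carrier (obj F (i + 1))" for x
        using fun_cong[OF g(2), of x] that by simp
      then show "\<exists>g\<in>mod_hom R (obj F i) N. \<forall>x\<in>carrier (boundary_mod F i). g x = f x"
        using g(1) by (intro bexI[of _ g]) (auto simp: boundaries_def)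
    qed
  next
    assume ext: "hom_ext R (boundary_mod F i) (\<lambda>x. x) (obj F i) N"
    have "cycles ?H (- i - 1) \<subseteq> boundaries ?H (- i - 1)"
    proof
      fix f assume "f \<in> cycles ?H (- i - 1)"
      then have f: "f \<in> mod_hom R (obj F (i + 1)) N" "f \<in> extensional (carrier (obj F (i + 1)))"
        "\<And>y. y \<in> cycles F (i + 1) \<Longrightarrow> f y = \<zero>" unfolding cyc kill by auto
      have "f x = \<zero>" if "x \<in> carrier (obj F (i + 1))" "bd F (i + 1) x = \<zero>\<^bsub>boundary_mod F i\<^esub>" for x
        using that by (intro f(3)) (simp add: cycles_def)
      then obtain f' where f': "f' \<in> mod_hom R (boundary_mod F i) N" "\<And>x. x \<in> carrier (obj F (i + 1)) \<Longrightarrow> f' (bd F (i + 1) x) = f x"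
        using surj_factor[OF s(2,3) N s(5,7) f(1)] by blast
      obtain g where g: "g \<in> mod_hom R (obj F i) N" "\<And>x. x \<in> carrier (boundary_mod F i) \<Longrightarrow> g x = f' x"
        by (rule hom_extE[OF ext f'(1)]) (rule that)
      have "f = (\<lambda>x\<in>carrier (obj F (i + 1)). (\<lambda>y\<in>carrier (obj F i). g y) (bd F (i + 1) x))"
      proof (rule extensionalityI[OF f(2)])
        fix x assume x: "x \<in> carrier (obj F (i + 1))"
        have "g (bd F (i + 1) x) = f x" using g(2) f'(2)[OF x] x by (simp add: boundaries_def)
        then show "f x = (\<lambda>x\<in>carrier (obj F (i + 1)). (\<lambda>y\<in>carrier (obj F i). g y) (bd F (i + 1) x)) x"
          using x hom_closed[OF d x] by simp
      qed simp
      moreover have "(\<lambda>y\<in>carrier (obj F i). g y) \<in> carrier (mod_Hom R (obj F i) N)"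
        unfolding mod_Hom_sel hom_restrict_iff[OF D(1)] using g(1) by (intro conjI restrict_extensional)
      ultimately show "f \<in> boundaries ?H (- i - 1)" unfolding bou by (rule image_eqI)
    qed
    then show "cycles ?H (- i - 1) = boundaries ?H (- i - 1)"
      using cycles_boundaries(3)[OF is_complex_Hom_complex[OF F N]] by blast
  qed
qed

lemma projective_resolution_resolved:
  assumes "projective_resolution R M F" and M: "module R M"
  shows "is_complex R F" "\<And>k. cycles F (int k + 1) = boundaries F (int k + 1)"
    "\<exists>e. resolved_by R M (\<lambda>k. boundary_mod F (int k)) (\<lambda>k. obj F (int k)) e (\<lambda>k. bd F (int k + 1))"
proof -
  note F = assms(1)[unfolded projective_resolution_def]
  show C: "is_complex R F" using F by auto
  show ex: "cycles F (int k + 1) = boundaries F (int k + 1)" for k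
    using F zero_homology_iff[OF C] by auto
  have s: "ses R (boundary_mod F (int (Suc k))) (\<lambda>x. x) (obj F (int (Suc k))) (bd F (int k + 1)) (boundary_mod F (int k))" for k
  proof -
    have *: "int (Suc k) = int k + 1" by simp
    show ?thesis unfolding * ex[symmetric] by (rule cycles_boundaries(7)[OF C])
  qed
  obtain e where e: "e \<in> mod_hom R (obj F 0) M" "e ` carrier (obj F 0) = carrier M"
      "a_kernel (obj F 0) M e = bd F 1 ` carrier (obj F 1)" using F by blast
  have "ses R (boundary_mod F 0) (\<lambda>x. x) (obj F 0) e M"
    by (rule ses_inclusion[OF is_complexD(1)[OF C] M e(1,2)]) (use e(3) in \<open>simp add: boundaries_def a_kernel_eq\<close>)
  then show "\<exists>e. resolved_by R M (\<lambda>k. boundary_mod F (int k)) (\<lambda>k. obj F (int k)) e (\<lambda>k. bd F (int k + 1))"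
    using s F unfolding resolved_by_def by auto
qed

section \<open>Resolutions with finitely generated syzygies\<close>

lemma fin_gen_image_free_mod:
  assumes R: "cring R" and A: "module R A" and f: "f \<in> mod_hom R (free_mod R n) A" "f ` carrier (free_mod R n) = carrier A"
  shows "fin_gen R A"
proof -
  obtain es where es: "length es = n" "set es \<subseteq> carrier A"
      "\<And>xs. xs \<in> carrier (free_mod R n) \<Longrightarrow> f xs = lincomb_zip A xs es"
    using free_mod_hom_eq[OF A f(1)] by blast
  have "carrier A = (\<lambda>xs. lincomb_zip A xs es) ` carrier (free_mod R (length es))"
    unfolding f(2)[symmetric] es(1) using es(3) by (rule image_cong[OF refl])
  then show ?thesis unfolding fin_gen_def lincomb_zip_image using es(2) by blast
qed

lemma fin_gen_submodule:
  assumes R: "cring R" "noetherian_ring R" and A: "module R A" "fin_gen R A" and H: "submodule H R A"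
  shows "fin_gen R (A\<lparr>carrier := H\<rparr>)"
proof -
  obtain es where es: "set es \<subseteq> carrier A" "carrier A = span_over A (carrier R) {\<zero>\<^bsub>A\<^esub>} es"
    using A(2) unfolding fin_gen_def by blast
  then show ?thesis
    using noetherian_submodule_generators[OF R A(1) es(1) H] submoduleD(1)[OF A(1) H]
    unfolding fin_gen_def by simp
qed

text \<open>The free cover is copied to the type \<open>'c\<close> along \<open>u\<close>, so that
  the construction can be iterated on one type. The kernel is finitely generated because
  \<open>R\<close> is Noetherian.\<close>

lemma fin_gen_syzygy:
  fixes N :: "('a, 'n, 'm) module_scheme" and u :: "'a list \<Rightarrow> 'c"
  assumes R: "cring R" "noetherian_ring R" and N: "module R N" "fin_gen R N" and u: "inj u"
  shows "\<exists>(K :: ('a, 'c) module) (G :: ('a, 'c) module) p.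
    ses R K (\<lambda>x. x) G p N \<and> projective_module R G \<and> fin_gen R K"
proof -
  obtain es where es: "set es \<subseteq> carrier N"
      "(\<lambda>xs. lincomb_zip N xs es) ` carrier (free_mod R (length es)) = carrier N"
    using fin_gen_cover[OF N] by blast
  let ?F = "free_mod R (length es)"
  have u: "inj_on u (carrier ?F)" using u by (rule inj_on_subset) simp
  have mF: "module R ?F" by (rule module_free_mod[OF R(1)])
  note t = mod_transport_iso[OF mF u]
  let ?G = "mod_transport u ?F" and ?p = "\<lambda>x. lincomb_zip N (inv_into (carrier ?F) u x) es"
  have p: "?p \<in> mod_hom R ?G N" by (rule mod_hom_compose[OF t(3) hom_lincomb_zip[OF N(1) es(1)]])
  have surj: "?p ` carrier ?G = carrier N"
    unfolding t(5) es(2)[symmetric] image_image by (rule image_cong[OF refl]) (simp only: t(6))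
  have H: "submodule {x \<in> carrier ?G. ?p x = \<zero>\<^bsub>N\<^esub>} R ?G" by (rule submodule_kernel[OF t(1) N(1) p])
  have "fin_gen R ?G" by (rule fin_gen_image_free_mod[OF R(1) t(1,2) t(5)[symmetric]])
  then show ?thesis
    using ses_inclusion[OF t(1) N(1) p surj refl] projective_transport[OF projective_free_mod[OF R(1)] u]
      fin_gen_submodule[OF R t(1) _ H] by blast
qed

text \<open>Dependent choice on pairs of a syzygy and its cover. The initial pair is built
  separately because \<open>M\<close> lives on a type of its own; the clause for
  \<open>n = 0\<close> keeps it as the start.\<close>

lemma fin_gen_resolution:
  fixes M :: "('a, 'b, 'm) module_scheme" and u :: "'a list \<Rightarrow> 'c"
  assumes R: "cring R" "noetherian_ring R" and M: "module R M" "fin_gen R M" and u: "inj u"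
  shows "\<exists>(K :: nat \<Rightarrow> ('a, 'c) module) G e p. resolved_by R M K G e p \<and> (\<forall>k. fin_gen R (K k))"
proof -
  obtain K0 G0 :: "('a, 'c) module" and e where s0: "ses R K0 (\<lambda>x. x) G0 e M" "projective_module R G0" "fin_gen R K0"
    using fin_gen_syzygy[OF R M u] by blast
  define Q where "Q x y \<longleftrightarrow> projective_module R (snd y) \<and> (\<exists>p. ses R (fst y) (\<lambda>x. x) (snd y) p (fst x))"
    for x y :: "('a, 'c) module \<times> ('a, 'c) module"
  have "\<exists>f :: nat \<Rightarrow> ('a, 'c) module \<times> ('a, 'c) module.
      \<forall>n. ((n = 0 \<longrightarrow> f n = (K0, G0)) \<and> module R (fst (f n)) \<and> fin_gen R (fst (f n))) \<and> Q (f n) (f (Suc n))"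
  proof (rule dependent_nat_choice[where P = "\<lambda>n x. (n = 0 \<longrightarrow> x = (K0, G0)) \<and> module R (fst x) \<and> fin_gen R (fst x)" and Q = "\<lambda>n. Q"])
    fix x :: "('a, 'c) module \<times> ('a, 'c) module" and n :: nat
    assume "(n = 0 \<longrightarrow> x = (K0, G0)) \<and> module R (fst x) \<and> fin_gen R (fst x)"
    then obtain K' G' :: "('a, 'c) module" and p
      where *: "ses R K' (\<lambda>x. x) G' p (fst x)" "projective_module R G'" "fin_gen R K'"
      using fin_gen_syzygy[OF R _ _ u, of "fst x"] by blast
    then show "\<exists>y. ((Suc n = 0 \<longrightarrow> y = (K0, G0)) \<and> module R (fst y) \<and> fin_gen R (fst y)) \<and> Q x y"
      using sesD(1)[OF *(1)] by (intro exI[of _ "(K', G')"]) (auto simp: Q_def)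
  qed (use sesD(1)[OF s0(1)] s0(3) in auto)
  then obtain f where f: "f 0 = (K0, G0)" "\<And>n :: nat. fin_gen R (fst (f n))" "\<And>n. Q (f n) (f (Suc n))" by blast
  have "\<forall>n. \<exists>p. ses R (fst (f (Suc n))) (\<lambda>x. x) (snd (f (Suc n))) p (fst (f n))"
    and "projective_module R (snd (f (Suc n)))" for n
    using f(3) by (auto simp: Q_def)
  then obtain p where p: "\<And>n. ses R (fst (f (Suc n))) (\<lambda>x. x) (snd (f (Suc n))) (p n) (fst (f n))"
    "\<And>n. projective_module R (snd (f (Suc n)))" by metis
  have "projective_module R (snd (f n))" for n using p(2) f(1) s0(2) by (cases n) auto
  then have "resolved_by R M (\<lambda>n. fst (f n)) (\<lambda>n. snd (f n)) e p"
    using s0(1) f(1) p(1) by (simp add: resolved_by_def)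
  then show ?thesis using f(2) by blast
qed

text \<open>This makes the choice in \<open>Ext\<close> a proper one; the type is the one prescribed
  there, into which coefficient lists embed by \<open>map Inl\<close>.\<close>

lemma projective_resolution_exists:
  fixes M :: "('a, 'b, 'm) module_scheme"
  assumes R: "cring R" "noetherian_ring R" and M: "module R M" "fin_gen R M"
  shows "\<exists>F :: ('a, ('a, 'b) universe) mod_complex. projective_resolution R M F"
proof -
  have inj: "inj (map Inl :: 'a list \<Rightarrow> ('a, 'b) universe)" by (simp add: inj_def inj_map_eq_map)
  obtain K G :: "nat \<Rightarrow> ('a, ('a, 'b) universe) module" and e p where res: "resolved_by R M K G e p"
    using fin_gen_resolution[OF R M inj] by blast
  note D = resolved_byD[OF res]
  note mG = D(5)
  let ?Z = "(G 0)\<lparr>carrier := {\<zero>\<^bsub>G 0\<^esub>}\<rparr>"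
  have mZ: "module R ?Z" by (rule submoduleD[OF mG submodule_zero[OF mG]])
  have Z: "projective_module R ?Z" by (rule projective_zero[OF mZ]) simp
  \<comment> \<open>Degree \<open>k + 1\<close> uses \<open>p k\<close>, whose values in
    \<open>K k\<close> are read in \<open>G k\<close>; a zero submodule of \<open>G 0\<close> fills
    the negative degrees.\<close>
  define F where "F = \<lparr>obj = (\<lambda>j. if j < 0 then ?Z else G (nat j)),
     bd = (\<lambda>j x. if j < 0 then \<zero>\<^bsub>?Z\<^esub> else if j = 0 then \<zero>\<^bsub>?Z\<^esub> else p (nat j - 1) x)\<rparr>"
  have pG: "p k \<in> mod_hom R (G (Suc k)) (G k)" for k
    using mod_hom_compose[OF sesD(5)[OF D(2)] D(6)] by simp
  have K0: "carrier (K 0) = {x \<in> carrier (G 0). e x = \<zero>\<^bsub>M\<^esub>}" using sesD(8)[OF D(1)] by simp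
  have KS: "carrier (K (Suc k)) = {x \<in> carrier (G (Suc k)). p k x = \<zero>\<^bsub>G k\<^esub>}" for k
    using sesD(8)[OF D(2)[of k]] hom_zero[OF D(4,5,6)] by simp
  have im: "p k ` carrier (G (Suc k)) = carrier (K k)" for k by (rule sesD(7)[OF D(2)])
  have j_cases: "j < 0 \<or> j = 0 \<or> (\<exists>k. j = int (Suc k))" for j :: int
    by (cases j rule: int_cases2) (auto, metis not0_implies_Suc of_nat_Suc)
  have obj: "obj F (int k) = G k" for k by (simp add: F_def)
  have objZ: "j < 0 \<Longrightarrow> obj F j = ?Z" for j by (simp add: F_def)
  have bd: "bd F (int (Suc k)) = p k" for k by (simp add: F_def nat_add_distrib del: of_nat_Suc)
  have bdZ: "j \<le> 0 \<Longrightarrow> bd F j x = \<zero>\<^bsub>?Z\<^esub>" for j x by (simp add: F_def)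
  have C: "is_complex R F"
    unfolding is_complex_def
  proof (intro conjI allI ballI)
    fix j
    show "module R (obj F j)" using mZ mG by (simp add: F_def)
    show "bd F j \<in> mod_hom R (obj F j) (obj F (j - 1))"
    proof (cases "j \<le> 0")
      case True
      have "bd F j = (\<lambda>x. \<zero>\<^bsub>?Z\<^esub>)" using bdZ[OF True] by blast
      then show ?thesis using objZ[of "j - 1"] True hom_const_zero[OF mZ] by simp
    next
      case False
      then obtain k where "j = int (Suc k)" using j_cases[of j] by auto
      then show ?thesis using pG[of k] obj[of k] obj[of "Suc k"] bd[of k] by simp
    qed
    fix x assume x: "x \<in> carrier (obj F j)"
    show "bd F (j - 1) (bd F j x) = \<zero>\<^bsub>obj F (j - 2)\<^esub>"
    proof (cases "j \<le> 1")
      case False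
      define k where "k = nat (j - 2)"
      have k: "j = int (Suc (Suc k))" "j - 1 = int (Suc k)" "j - 2 = int k" using False by (auto simp: k_def)
      have "x \<in> carrier (G (Suc (Suc k)))" using x obj[of "Suc (Suc k)"] k by simp
      then have "p (Suc k) x \<in> carrier (K (Suc k))" using im by blast
      then have "p k (p (Suc k) x) = \<zero>\<^bsub>G k\<^esub>" unfolding KS by simp
      then show ?thesis unfolding k(2,3) unfolding k(1) bd obj .
    qed (use bdZ objZ in auto)
  qed
  have zero: "zero_module (homology F j)" if j0: "j > 0" for j
    unfolding zero_homology_iff[OF C]
  proof -
    obtain k where k: "j = int (Suc k)" using j_cases[of j] j0 by auto
    have 1: "j - 1 = int k" "j + 1 = int (Suc (Suc k))" using k by auto
    show "cycles F j = boundaries F j"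
      unfolding cycles_def boundaries_def 1 unfolding k obj bd im KS ..
  qed
  have "projective_resolution R M F"
    unfolding projective_resolution_def
  proof (intro conjI allI impI C zero)
    show "projective_module R (obj F j)" for j using Z D(3) by (simp add: F_def)
    show "zero_module (obj F j)" if "j < 0" for j using objZ[OF that] by (simp add: zero_module_def)
    have o: "obj F 0 = G 0" "obj F 1 = G (Suc 0)" "bd F 1 = p 0" using obj[of 0] obj[of 1] bd[of 0] by auto
    show "\<exists>e\<in>mod_hom R (obj F 0) M. e ` carrier (obj F 0) = carrier M \<and> a_kernel (obj F 0) M e = bd F 1 ` carrier (obj F 1)"
      unfolding o im K0 a_kernel_eq using sesD(5,7)[OF D(1)] by blast
  qed
  then show ?thesis by blast
qed

section \<open>Complexes whose homology consists of powers of a module\<close>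

lemma mod_power_sel [simp]:
  "x \<in> carrier (mod_power n M) \<longleftrightarrow> x \<in> {..<n} \<rightarrow>\<^sub>E carrier M"
  "\<zero>\<^bsub>mod_power n M\<^esub> = (\<lambda>k\<in>{..<n}. \<zero>\<^bsub>M\<^esub>)"
  "x \<oplus>\<^bsub>mod_power n M\<^esub> y = (\<lambda>k\<in>{..<n}. x k \<oplus>\<^bsub>M\<^esub> y k)"
  "r \<odot>\<^bsub>mod_power n M\<^esub> x = (\<lambda>k\<in>{..<n}. r \<odot>\<^bsub>M\<^esub> x k)"
  by (simp_all add: mod_power_def)

lemma hom_mod_power_coord:
  assumes f: "f \<in> mod_hom R A (mod_power n M)" and j: "j < n"
  shows "(\<lambda>z. f z j) \<in> mod_hom R A M"
  using j hom_closed[OF f] by (auto simp: mod_hom_def[of R A M] hom_add[OF f] hom_smult[OF f] PiE_iff)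

lemma module_mod_power:
  assumes M: "module R M" shows "module R (mod_power n M)"
proof -
  interpret M: Module.module R M by (rule M)
  show ?thesis
  proof (rule module_if_coordinates[where J = "{..<n}" and \<pi> = "\<lambda>k x. x k" and B = "\<lambda>k. M", OF M.R.is_cring M])
    show "(\<lambda>x. x k) \<in> mod_hom R (mod_power n M) M" if "k \<in> {..<n}" for k
      by (rule hom_mod_power_coord[OF hom_id]) (use that in simp)
    show "x = y" if "x \<in> carrier (mod_power n M)" "y \<in> carrier (mod_power n M)" "\<And>k. k \<in> {..<n} \<Longrightarrow> x k = y k" for x y
      by (rule PiE_ext[of x "{..<n}" "\<lambda>_. carrier M" y]) (use that in simp_all)
  qed auto
qed

text \<open>\<open>f\<close> is an isomorphism from the homology in degree \<open>i\<close> to \<open>M\<^sup>n\<close>, lifted to the cycles.\<close>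

definition power_coords ::
  "('a, 'r) ring_scheme \<Rightarrow> ('a, 'c) mod_complex \<Rightarrow> int \<Rightarrow> nat \<Rightarrow> ('a, 'b, 'm) module_scheme \<Rightarrow> ('c \<Rightarrow> nat \<Rightarrow> 'b) \<Rightarrow> bool" where
  "power_coords R C i n M f \<longleftrightarrow> f \<in> mod_hom R (cycle_mod C i) (mod_power n M) \<and>
     f ` cycles C i = carrier (mod_power n M) \<and>
     boundaries C i = {z \<in> cycles C i. \<forall>k<n. f z k = \<zero>\<^bsub>M\<^esub>}"

lemma power_coords_if_iso:
  assumes C: "is_complex R C" and M: "module R M" and iso: "mod_iso R (homology C i) (mod_power n M)"
  shows "\<exists>f. power_coords R C i n M f"
proof -
  note cb = cycles_boundaries[OF C, of i]
  note q = quotient_hom[OF cb(5,4)]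
  let ?Z = "cycle_mod C i" and ?P = "mod_power n M"
  have mP: "module R ?P" by (rule module_mod_power[OF M])
  interpret Z: Module.module R ?Z by (rule cb(5))
  obtain \<phi> where \<phi>: "\<phi> \<in> mod_hom R (mod_quotient ?Z (boundaries C i)) ?P"
      "bij_betw \<phi> (carrier (mod_quotient ?Z (boundaries C i))) (carrier ?P)"
    using iso unfolding mod_iso_def homology_eq by blast
  let ?f = "\<lambda>z. \<phi> (boundaries C i +>\<^bsub>?Z\<^esub> z)"
  have f: "?f \<in> mod_hom R ?Z ?P" by (rule mod_hom_compose[OF q(1) \<phi>(1)])
  have "?f z = \<zero>\<^bsub>?P\<^esub> \<longleftrightarrow> z \<in> boundaries C i" if z: "z \<in> cycles C i" for z
  proof -
    have "?f z = ?f \<zero>\<^bsub>?Z\<^esub> \<longleftrightarrow> boundaries C i +>\<^bsub>?Z\<^esub> z = boundaries C i +>\<^bsub>?Z\<^esub> \<zero>\<^bsub>?Z\<^esub>"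
      by (rule inj_on_eq_iff[OF bij_betw_imp_inj_on[OF \<phi>(2)] hom_closed[OF q(1)] hom_closed[OF q(1) Z.M.zero_closed]])
        (use z in simp)
    then show ?thesis unfolding hom_zero[OF cb(5) mP f] using q(3)[of z] z by simp
  qed
  moreover have "?f z = \<zero>\<^bsub>?P\<^esub> \<longleftrightarrow> (\<forall>k<n. ?f z k = \<zero>\<^bsub>M\<^esub>)" if z: "z \<in> cycles C i" for z
  proof -
    have "?f z \<in> {..<n} \<rightarrow>\<^sub>E carrier M" using hom_closed[OF f, of z] z by simp
    then have "?f z \<in> extensional {..<n}" by (simp add: PiE_def)
    then show ?thesis unfolding mod_power_sel by (auto intro!: extensionalityI[of _ "{..<n}"])
  qed
  moreover have "?f ` cycles C i = carrier ?P"
  proof -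
    have "?f ` cycles C i = \<phi> ` (\<lambda>z. boundaries C i +>\<^bsub>?Z\<^esub> z) ` carrier ?Z" by (simp add: image_image)
    then show ?thesis unfolding q(2) using \<phi>(2) by (simp add: bij_betw_def)
  qed
  ultimately have "power_coords R C i n M ?f"
    using f cb(3) unfolding power_coords_def by auto
  then show ?thesis by blast
qed

text \<open>One copy of \<open>M\<close> is removed at a time: the cycles are filtered by the
  vanishing of the first \<open>j\<close> coordinates, and each term is the kernel of the next
  coordinate on the previous term, which maps onto \<open>M\<close>. So closure under kernels is
  enough. \<open>M'\<close> is a copy of \<open>M\<close> on the type of the complex.\<close>

lemma ext_perp_boundaries_step:
  fixes C :: "('a, nat \<Rightarrow> 'y) mod_complex" and M' :: "('a, nat \<Rightarrow> 'y) module"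
  assumes C: "is_complex R C" and M: "module R M" and Y: "module R Y"
    and f: "power_coords R C i n M f" and e: "e \<in> mod_hom R M M'" "bij_betw e (carrier M) (carrier M')"
    and M': "module R M'" "ext_perp R Y M'" and Z: "ext_perp R Y (cycle_mod C i)"
  shows "ext_perp R Y (boundary_mod C i)"
proof -
  note cb = cycles_boundaries[OF C, of i]
  interpret M: Module.module R M by (rule M)
  define B where "B j = {z \<in> cycles C i. \<forall>k<j. f z k = \<zero>\<^bsub>M\<^esub>}" for j
  have f': "f \<in> mod_hom R (cycle_mod C i) (mod_power n M)" "f ` cycles C i = carrier (mod_power n M)"
    using f unfolding power_coords_def by auto
  have coord: "(\<lambda>z. f z j) \<in> mod_hom R (cycle_mod C i) M" if "j < n" for j
    by (rule hom_mod_power_coord[OF f'(1) that])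
  have "ext_perp R Y ((obj C i)\<lparr>carrier := B j\<rparr>)" if "j \<le> n" for j
    using that
  proof (induction j)
    case 0
    have "B 0 = cycles C i" by (simp add: B_def)
    then show ?case using Z by simp
  next
    case (Suc j)
    then have j: "j < n" and IH: "ext_perp R Y ((obj C i)\<lparr>carrier := B j\<rparr>)" by auto
    let ?Bj = "(obj C i)\<lparr>carrier := B j\<rparr>"
    have Bsub: "B j \<subseteq> cycles C i" by (auto simp: B_def)
    have "submodule (B j) R (cycle_mod C i)"
      using submodule_common_kernel[OF cb(5), of "{..<j}" "\<lambda>_. M" "\<lambda>k z. f z k"] M coord j by (simp add: B_def Ball_def)
    from submoduleD(3)[OF cb(5) this] have mB: "module R ?Bj" by simp
    have p: "(\<lambda>z. e (f z j)) \<in> mod_hom R ?Bj M'"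
      using hom_restrict_dom[OF mod_hom_compose[OF coord[OF j] e(1)], of "B j"] Bsub by simp
    have surj: "(\<lambda>z. e (f z j)) ` carrier ?Bj = carrier M'"
    proof (intro equalityI subsetI)
      fix y assume "y \<in> carrier M'"
      then obtain m where m: "m \<in> carrier M" "y = e m" using e(2) unfolding bij_betw_def by blast
      have "(\<lambda>k\<in>{..<n}. if k = j then m else \<zero>\<^bsub>M\<^esub>) \<in> f ` cycles C i"
        unfolding f'(2) using m(1) by auto
      then obtain z where z: "z \<in> cycles C i" "f z = (\<lambda>k\<in>{..<n}. if k = j then m else \<zero>\<^bsub>M\<^esub>)" by (metis imageE)
      have "z \<in> B j" using z j by (simp add: B_def)
      moreover have "e (f z j) = y" using z(2) j m(2) by simp
      ultimately show "y \<in> (\<lambda>z. e (f z j)) ` carrier ?Bj" by auto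
    qed (use hom_closed[OF p] in auto)
    have "e (f z j) = \<zero>\<^bsub>M'\<^esub> \<longleftrightarrow> f z j = \<zero>\<^bsub>M\<^esub>" if "z \<in> cycles C i" for z
      by (rule hom_inj_zero_iff[OF M M'(1) e(1)]) (use e(2) hom_closed[OF coord[OF j], of z] that in \<open>auto simp: bij_betw_def\<close>)
    then have "B (Suc j) = {z \<in> carrier ?Bj. e (f z j) = \<zero>\<^bsub>M'\<^esub>}"
      by (auto simp: B_def less_Suc_eq)
    from ses_inclusion[OF mB M'(1) p surj this]
    have "ses R ((obj C i)\<lparr>carrier := B (Suc j)\<rparr>) (\<lambda>z. z) ?Bj (\<lambda>z. e (f z j)) M'" by simp
    then show ?case by (rule ext_perp_kernel[OF _ IH M'(2) Y])
  qed
  from this[of n] show ?thesis using f by (simp add: power_coords_def B_def)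
qed

text \<open>\<open>M\<close> is a summand of the cokernel of degree \<open>t + 1\<close> in degree
  \<open>t\<close>, but this cokernel is never formed: the splitting is expressed on the covers by
  \<alpha> and \<beta>, which relates the first syzygy of \<open>M\<close> to the boundaries in
  degree \<open>t\<close>.\<close>

lemma projective_syzygy_exists:
  fixes C :: "('a, nat \<Rightarrow> 'y) mod_complex" and M' :: "('a, nat \<Rightarrow> 'y) module"
  assumes C: "is_complex R C" "\<And>i. projective_module R (obj C i)"
    and lo: "\<And>i. i < lo \<Longrightarrow> zero_module (obj C i)" and hi: "\<And>i. i > hi \<Longrightarrow> zero_module (obj C i)"
    and M: "module R M" "\<not> zero_module M" and f: "\<And>i. power_coords R C i (a i) M (f i)" and a: "a i0 \<noteq> 0"
    and e: "e \<in> mod_hom R M M'" "bij_betw e (carrier M) (carrier M')" and M': "module R M'" "ext_perp R M M'"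
    and res: "resolved_by R M K G \<epsilon> p"
  shows "\<exists>k. projective_module R (K k)"
proof -
  interpret M: Module.module R M by (rule M)
  note D = is_complexD[OF C(1)] and cb = cycles_boundaries[OF C(1)]
  have zero_obj: "carrier (obj C i) = {\<zero>\<^bsub>obj C i\<^esub>}" if "i < lo \<or> i > hi" for i
    using lo hi that unfolding zero_module_def by blast
  have B_zero: "boundaries C i = {\<zero>\<^bsub>obj C i\<^esub>}" if "i < lo \<or> i > hi" for i
    using zero_obj[OF that] cb(2)[of i] submoduleD(1,2)[OF D(1) cb(2), of i] by auto
  \<comment> \<open>Here \<open>M \<noteq> 0\<close> enters: a positive power of it is not zero, so
    \<open>a i\<close> vanishes where the complex does, and a top degree \<open>t\<close>
    exists.\<close>
  have a_zero: "a i = 0" if i: "i < lo \<or> i > hi" for i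
  proof (rule ccontr)
    assume "a i \<noteq> 0"
    obtain m where m: "m \<in> carrier M" "m \<noteq> \<zero>\<^bsub>M\<^esub>" using M(2) M.M.zero_closed unfolding zero_module_def by blast
    have "(\<lambda>k\<in>{..<a i}. m) \<in> f i ` cycles C i"
      using f[of i] m(1) unfolding power_coords_def by auto
    then obtain z where z: "z \<in> cycles C i" "f i z = (\<lambda>k\<in>{..<a i}. m)" by (metis imageE)
    have "z \<in> boundaries C i" using z(1) B_zero[OF i] zero_obj[OF i] by (auto simp: cycles_def)
    then have "f i z 0 = \<zero>\<^bsub>M\<^esub>" using f[of i] \<open>a i \<noteq> 0\<close> unfolding power_coords_def by auto
    then show False using z(2) m(2) \<open>a i \<noteq> 0\<close> by simp
  qed
  have fin: "finite {i. a i \<noteq> 0}"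
    by (rule finite_subset[of _ "{lo..hi}"]) (use a_zero in \<open>auto simp: not_less[symmetric]\<close>)
  define t where "t = Max {i. a i \<noteq> 0}"
  have t: "a t \<noteq> 0" using Max_in[OF fin] a unfolding t_def by auto
  have above: "a i = 0" if "i > t" for i using Max_ge[OF fin, of i] that unfolding t_def by auto
  \<comment> \<open>The start is one degree below \<open>lo\<close>, where boundaries are zero.
    Cycles in the next degree are the kernel of a projective mapping onto the boundaries, and
    \<open>ext_perp_boundaries_step\<close> passes from these cycles to their boundaries.\<close>
  have perp: "ext_perp R M (boundary_mod C (lo - 1 + int n))" for n
  proof (induction n)
    case 0
    show ?case by (rule ext_perp_zero[OF cb(6)]) (use B_zero[of "lo - 1"] in simp)
  next
    case (Suc n)
    have "ext_perp R M (cycle_mod C (lo - 1 + int n + 1))"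
      by (rule ext_perp_kernel[OF cb(7) ext_perp_projective[OF C(2) M(1)] Suc M(1)])
    then have "ext_perp R M (cycle_mod C (lo - 1 + int (Suc n)))" by (simp add: algebra_simps)
    then show ?case by (rule ext_perp_boundaries_step[OF C(1) M(1) M(1) f e M'])
  qed
  have "t \<ge> lo" using a_zero[of t] t by linarith
  then have "ext_perp R M (boundary_mod C (t - 1))" using perp[of "nat (t - lo)"] by simp
  then have ext: "hom_ext R (cycle_mod C t) (\<lambda>x. x) (obj C t) M"
    using ext_perp_hom_ext[OF _ M(1) cb(7)[of "t - 1"] C(2)] by simp
  note ft = f[of t, unfolded power_coords_def]
  have f': "f t \<in> mod_hom R (cycle_mod C t) (mod_power (a t) M)" using ft by blast
  have coord: "(\<lambda>z. f t z j) \<in> mod_hom R (cycle_mod C t) M" if "j < a t" for j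
    by (rule hom_mod_power_coord[OF f' that])
  \<comment> \<open>The first coordinate on the cycles, available since \<open>a t\<close> is
    nonzero, extended to all of degree \<open>t\<close>.\<close>
  obtain q where q: "q \<in> mod_hom R (obj C t) M" "\<And>z. z \<in> cycles C t \<Longrightarrow> q z = f t z 0"
    using hom_extE[OF ext coord[of 0]] t by auto
  have B_iff: "z \<in> boundaries C t \<longleftrightarrow> z \<in> cycles C t \<and> (\<forall>k<a t. f t z k = \<zero>\<^bsub>M\<^esub>)" for z
    using ft by blast
  \<comment> \<open>The cycles representing the first copy of \<open>M\<close> in the homology:
    \<open>q\<close> maps \<open>S\<close> onto \<open>M\<close>, with the boundaries as
    kernel.\<close>
  define S where "S = {z \<in> cycles C t. \<forall>k<a t. k \<noteq> 0 \<longrightarrow> f t z k = \<zero>\<^bsub>M\<^esub>}"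
  note ZD = submoduleD[OF D(1) cb(1)[of t]]
  have "submodule S R (cycle_mod C t)"
    using submodule_common_kernel[OF cb(5)[of t], of "{k. k < a t \<and> k \<noteq> 0}" "\<lambda>_. M" "\<lambda>k z. f t z k"] M(1) coord by (simp add: S_def Ball_def imp_conjL)
  from submoduleD(3)[OF cb(5) this] have mS: "module R ((obj C t)\<lparr>carrier := S\<rparr>)" by simp
  have Ssub: "S \<subseteq> cycles C t" "S \<subseteq> carrier (obj C t)" using ZD(1) by (auto simp: S_def)
  have qS: "q \<in> mod_hom R ((obj C t)\<lparr>carrier := S\<rparr>) M" by (rule hom_restrict_dom[OF q(1) Ssub(2)])
  have qSs: "q ` carrier ((obj C t)\<lparr>carrier := S\<rparr>) = carrier M"
  proof (intro equalityI subsetI)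
    fix m assume m: "m \<in> carrier M"
    have "(\<lambda>k\<in>{..<a t}. if k = 0 then m else \<zero>\<^bsub>M\<^esub>) \<in> f t ` cycles C t"
      using ft m by auto
    then obtain z where z: "z \<in> cycles C t" "f t z = (\<lambda>k\<in>{..<a t}. if k = 0 then m else \<zero>\<^bsub>M\<^esub>)" by (metis imageE)
    have "z \<in> S" using z by (simp add: S_def)
    moreover have "q z = m" using q(2)[OF z(1)] z(2) t by simp
    ultimately show "m \<in> q ` carrier ((obj C t)\<lparr>carrier := S\<rparr>)" by auto
  qed (use hom_closed[OF qS] in auto)
  note E = resolved_byD[OF res]
  note s0 = sesD[OF E(1)]
  \<comment> \<open>\<alpha> covers the inclusion of \<open>M\<close> as this first copy, and
    \<beta> covers \<open>q\<close>. They compose to the identity on \<open>M\<close>, so \<beta>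
    after \<alpha> differs from the identity of \<open>G 0\<close> by a map into \<open>K 0\<close>,
    the homotopy \<open>h\<close>.\<close>
  obtain \<alpha> where \<alpha>: "\<alpha> \<in> mod_hom R (G 0) ((obj C t)\<lparr>carrier := S\<rparr>)"
      "\<And>x. x \<in> carrier (G 0) \<Longrightarrow> q (\<alpha> x) = \<epsilon> x"
    using projective_module_lift[OF E(3) mS M(1) qS qSs s0(5)] by blast
  obtain \<beta> where \<beta>: "\<beta> \<in> mod_hom R (obj C t) (G 0)" "\<And>x. x \<in> carrier (obj C t) \<Longrightarrow> \<epsilon> (\<beta> x) = q x"
    using projective_module_lift[OF C(2) s0(2,3,5,7) q(1)] by blast
  have \<alpha>': "\<alpha> \<in> mod_hom R (G 0) (obj C t)" by (rule hom_extend_cod[OF \<alpha>(1) Ssub(2)])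
  have \<alpha>S: "\<alpha> x \<in> S" if "x \<in> carrier (G 0)" for x using hom_closed[OF \<alpha>(1) that] by simp
  have \<alpha>B: "\<alpha> x \<in> boundaries C t" if x: "x \<in> carrier (K 0)" for x
  proof -
    have ix: "x \<in> carrier (G 0)" by (rule hom_closed[OF s0(4) x])
    have "q (\<alpha> x) = \<zero>\<^bsub>M\<^esub>" using \<alpha>(2)[OF ix] s0(9)[OF x] by simp
    then have "f t (\<alpha> x) 0 = \<zero>\<^bsub>M\<^esub>" using q(2) \<alpha>S[OF ix] Ssub(1) by auto
    then show ?thesis using \<alpha>S[OF ix] unfolding B_iff S_def by auto
  qed
  have a1: "\<alpha> \<in> mod_hom R (K 0) (boundary_mod C t)"
    by (rule hom_restrict_cod[OF _ \<alpha>B]) (use mod_hom_compose[OF s0(4) \<alpha>'] in simp_all)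
  have Bsub: "boundaries C t \<subseteq> carrier (obj C t)" by (rule submoduleD[OF D(1) cb(2)])
  have "\<epsilon> (\<beta> z) = \<zero>\<^bsub>M\<^esub>" if "z \<in> carrier (boundary_mod C t)" for z
  proof -
    have z: "z \<in> cycles C t" "f t z 0 = \<zero>\<^bsub>M\<^esub>" "z \<in> carrier (obj C t)"
      using that t Bsub B_iff[of z] by auto
    then show ?thesis using \<beta>(2)[OF z(3)] q(2)[OF z(1)] by simp
  qed
  then obtain b1 where b1: "b1 \<in> mod_hom R (boundary_mod C t) (K 0)" "\<And>z. z \<in> boundaries C t \<Longrightarrow> b1 z = \<beta> z"
    using ses_lift[OF E(1) cb(6) hom_restrict_dom[OF \<beta>(1) Bsub]] by auto
  interpret G0: Module.module R "G 0" by (rule E)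
  interpret K0: Module.module R "K 0" by (rule E)
  have \<beta>\<alpha>: "\<beta> (\<alpha> x) \<in> carrier (G 0)" "\<epsilon> (\<beta> (\<alpha> x)) = \<epsilon> x" if "x \<in> carrier (G 0)" for x
  proof -
    have ax: "\<alpha> x \<in> carrier (obj C t)" by (rule hom_closed[OF \<alpha>' that])
    show "\<beta> (\<alpha> x) \<in> carrier (G 0)" by (rule hom_closed[OF \<beta>(1) ax])
    show "\<epsilon> (\<beta> (\<alpha> x)) = \<epsilon> x" using \<beta>(2)[OF ax] \<alpha>(2)[OF that] by simp
  qed
  have "\<epsilon> (x \<ominus>\<^bsub>G 0\<^esub> \<beta> (\<alpha> x)) = \<zero>\<^bsub>M\<^esub>" if x: "x \<in> carrier (G 0)" for x
    using hom_minus[OF s0(2,3,5) x \<beta>\<alpha>(1)[OF x]] \<beta>\<alpha>(2)[OF x] hom_closed[OF s0(5) x] by simp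
  then obtain h where h: "h \<in> mod_hom R (G 0) (K 0)" "\<And>x. x \<in> carrier (G 0) \<Longrightarrow> h x = x \<ominus>\<^bsub>G 0\<^esub> \<beta> (\<alpha> x)"
    using ses_lift[OF E(1,5) hom_diff[OF E(5,5) hom_id mod_hom_compose[OF \<alpha>' \<beta>(1)]]] by blast
  have "b1 (\<alpha> x) \<oplus>\<^bsub>K 0\<^esub> h x = \<one>\<^bsub>R\<^esub> \<odot>\<^bsub>K 0\<^esub> x" if x: "x \<in> carrier (K 0)" for x
  proof -
    have ix: "x \<in> carrier (G 0)" by (rule hom_closed[OF s0(4) x])
    have c: "b1 (\<alpha> x) \<in> carrier (K 0)" "h x \<in> carrier (K 0)"
      using hom_closed[OF b1(1)] \<alpha>B[OF x] hom_closed[OF h(1) ix] by auto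
    show ?thesis
      unfolding hom_add[OF s0(4) c] unfolding b1(2)[OF \<alpha>B[OF x]] h(2)[OF ix] K0.smult_one[OF x]
      by (rule G0.M.add_minus_cancel(1)[OF ix \<beta>\<alpha>(1)[OF ix]])
  qed
  then have rel: "syzygy_rel R \<one>\<^bsub>R\<^esub> (K 0) (\<lambda>x. x) (G 0) (boundary_mod C t) (\<lambda>x. x) (obj C t)"
    unfolding syzygy_rel_def
    by (intro bexI[OF _ \<alpha>'] bexI[OF _ a1] bexI[OF _ b1(1)] bexI[OF _ h(1)]) auto
  \<comment> \<open>Above \<open>t\<close> the homology is a power with exponent 0, so boundaries
    and cycles agree and the complex continues as a resolution.\<close>
  have s': "ses R (boundary_mod C (t + int (Suc k))) (\<lambda>x. x) (obj C (t + int (Suc k))) (bd C (t + int (Suc k))) (boundary_mod C (t + int k))" for k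
  proof -
    have "boundaries C (t + int k + 1) = cycles C (t + int k + 1)"
      using f[of "t + int k + 1"] above[of "t + int k + 1"] unfolding power_coords_def by simp
    then show ?thesis using cb(7)[of "t + int k"] by (simp add: algebra_simps)
  qed
  \<comment> \<open>Far enough to pass \<open>hi\<close>, where the boundaries are zero; the
    homotopy then retracts \<open>G k\<close> onto \<open>K k\<close>.\<close>
  define k where "k = nat (hi + 1 - t)"
  have k: "t + int k > hi" by (simp add: k_def)
  have "syzygy_rel R \<one>\<^bsub>R\<^esub> (K k) (\<lambda>x. x) (G k) (boundary_mod C (t + int k)) (\<lambda>x. x) (obj C (t + int k))"
    by (rule syzygy_rel_chain[where K' = "\<lambda>k. boundary_mod C (t + int k)" and G' = "\<lambda>k. obj C (t + int k)",
          OF _ M.R.one_closed res s' C(2)]) (use rel in simp)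
  from syzygy_rel_zero[OF this E(4) cb(6) _ E(6) M.R.one_closed]
  obtain h' where h': "h' \<in> mod_hom R (G k) (K k)" "\<And>x. x \<in> carrier (K k) \<Longrightarrow> h' x = \<one>\<^bsub>R\<^esub> \<odot>\<^bsub>K k\<^esub> x"
    using B_zero k by auto
  have "projective_module R (K k)"
    by (rule projective_retract[OF E(3,4,6) h'(1)]) (use h'(2) module.smult_one[OF E(4)] in auto)
  then show ?thesis by blast
qed

text \<open>Moves a quasi-projective resolution from its own type to the one that also holds
  \<open>M\<close> and its syzygies, since \<open>ext_perp\<close> handles a single type.\<close>

definition transport_complex :: "('p \<Rightarrow> 'q) \<Rightarrow> ('a, 'p) mod_complex \<Rightarrow> ('a, 'q) mod_complex" where
  "transport_complex u P = \<lparr>obj = (\<lambda>i. mod_transport u (obj P i)), bd = (\<lambda>i x. u (bd P i (inv_into UNIV u x)))\<rparr>"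

lemma transport_complex:
  assumes P: "is_complex R P" and u: "inj u"
  shows "is_complex R (transport_complex u P)" (is "is_complex R ?C")
    and "zero_module (obj (transport_complex u P) i) \<longleftrightarrow> zero_module (obj P i)"
    and "projective_module R (obj P i) \<Longrightarrow> projective_module R (obj (transport_complex u P) i)"
    and "power_coords R P i n M f \<Longrightarrow> power_coords R (transport_complex u P) i n M (\<lambda>x. f (inv_into UNIV u x))"
proof -
  note D = is_complexD[OF P]
  have ui: "inj_on u A" for A using u by (rule inj_on_subset) simp
  note t = mod_transport_iso[OF D(1) ui]
  have iu [simp]: "inv_into UNIV u (u x) = x" for x using u by simp
  have obj: "obj ?C i = mod_transport u (obj P i)" and bd: "bd ?C i x = u (bd P i (inv_into UNIV u x))" for i x
    by (simp_all add: transport_complex_def)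
  have z: "\<zero>\<^bsub>obj ?C i\<^esub> = u \<zero>\<^bsub>obj P i\<^esub>" for i using hom_zero[OF D(1) t(1,2)] by (simp add: obj)
  have c: "carrier (obj ?C i) = u ` carrier (obj P i)" for i unfolding obj by (rule t(5))
  have inv_hom: "inv_into UNIV u \<in> mod_hom R (obj ?C i) (obj P i)" for i
    unfolding obj by (rule hom_cong[OF t(1) t(3)]) (auto simp: t(5,6))
  show C: "is_complex R ?C"
    unfolding is_complex_def
  proof (intro conjI allI ballI)
    fix i
    show "module R (obj ?C i)" unfolding obj by (rule t(1))
    have "(\<lambda>x. u (bd P i (inv_into UNIV u x))) \<in> mod_hom R (obj ?C i) (obj ?C (i - 1))"
      using mod_hom_compose[OF mod_hom_compose[OF inv_hom D(2)] t(2)] by (simp only: obj)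
    then show "bd ?C i \<in> mod_hom R (obj ?C i) (obj ?C (i - 1))" by (simp only: bd[abs_def])
    fix x assume "x \<in> carrier (obj ?C i)"
    then show "bd ?C (i - 1) (bd ?C i x) = \<zero>\<^bsub>obj ?C (i - 2)\<^esub>" unfolding c z bd using D(4) by auto
  qed
  show "zero_module (obj ?C i) \<longleftrightarrow> zero_module (obj P i)"
    unfolding zero_module_def c z using inj_image_eq_iff[OF u, of "carrier (obj P i)" "{\<zero>\<^bsub>obj P i\<^esub>}"] by simp
  show "projective_module R (obj ?C i)" if "projective_module R (obj P i)"
    unfolding obj by (rule projective_transport[OF that ui])
  have cyc: "cycles ?C i = u ` cycles P i" for i
    unfolding cycles_def c z bd by (auto simp: inj_eq[OF u])
  have bou: "boundaries ?C i = u ` boundaries P i" for i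
    unfolding boundaries_def c by (auto simp: image_image bd)
  assume f: "power_coords R P i n M f"
  have fh: "f \<in> mod_hom R (cycle_mod P i) (mod_power n M)" and fs: "f ` cycles P i = carrier (mod_power n M)"
    and fb: "boundaries P i = {z \<in> cycles P i. \<forall>k<n. f z k = \<zero>\<^bsub>M\<^esub>}" using f unfolding power_coords_def by auto
  have "inv_into UNIV u \<in> mod_hom R (cycle_mod ?C i) (cycle_mod P i)"
    by (rule hom_restrict_cod[OF hom_restrict_dom[OF inv_hom]])
      (use submoduleD(1)[OF is_complexD(1)[OF C] cycles_boundaries(1)[OF C]] in \<open>auto simp: cyc\<close>)
  from mod_hom_compose[OF this fh] show "power_coords R ?C i n M (\<lambda>x. f (inv_into UNIV u x))"
    unfolding power_coords_def cyc bou fb fs[symmetric] by (auto simp: image_image)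
qed

text \<open>An infimum below infinity is taken over a nonempty set, so a finite quasi-projective
  resolution exists; its extended real bounds become integer bounds.\<close>

lemma qpd_finiteD:
  fixes M :: "('a, 'b, 'm) module_scheme"
  assumes M: "module R M" "\<not> zero_module M" and "qpd TYPE('p) R M < \<infinity>"
  shows "\<exists>(P :: ('a, 'p) mod_complex) lo hi a f. is_complex R P \<and> (\<forall>i. projective_module R (obj P i)) \<and>
    (\<forall>i<lo. zero_module (obj P i)) \<and> (\<forall>i>hi. zero_module (obj P i)) \<and>
    (\<exists>i. a i \<noteq> 0) \<and> (\<forall>i. power_coords R P i (a i) M (f i))"
proof -
  have "(INF P\<in>{P :: ('a, 'p) mod_complex. finite_quasi_projective_resolution R M P}. csup P - hsup P) < \<infinity>"
    using assms(3) M(2) by (simp only: qpd_def if_False)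
  then obtain P :: "('a, 'p) mod_complex" where fin: "finite_quasi_projective_resolution R M P"
    unfolding INF_less_iff by blast
  then have q: "quasi_projective_resolution R M P" "csup P < \<infinity>"
    unfolding finite_quasi_projective_resolution_def by auto
  then have P: "is_complex R P" "\<And>i. projective_module R (obj P i)" and inf: "cinf P > - \<infinity>"
    unfolding quasi_projective_resolution_def by auto
  obtain a where a: "\<exists>i. cinf P \<le> ereal (of_int i) \<and> a i \<noteq> 0"
      "\<And>i. cinf P \<le> ereal (of_int i) \<Longrightarrow> mod_iso R (homology P i) (mod_power (a i) M)"
    using q(1) unfolding quasi_projective_resolution_def by blast
  have cinf_le: "cinf P \<le> ereal (of_int i)" and csup_ge: "ereal (of_int i) \<le> csup P" if "\<not> zero_module (obj P i)" for i
    using that unfolding cinf_def csup_def by (auto intro: INF_lower SUP_upper)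
  obtain x where x: "ereal x < cinf P" using ereal_dense2[OF inf] by blast
  obtain y where y: "csup P < ereal y" using ereal_dense2[OF q(2)] by blast
  have lo: "zero_module (obj P i)" if "i < \<lfloor>x\<rfloor>" for i
  proof (rule ccontr)
    assume "\<not> zero_module (obj P i)"
    from less_le_trans[OF x cinf_le[OF this]] have "x < of_int i" by simp
    then show False using that by linarith
  qed
  have hi: "zero_module (obj P i)" if "i > \<lceil>y\<rceil>" for i
  proof (rule ccontr)
    assume "\<not> zero_module (obj P i)"
    from le_less_trans[OF csup_ge[OF this] y] have "of_int i < y" by simp
    then show False using that by linarith
  qed
  \<comment> \<open>The homology is prescribed only from \<open>cinf P\<close> on. Below it the
    complex is zero, so exponent 0 is correct there.\<close>
  let ?a = "\<lambda>i. if cinf P \<le> ereal (of_int i) then a i else 0"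
  have "\<exists>f. power_coords R P i (?a i) M f" for i
  proof (cases "cinf P \<le> ereal (of_int i)")
    case True
    then show ?thesis using power_coords_if_iso[OF P(1) M(1) a(2)[OF True]] by simp
  next
    case False
    then have z: "carrier (obj P i) = {\<zero>\<^bsub>obj P i\<^esub>}" using cinf_le unfolding zero_module_def by blast
    note cb = cycles_boundaries[OF P(1), of i]
    have "cycles P i = {\<zero>\<^bsub>obj P i\<^esub>}" "boundaries P i = {\<zero>\<^bsub>obj P i\<^esub>}"
      using z submoduleD(1,2)[OF is_complexD(1)[OF P(1)] cb(1)] submoduleD(1,2)[OF is_complexD(1)[OF P(1)] cb(2)] by auto
    then have "power_coords R P i 0 M (\<lambda>x. \<zero>\<^bsub>mod_power 0 M\<^esub>)"
      unfolding power_coords_def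
      using hom_const_zero[OF module_mod_power[OF M(1)], of 0 "cycle_mod P i"] by (auto simp: restrict_def)
    then show ?thesis using False by auto
  qed
  then obtain f where f: "\<And>i. power_coords R P i (?a i) M (f i)" by metis
  have "\<exists>i. ?a i \<noteq> 0" using a(1) by auto
  then show ?thesis using P lo hi f
    by (intro exI[of _ P] exI[of _ "\<lfloor>x\<rfloor>"] exI[of _ "\<lceil>y\<rceil>"] exI[of _ ?a] exI[of _ f]) blast
qed

theorem theorem1p4:
  fixes R :: "('a, 'r) ring_scheme" and M :: "('a, 'b, 'm) module_scheme"
  assumes "cring R" and "noetherian_ring R"
    and "module R M" and "finitely_generated_module R M"
    and "qpd TYPE('p) R M < \<infinity>"
  shows "(\<forall>i>0. zero_module (Ext R i M M)) \<longleftrightarrow> projective_module R M"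
proof -
  note R = assms(1,2) and M = assms(3)
  interpret M: Module.module R M by (rule M)
  have fg: "fin_gen R M" by (rule fin_gen_if_finitely_generated[OF M assms(4)])
  define F where "F = (SOME F :: ('a, ('a, 'b) universe) mod_complex. projective_resolution R M F)"
  have F: "projective_resolution R M F"
    unfolding F_def using projective_resolution_exists[OF R M fg] by (rule someI_ex)
  note FS = projective_resolution_resolved[OF F M]
  let ?B = "\<lambda>k. boundary_mod F (int k)" and ?F = "\<lambda>k. obj F (int k)"
  obtain \<epsilon> where res: "resolved_by R M ?B ?F \<epsilon> (\<lambda>k. bd F (int k + 1))" using FS(3) by blast
  note D = resolved_byD[OF res]
  have "(\<forall>i>0. zero_module (Ext R i M M)) \<longleftrightarrow> (\<forall>k. zero_module (Ext R (Suc k) M M))"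
    by (metis gr0_implies_Suc zero_less_Suc)
  also have "\<dots> \<longleftrightarrow> (\<forall>k. hom_ext R (?B k) (\<lambda>x. x) (?F k) M)"
  proof (intro iff_allI)
    fix k
    have "- int (Suc k) = - int k - 1" by simp
    then show "zero_module (Ext R (Suc k) M M) \<longleftrightarrow> hom_ext R (?B k) (\<lambda>x. x) (?F k) M"
      using zero_Hom_homology_iff[OF FS(1) M FS(2)] unfolding Ext_def F_def[symmetric] by (simp only:)
  qed
  finally have Ext_iff: "(\<forall>i>0. zero_module (Ext R i M M)) \<longleftrightarrow> (\<forall>k. hom_ext R (?B k) (\<lambda>x. x) (?F k) M)" .
  show ?thesis unfolding Ext_iff
  proof
    assume proj: "projective_module R M"
    \<comment> \<open>A projective \<open>M\<close> splits its cover, so multiplication by 1 is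
      null-homotopic on the resolution and every syzygy is a retract of its cover.\<close>
    obtain w where w: "w \<in> mod_hom R M (?F 0)" "\<And>x. x \<in> carrier M \<Longrightarrow> \<epsilon> (w x) = \<one>\<^bsub>R\<^esub> \<odot>\<^bsub>M\<^esub> x"
      using projective_module_lift[OF proj sesD(2,3,5,7)[OF D(1)] hom_id] by auto
    show "\<forall>k. hom_ext R (?B k) (\<lambda>x. x) (?F k) M" unfolding hom_ext_def
    proof (intro allI ballI)
      fix k f assume f: "f \<in> mod_hom R (?B k) M"
      obtain h where h: "h \<in> mod_hom R (?F k) (?B k)" "\<forall>x\<in>carrier (?B k). h x = \<one>\<^bsub>R\<^esub> \<odot>\<^bsub>?B k\<^esub> x"
        using syzygy_rel_zero_chain[OF res M.R.one_closed w] by blast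
      show "\<exists>g\<in>mod_hom R (?F k) M. \<forall>x\<in>carrier (?B k). g x = f x"
        using h(2) module.smult_one[OF D(4), of _ k] by (intro bexI[OF _ mod_hom_compose[OF h(1) f]]) auto
    qed
  next
    assume ext: "\<forall>k. hom_ext R (?B k) (\<lambda>x. x) (?F k) M"
    show "projective_module R M"
    proof (cases "zero_module M")
      case True
      then show ?thesis using projective_zero[OF M] unfolding zero_module_def by blast
    next
      case False
      obtain P :: "('a, 'p) mod_complex" and lo hi a f where P: "is_complex R P" "\<And>i. projective_module R (obj P i)"
        "\<And>i. i < lo \<Longrightarrow> zero_module (obj P i)" "\<And>i. i > hi \<Longrightarrow> zero_module (obj P i)"
        and a: "\<exists>i. a i \<noteq> 0" and f: "\<And>i. power_coords R P i (a i) M (f i)"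
        using qpd_finiteD[OF M False assms(5)] by blast
      obtain i0 where i0: "a i0 \<noteq> 0" using a by blast
      \<comment> \<open>One type for everything: the left summand holds coefficient lists and
        \<open>M\<close>, the right one \<open>P\<close>; functions on \<open>nat\<close> provide
        the closure under pairing.\<close>
      define uL :: "'a list \<Rightarrow> nat \<Rightarrow> ('a, 'b) universe + 'p" where "uL x = (\<lambda>_. Inl (map Inl x))" for x
      define uM :: "'b \<Rightarrow> nat \<Rightarrow> ('a, 'b) universe + 'p" where "uM x = (\<lambda>_. Inl [Inr x])" for x
      define uP :: "'p \<Rightarrow> nat \<Rightarrow> ('a, 'b) universe + 'p" where "uP x = (\<lambda>_. Inr x)" for x
      have uL: "inj uL" and uM: "inj_on uM (carrier M)" and uP: "inj uP"
        by (auto simp: inj_on_def uL_def uM_def uP_def fun_eq_iff inj_map_eq_map)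
      note t = mod_transport_iso[OF M uM]
      \<comment> \<open>The resolution chosen in \<open>Ext\<close> need not have finitely generated
        syzygies, as the splitting criterion demands, so a second one is taken and the vanishing is
        carried over to it.\<close>
      obtain L H :: "nat \<Rightarrow> ('a, nat \<Rightarrow> ('a, 'b) universe + 'p) module" and e p where resL: "resolved_by R M L H e p" and L: "\<And>k. fin_gen R (L k)"
        using fin_gen_resolution[OF R M fg uL] by blast
      note DL = resolved_byD[OF resL]
      have extL: "hom_ext R (L k) (\<lambda>x. x) (H k) M" for k
      proof (rule syzygy_rel_hom_ext[OF _ DL(4,5) M DL(6)])
        show "syzygy_rel R \<one>\<^bsub>R\<^esub> (L k) (\<lambda>x. x) (H k) (?B k) (\<lambda>x. x) (?F k)"
          by (rule syzygy_rel_resolutions[OF resL res hom_id hom_id hom_const_zero[OF DL(5)] M.R.one_closed])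
            (simp add: hom_zero[OF sesD(2,3,5)[OF DL(1)]])
      qed (use ext in blast)
      have "resolved_by R (mod_transport uM M) L H (\<lambda>x. uM (e x)) p"
        using resL ses_iso[OF DL(1) t(1,2,4)] unfolding resolved_by_def by blast
      then have perp: "ext_perp R M (mod_transport uM M)" using extL by (rule ext_perp_if_resolved)
      note C = transport_complex[OF P(1) uP]
      obtain n where "projective_module R (L n)"
        using projective_syzygy_exists[OF C(1) C(3)[OF P(2)] C(2)[THEN iffD2, OF P(3)] C(2)[THEN iffD2, OF P(4)]
            M False C(4)[OF f] i0 t(2,4,1) perp resL] by blast
      then show ?thesis by (rule projective_if_projective_syzygy[OF resL fg L extL])
    qed
  qed
qed

end
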